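(* Let $k$ be an algebraically closed field of characteristic $2$. With respect to the ordering $S_1,S_2,S_3,S_4$ of the simple $kA_5$-modules, the Cartan matrix $(C_{S_iS_j})$ of $kA_5$ is $$\begin{bmatrix}4&2&2&0\\2&2&1&0\\2&1&2&0\\0&0&0&1\end{bmatrix}.$$
   Context: The simple left $kA_5$-modules are $S_1,S_2,S_3,S_4$: $S_1=k_{A_5}$ is the trivial module; $S_2$ is the two-dimensional module obtained from an isomorphism $A_5\cong SL_2(\mathbb F_4)$ and the natural action on $\mathbb F_4^2$, extending scalars from $\mathbb F_4\subseteq k$ to $k$; $S_3$ is the two-dimensional module obtained from $S_2$ by applying the nontrivial automorphism of $\mathbb F_4$ to the matrix entries; $S_4$ is the four-dimensional submodule, consisting of vectors with coordinate sum $0$, of the permutation module $k^5$ of $A_5$ acting on $\{1,\dots,5\}$. The Cartan invariant $C_{ST}$ is the multiplicity of the simple module $S$ as a composition factor of the projective cover $P_T$ of the simple module $T$. *)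

theory Defs
  imports
    "HOL-Algebra.Sym_Groups"
    "HOL-Algebra.AbelCoset"
    "HOL-Algebra.Module"
    "Jordan_Normal_Form.Determinant"
begin

hide_const (open) Polynomial.smult

section \<open>Left modules over a ring\<close>

text \<open>
  The library locale \<open>module\<close> requires a commutative ring of scalars, so left modules over an
  arbitrary ring are introduced here, on the same record type. The fields \<open>mult\<close> and \<open>one\<close> of that
  record play no role for a module. The library locale \<open>submodule\<close> does not need commutativity
  and is used as it is.
\<close>

locale left_module = R?: ring + M?: abelian_group M for M (structure) +
  assumes smult_closed:
      "\<lbrakk>a \<in> carrier R; x \<in> carrier M\<rbrakk> \<Longrightarrow> a \<odot>\<^bsub>M\<^esub> x \<in> carrier M"
    and smult_l_distr:
      "\<lbrakk>a \<in> carrier R; b \<in> carrier R; x \<in> carrier M\<rbrakk> \<Longrightarrow>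
        (a \<oplus> b) \<odot>\<^bsub>M\<^esub> x = a \<odot>\<^bsub>M\<^esub> x \<oplus>\<^bsub>M\<^esub> b \<odot>\<^bsub>M\<^esub> x"
    and smult_r_distr:
      "\<lbrakk>a \<in> carrier R; x \<in> carrier M; y \<in> carrier M\<rbrakk> \<Longrightarrow>
        a \<odot>\<^bsub>M\<^esub> (x \<oplus>\<^bsub>M\<^esub> y) = a \<odot>\<^bsub>M\<^esub> x \<oplus>\<^bsub>M\<^esub> a \<odot>\<^bsub>M\<^esub> y"
    and smult_assoc:
      "\<lbrakk>a \<in> carrier R; b \<in> carrier R; x \<in> carrier M\<rbrakk> \<Longrightarrow>
        (a \<otimes> b) \<odot>\<^bsub>M\<^esub> x = a \<odot>\<^bsub>M\<^esub> (b \<odot>\<^bsub>M\<^esub> x)"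
    and smult_one:
      "x \<in> carrier M \<Longrightarrow> \<one> \<odot>\<^bsub>M\<^esub> x = x"

definition left_module_hom ::
  "('a, 'r) ring_scheme \<Rightarrow> ('a, 'b, 'm) module_scheme \<Rightarrow> ('a, 'c, 'n) module_scheme \<Rightarrow> ('b \<Rightarrow> 'c) set"
  where "left_module_hom R M N = {f \<in> carrier M \<rightarrow> carrier N.
    (\<forall>x\<in>carrier M. \<forall>y\<in>carrier M. f (x \<oplus>\<^bsub>M\<^esub> y) = f x \<oplus>\<^bsub>N\<^esub> f y) \<and>
    (\<forall>a\<in>carrier R. \<forall>x\<in>carrier M. f (a \<odot>\<^bsub>M\<^esub> x) = a \<odot>\<^bsub>N\<^esub> f x)}"

definition left_module_isomorphic ::
  "('a, 'r) ring_scheme \<Rightarrow> ('a, 'b, 'm) module_scheme \<Rightarrow> ('a, 'c, 'n) module_scheme \<Rightarrow> bool"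
  where "left_module_isomorphic R M N \<longleftrightarrow>
    (\<exists>f\<in>left_module_hom R M N. bij_betw f (carrier M) (carrier N))"

definition simple_module :: "('a, 'r) ring_scheme \<Rightarrow> ('a, 'b, 'm) module_scheme \<Rightarrow> bool"
  where "simple_module R M \<longleftrightarrow> left_module R M \<and> carrier M \<noteq> {\<zero>\<^bsub>M\<^esub>} \<and>
    (\<forall>N. submodule N R M \<longrightarrow> N = {\<zero>\<^bsub>M\<^esub>} \<or> N = carrier M)"

definition quotient_module ::
  "('a, 'b, 'm) module_scheme \<Rightarrow> 'b set \<Rightarrow> ('a, 'b set) module"
  where "quotient_module M H = \<lparr>carrier = a_rcosets\<^bsub>M\<^esub> H, mult = undefined, one = undefined,
    zero = H, add = set_add M, smult = (\<lambda>a X. \<Union>x\<in>X. H +>\<^bsub>M\<^esub> (a \<odot>\<^bsub>M\<^esub> x))\<rparr>"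


section \<open>Composition factors\<close>

definition series_factor ::
  "('a, 'b, 'm) module_scheme \<Rightarrow> (nat \<Rightarrow> 'b set) \<Rightarrow> nat \<Rightarrow> ('a, 'b set) module"
  where "series_factor M N i = quotient_module (M\<lparr>carrier := N (Suc i)\<rparr>) (N i)"

definition composition_series ::
  "('a, 'r) ring_scheme \<Rightarrow> ('a, 'b, 'm) module_scheme \<Rightarrow> nat \<Rightarrow> (nat \<Rightarrow> 'b set) \<Rightarrow> bool"
  where "composition_series R M r N \<longleftrightarrow> left_module R M \<and>
    N 0 = {\<zero>\<^bsub>M\<^esub>} \<and> N r = carrier M \<and> (\<forall>i\<le>r. submodule (N i) R M) \<and>
    (\<forall>i<r. N i \<subseteq> N (Suc i) \<and> simple_module R (series_factor M N i))"

text \<open>By the Jordan--Hoelder theorem the number below does not depend on the composition series.\<close>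

definition composition_multiplicity ::
  "('a, 'r) ring_scheme \<Rightarrow> ('a, 'b, 'm) module_scheme \<Rightarrow> ('a, 'c, 'n) module_scheme \<Rightarrow> nat"
  where "composition_multiplicity R M S = (THE n. \<exists>r N. composition_series R M r N \<and>
    n = card {i. i < r \<and> left_module_isomorphic R (series_factor M N i) S})"


section \<open>Projective covers and Cartan invariants\<close>

definition free_module :: "('a, 'r) ring_scheme \<Rightarrow> 'i set \<Rightarrow> ('a, 'i \<Rightarrow> 'a) module"
  where "free_module R I = \<lparr>carrier = {f. range f \<subseteq> carrier R \<and>
      finite {i. f i \<noteq> \<zero>\<^bsub>R\<^esub>} \<and> {i. f i \<noteq> \<zero>\<^bsub>R\<^esub>} \<subseteq> I},
    mult = undefined, one = undefined, zero = (\<lambda>_. \<zero>\<^bsub>R\<^esub>),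
    add = (\<lambda>f g i. f i \<oplus>\<^bsub>R\<^esub> g i), smult = (\<lambda>a f i. a \<otimes>\<^bsub>R\<^esub> f i)\<rparr>"

text \<open>
  A module is projective if it is (isomorphic to) a direct summand of a free module. Index sets
  inside the element type of \<open>P\<close> suffice: if \<open>P\<close> is a summand of any free module, the canonical
  epimorphism onto \<open>P\<close> from the free module on \<open>carrier P\<close> splits.
\<close>

definition projective_module :: "('a, 'r) ring_scheme \<Rightarrow> ('a, 'b, 'm) module_scheme \<Rightarrow> bool"
  where "projective_module R P \<longleftrightarrow> left_module R P \<and>
    (\<exists>(I :: 'b set). \<exists>\<iota>\<in>left_module_hom R P (free_module R I).
      \<exists>\<pi>\<in>left_module_hom R (free_module R I) P. \<forall>x\<in>carrier P. \<pi> (\<iota> x) = x)"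

definition superfluous_submodule ::
  "('a, 'r) ring_scheme \<Rightarrow> ('a, 'b, 'm) module_scheme \<Rightarrow> 'b set \<Rightarrow> bool"
  where "superfluous_submodule R M K \<longleftrightarrow> submodule K R M \<and>
    (\<forall>N. submodule N R M \<and> N <+>\<^bsub>M\<^esub> K = carrier M \<longrightarrow> N = carrier M)"

definition is_projective_cover ::
  "('a, 'r) ring_scheme \<Rightarrow> ('a, 'b, 'm) module_scheme \<Rightarrow> ('b \<Rightarrow> 'c) \<Rightarrow> ('a, 'c, 'n) module_scheme \<Rightarrow> bool"
  where "is_projective_cover R P \<pi> T \<longleftrightarrow> projective_module R P \<and>
    \<pi> \<in> left_module_hom R P T \<and> \<pi> ` carrier P = carrier T \<and>
    superfluous_submodule R P (a_kernel P T \<pi>)"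

text \<open>
  Projective covers are unique up to isomorphism. A projective cover of a simple module is generated
  by any element outside the kernel of the covering map, hence isomorphic to a left ideal that is a
  direct summand of \<open>R\<close>; so looking for it on the element type of \<open>R\<close> loses nothing when
  \<open>T\<close> is simple.
\<close>

definition projective_cover ::
  "('a, 'r) ring_scheme \<Rightarrow> ('a, 'c, 'n) module_scheme \<Rightarrow> ('a, 'a) module"
  where "projective_cover R T = (SOME P. \<exists>\<pi>. is_projective_cover R P \<pi> T)"

definition cartan_invariant ::
  "('a, 'r) ring_scheme \<Rightarrow> ('a, 'b, 'm) module_scheme \<Rightarrow> ('a, 'c, 'n) module_scheme \<Rightarrow> nat"
  where "cartan_invariant R S T = composition_multiplicity R (projective_cover R T) S"

definition cartan_matrix ::
  "('a, 'r) ring_scheme \<Rightarrow> ('a, 'b, 'm) module_scheme list \<Rightarrow> nat mat"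
  where "cartan_matrix R Ss =
    mat (length Ss) (length Ss) (\<lambda>(i, j). cartan_invariant R (Ss ! i) (Ss ! j))"


section \<open>Group algebras and their modules\<close>

text \<open>The function \<open>a\<close> stands for the formal sum of the \<open>a g \<cdot> g\<close>; multiplication is convolution.\<close>

definition group_algebra :: "('g, 'm) monoid_scheme \<Rightarrow> ('g \<Rightarrow> 'k::comm_ring_1) ring"
  where "group_algebra G = \<lparr>
    carrier = {a. finite {g. a g \<noteq> 0} \<and> {g. a g \<noteq> 0} \<subseteq> carrier G},
    mult = (\<lambda>a b x. if x \<in> carrier G
      then \<Sum>y | a y \<noteq> 0. a y * b (inv\<^bsub>G\<^esub> y \<otimes>\<^bsub>G\<^esub> x) else 0),
    one = (\<lambda>x. if x = \<one>\<^bsub>G\<^esub> then 1 else 0),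
    zero = (\<lambda>_. 0),
    add = (\<lambda>a b x. a x + b x)\<rparr>"

text \<open>
  The module on \<open>k^n\<close> over the group algebra that extends a matrix representation \<open>\<rho>\<close> of the group.
\<close>

definition representation_module ::
  "nat \<Rightarrow> ('g \<Rightarrow> 'k::comm_ring_1 mat) \<Rightarrow> ('g \<Rightarrow> 'k, 'k vec) module"
  where "representation_module n \<rho> = \<lparr>carrier = carrier_vec n, mult = undefined, one = undefined,
    zero = 0\<^sub>v n, add = (+),
    smult = (\<lambda>a v. vec n (\<lambda>i. \<Sum>g | a g \<noteq> 0. a g * (\<rho> g *\<^sub>v v) $ i))\<rparr>"


section \<open>The simple modules of \<open>A_5\<close> in characteristic two\<close>

text \<open>The subfield with four elements of an algebraically closed field of characteristic two.\<close>

definition F4 :: "'k::field set"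
  where "F4 = {x. x ^ 4 = x}"

definition SL :: "nat \<Rightarrow> 'k::field set \<Rightarrow> 'k mat monoid"
  where "SL n F = \<lparr>carrier = {A \<in> carrier_mat n n. elements_mat A \<subseteq> F \<and> det A = 1},
    mult = (*), one = 1\<^sub>m n\<rparr>"

abbreviation A5 :: "(nat \<Rightarrow> nat) monoid"
  where "A5 \<equiv> alt_group 5"

definition S1 :: "((nat \<Rightarrow> nat) \<Rightarrow> 'k::field, 'k vec) module"
  where "S1 = representation_module 1 (\<lambda>_. 1\<^sub>m 1)"

text \<open>
  Here \<open>\<phi>\<close> is the chosen isomorphism from \<open>A_5\<close> to \<open>SL_2(F_4)\<close>. The nontrivial automorphism of the
  field with four elements is squaring.
\<close>

definition S2 :: "((nat \<Rightarrow> nat) \<Rightarrow> 'k::field mat) \<Rightarrow> ((nat \<Rightarrow> nat) \<Rightarrow> 'k, 'k vec) module"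
  where "S2 \<phi> = representation_module 2 \<phi>"

definition S3 :: "((nat \<Rightarrow> nat) \<Rightarrow> 'k::field mat) \<Rightarrow> ((nat \<Rightarrow> nat) \<Rightarrow> 'k, 'k vec) module"
  where "S3 \<phi> = representation_module 2 (\<lambda>g. map_mat (\<lambda>x. x ^ 2) (\<phi> g))"

text \<open>
  Coordinates of vectors are numbered from 0 while \<open>alt_group 5\<close> permutes \<open>{1..5}\<close>; the matrix of
  \<open>p\<close> sends the basis vector with label \<open>j\<close> to the one with label \<open>p j\<close>.
\<close>

definition permutation_module :: "nat \<Rightarrow> ((nat \<Rightarrow> nat) \<Rightarrow> 'k::field, 'k vec) module"
  where "permutation_module n = representation_module n
    (\<lambda>p. mat n n (\<lambda>(i, j). if p (Suc j) = Suc i then 1 else 0))"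

definition S4 :: "((nat \<Rightarrow> nat) \<Rightarrow> 'k::field, 'k vec) module"
  where "S4 = (permutation_module 5)\<lparr>carrier := {v \<in> carrier_vec 5. (\<Sum>i<5. v $ i) = 0}\<rparr>"

end

theory Submission
  imports Defs
begin

text \<open>
  Write \<open>R\<close> for the group algebra. Everything is read off from idempotents. Call an idempotent \<open>e\<close>
  local if each element of the corner \<open>e R e\<close> is a scalar multiple of \<open>e\<close> plus an element of square
  zero. Up to isomorphism there is then at most one simple module \<open>T\<close> with \<open>e T \<noteq> 0\<close>
  (\<open>local_idem_isomorphic\<close>), the space \<open>e T\<close> is a line (\<open>local_idem_eigenspace\<close>), \<open>R e\<close> is a
  projective cover of \<open>T\<close> (\<open>left_ideal_projective_cover\<close>), and every projective cover of \<open>T\<close> is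
  isomorphic to \<open>R e\<close> (\<open>projective_cover_left_ideal\<close>). If \<open>f\<close> is local and \<open>f S \<noteq> 0\<close> for a simple
  module \<open>S\<close>, then along a composition series \<open>N\<close> of \<open>R e\<close> the dimension of \<open>f N\<^sub>i\<close> grows by one
  exactly at the factors isomorphic to \<open>S\<close>, and stays constant at the others. So the multiplicity of
  \<open>S\<close> is \<open>dim f R e\<close> for every series, without an appeal to the Jordan--Hoelder theorem, and the
  Cartan invariant is the dimension of a corner space (\<open>cartan_invariant_eq_dim\<close>).

  It remains to find local idempotents for the four modules. Let \<open>c\<close> be a 5-cycle. Since \<open>5 = 1\<close> in
  \<open>k\<close>, each \<open>x\<close> with \<open>x\<^sup>5 = 1\<close> gives an idempotent \<open>eig x\<close>, the sum of the \<open>x\<^sup>-\<^sup>i c\<^sup>i\<close>, which projects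
  every module onto the \<open>x\<close>-eigenspace of \<open>c\<close>; the five of them add up to \<open>1\<close>. The idempotent \<open>eig 1\<close>
  belongs to the trivial module. If \<open>x\<close> is a primitive fifth root of unity that is an eigenvalue of
  \<open>c\<close> on \<open>S\<^sub>2\<close>, then \<open>eig x\<close> is nonzero on \<open>S\<^sub>2\<close> and \<open>S\<^sub>4\<close>, and \<open>eig (x\<^sup>2)\<close> is nonzero on \<open>S\<^sub>3\<close> and
  \<open>S\<^sub>4\<close>. The two contributions are separated by the sum \<open>tau\<close> of the fifteen involutions: it is
  central and acts as zero on \<open>S\<^sub>4\<close>, and multiplication by it is an idempotent operation on \<open>R eig x\<close>.
  Hence \<open>eig x = E x + F x\<close> with orthogonal idempotents \<open>E x = tau eig x\<close> and \<open>F x\<close>, and the modules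
  \<open>S\<^sub>1, S\<^sub>2, S\<^sub>3, S\<^sub>4\<close> belong to \<open>eig 1, E x, E (x\<^sup>2), F x\<close>.

  All calculations take place in the spaces \<open>eig a R eig b\<close>. Let \<open>n\<close> be an involution that inverts
  \<open>c\<close>, and let \<open>{1, n, g, gn}\<close> be a Klein four group. Then \<open>1, n, g, gn\<close> represent the double cosets
  of \<open>c\<close> in \<open>A\<^sub>5\<close>, so that \<open>eig a R eig b\<close> is spanned by at most four elements (\<open>corner_spanned\<close>),
  and their products follow from the normal forms of the elements \<open>g c\<^sup>i g\<close> (\<open>X_mult_X\<close>). One finds
  that \<open>eig 1 R eig 1\<close> is the group algebra of the Klein four group (dimension 4), that
  \<open>E x R E x\<close> is an algebra of dual numbers (dimension 2), that \<open>eig 1\<close> and \<open>E x\<close> span corner spaces of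
  dimension 2 in both orders, and that \<open>E x R E (x\<^sup>2)\<close> and \<open>E (x\<^sup>2) R E x\<close> are lines. As \<open>tau\<close> is
  central, the corner spaces between \<open>F x\<close> and the other three idempotents vanish
  (\<open>block_orthogonal\<close>), and \<open>F x R F x\<close> is a line. These dimensions are the entries of the matrix.
\<close>

section \<open>Submodules, quotients and composition series\<close>

context left_module
begin

lemma smult_r_null [simp]: "a \<in> carrier R \<Longrightarrow> a \<odot>\<^bsub>M\<^esub> \<zero>\<^bsub>M\<^esub> = \<zero>\<^bsub>M\<^esub>"
  using smult_r_distr[of a "\<zero>\<^bsub>M\<^esub>" "\<zero>\<^bsub>M\<^esub>"]
  by (metis M.r_zero M.zero_closed M.add.l_cancel_one' smult_closed)

lemma smult_l_null [simp]: "x \<in> carrier M \<Longrightarrow> \<zero> \<odot>\<^bsub>M\<^esub> x = \<zero>\<^bsub>M\<^esub>"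
  using smult_l_distr[of "\<zero>" "\<zero>" x]
  by (metis R.r_zero R.zero_closed M.add.l_cancel_one' smult_closed)

lemma smult_minus_one: "x \<in> carrier M \<Longrightarrow> (\<ominus> \<one>) \<odot>\<^bsub>M\<^esub> x = \<ominus>\<^bsub>M\<^esub> x"
  using smult_l_distr[of "\<ominus> \<one>" "\<one>" x]
  by (metis R.l_neg R.one_closed R.a_inv_closed smult_l_null smult_one smult_closed M.minus_equality)

lemma smult_r_minus: "\<lbrakk>a \<in> carrier R; x \<in> carrier M\<rbrakk> \<Longrightarrow> a \<odot>\<^bsub>M\<^esub> (\<ominus>\<^bsub>M\<^esub> x) = \<ominus>\<^bsub>M\<^esub> (a \<odot>\<^bsub>M\<^esub> x)"
  by (metis smult_r_distr smult_r_null M.l_neg M.minus_equality smult_closed M.a_inv_closed)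

lemma submoduleI:
  assumes "H \<subseteq> carrier M" "\<zero>\<^bsub>M\<^esub> \<in> H"
    and add: "\<And>x y. \<lbrakk>x \<in> H; y \<in> H\<rbrakk> \<Longrightarrow> x \<oplus>\<^bsub>M\<^esub> y \<in> H"
    and smult: "\<And>a x. \<lbrakk>a \<in> carrier R; x \<in> H\<rbrakk> \<Longrightarrow> a \<odot>\<^bsub>M\<^esub> x \<in> H"
  shows "submodule H R M"
proof -
  have "\<ominus>\<^bsub>M\<^esub> x \<in> H" if "x \<in> H" for x
    using smult[of "\<ominus> \<one>" x] smult_minus_one[of x] that assms(1) by auto
  then show ?thesis
    using assms by unfold_locales (auto simp: a_inv_def)
qed

lemma submoduleD:
  assumes "submodule H R M"
  shows "H \<subseteq> carrier M" "\<zero>\<^bsub>M\<^esub> \<in> H"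
    "\<And>x y. \<lbrakk>x \<in> H; y \<in> H\<rbrakk> \<Longrightarrow> x \<oplus>\<^bsub>M\<^esub> y \<in> H"
    "\<And>a x. \<lbrakk>a \<in> carrier R; x \<in> H\<rbrakk> \<Longrightarrow> a \<odot>\<^bsub>M\<^esub> x \<in> H"
    "\<And>x. x \<in> H \<Longrightarrow> \<ominus>\<^bsub>M\<^esub> x \<in> H"
proof -
  interpret submodule H R M by fact
  show "H \<subseteq> carrier M" "\<zero>\<^bsub>M\<^esub> \<in> H" "\<And>x y. \<lbrakk>x \<in> H; y \<in> H\<rbrakk> \<Longrightarrow> x \<oplus>\<^bsub>M\<^esub> y \<in> H"
    "\<And>a x. \<lbrakk>a \<in> carrier R; x \<in> H\<rbrakk> \<Longrightarrow> a \<odot>\<^bsub>M\<^esub> x \<in> H" "\<And>x. x \<in> H \<Longrightarrow> \<ominus>\<^bsub>M\<^esub> x \<in> H"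
    using subset m_closed one_closed m_inv_closed by (auto simp: a_inv_def)
qed

lemma submodule_carrier: "submodule (carrier M) R M"
  by (rule submoduleI) (auto simp: smult_closed)

lemma submodule_zero: "submodule {\<zero>\<^bsub>M\<^esub>} R M"
  by (rule submoduleI) auto

lemma submodule_left_module:
  assumes "submodule H R M"
  shows "left_module R (M\<lparr>carrier := H\<rparr>)"
proof -
  note H = submoduleD[OF assms]
  have inv: "\<exists>y\<in>H. y \<oplus>\<^bsub>M\<^esub> x = \<zero>\<^bsub>M\<^esub>" if "x \<in> H" for x
    using H(5)[OF that] H(1) that M.l_neg by blast
  have "abelian_group (M\<lparr>carrier := H\<rparr>)"
    using H inv by (intro abelian_groupI) (auto simp: M.a_assoc subset_iff intro: M.a_comm)
  then show ?thesis
    using H R.ring_axioms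
    by (intro left_module.intro left_module_axioms.intro)
       (auto simp: smult_l_distr smult_r_distr smult_assoc smult_one subset_iff)
qed

lemma submodule_of_submodule:
  assumes "submodule H R M"
  shows "submodule K R (M\<lparr>carrier := H\<rparr>) \<longleftrightarrow> submodule K R M \<and> K \<subseteq> H"
proof -
  interpret H: left_module R "M\<lparr>carrier := H\<rparr>" by (rule submodule_left_module[OF assms])
  note HD = submoduleD[OF assms]
  show ?thesis
  proof
    assume K: "submodule K R (M\<lparr>carrier := H\<rparr>)"
    show "submodule K R M \<and> K \<subseteq> H"
      using H.submoduleD[OF K] HD by (intro conjI submoduleI) (auto simp: subset_iff)
  next
    assume "submodule K R M \<and> K \<subseteq> H"
    then show "submodule K R (M\<lparr>carrier := H\<rparr>)"
      using submoduleD[of K] by (intro H.submoduleI) (auto simp: subset_iff)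
  qed
qed

lemma simple_generated:
  assumes "simple_module R M" "w \<in> carrier M" "w \<noteq> \<zero>\<^bsub>M\<^esub>" "s \<in> carrier M"
  shows "\<exists>b\<in>carrier R. b \<odot>\<^bsub>M\<^esub> w = s"
proof -
  let ?N = "(\<lambda>b. b \<odot>\<^bsub>M\<^esub> w) ` carrier R"
  have "submodule ?N R M"
  proof (rule submoduleI)
    show "\<zero>\<^bsub>M\<^esub> \<in> ?N" using assms(2) by (intro image_eqI[of _ _ "\<zero>"]) auto
    show "x \<oplus>\<^bsub>M\<^esub> y \<in> ?N" if "x \<in> ?N" "y \<in> ?N" for x y
      using that assms(2) by (auto simp flip: smult_l_distr)
    show "a \<odot>\<^bsub>M\<^esub> x \<in> ?N" if "a \<in> carrier R" "x \<in> ?N" for a x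
      using that assms(2) by (auto simp flip: smult_assoc)
  qed (use assms(2) smult_closed in auto)
  moreover have "w \<in> ?N" using assms(2) smult_one[of w] by (intro image_eqI[of _ _ "\<one>"]) auto
  ultimately have "?N = carrier M" using assms(1,3) unfolding simple_module_def by blast
  then have "s \<in> ?N" using assms(4) by simp
  then show ?thesis by auto
qed

end

lemma quotient_sel:
  "carrier (quotient_module M H) = a_rcosets\<^bsub>M\<^esub> H" "\<zero>\<^bsub>quotient_module M H\<^esub> = H"
  "add (quotient_module M H) = set_add M"
  by (simp_all add: quotient_module_def)

locale module_with_submodule = left_module R M for R and M (structure) +
  fixes H
  assumes H: "submodule H R M"
begin

lemmas HD = submoduleD[OF H]

sublocale HA: abelian_subgroup H M
  using H M.abelian_group_axioms
  by (intro abelian_subgroupI3 additive_subgroup.intro) (simp_all add: submodule_def)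

abbreviation coset where "coset x \<equiv> H +>\<^bsub>M\<^esub> x"

lemma coset_eq_iff:
  assumes "x \<in> carrier M" "y \<in> carrier M"
  shows "coset x = coset y \<longleftrightarrow> x \<oplus>\<^bsub>M\<^esub> \<ominus>\<^bsub>M\<^esub> y \<in> H"
  using assms by (metis HA.a_rcos_module HA.a_rcos_self HA.a_repr_independence')

lemma coset_eq_zero_iff: "x \<in> carrier M \<Longrightarrow> coset x = H \<longleftrightarrow> x \<in> H"
  by (metis HA.a_rcos_const HA.a_rcos_self)

lemma carrier_quotient: "carrier (quotient_module M H) = coset ` carrier M"
  by (auto simp: quotient_sel A_RCOSETS_def' a_r_coset_def')

lemma coset_add:
  "\<lbrakk>x \<in> carrier M; y \<in> carrier M\<rbrakk> \<Longrightarrow> coset x \<oplus>\<^bsub>quotient_module M H\<^esub> coset y = coset (x \<oplus>\<^bsub>M\<^esub> y)"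
  by (simp add: quotient_sel HA.a_rcos_sum)

lemma coset_smult:
  assumes "a \<in> carrier R" "x \<in> carrier M"
  shows "a \<odot>\<^bsub>quotient_module M H\<^esub> coset x = coset (a \<odot>\<^bsub>M\<^esub> x)"
proof -
  have "coset (a \<odot>\<^bsub>M\<^esub> y) = coset (a \<odot>\<^bsub>M\<^esub> x)" if y: "y \<in> coset x" for y
  proof -
    have yM: "y \<in> carrier M" using HA.a_elemrcos_carrier[OF assms(2) y] .
    have "y \<oplus>\<^bsub>M\<^esub> \<ominus>\<^bsub>M\<^esub> x \<in> H" using HA.a_rcos_module_imp[OF assms(2) y] .
    then have "a \<odot>\<^bsub>M\<^esub> (y \<oplus>\<^bsub>M\<^esub> \<ominus>\<^bsub>M\<^esub> x) \<in> H" using HD(4)[OF assms(1)] by simp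
    then show ?thesis
      using assms yM by (subst coset_eq_iff) (auto simp: smult_r_distr smult_r_minus smult_closed)
  qed
  moreover have "x \<in> coset x" by (rule HA.a_rcos_self) fact
  ultimately have "(\<Union>y\<in>coset x. coset (a \<odot>\<^bsub>M\<^esub> y)) = coset (a \<odot>\<^bsub>M\<^esub> x)" by blast
  then show ?thesis by (simp add: quotient_module_def)
qed

lemma quotient_left_module: "left_module R (quotient_module M H)"
proof -
  have zero: "\<zero>\<^bsub>quotient_module M H\<^esub> = coset \<zero>\<^bsub>M\<^esub>"
    using coset_eq_zero_iff[of "\<zero>\<^bsub>M\<^esub>"] HD(2) by (simp add: quotient_sel)
  have inv: "\<exists>Y\<in>carrier (quotient_module M H). Y \<oplus>\<^bsub>quotient_module M H\<^esub> X = \<zero>\<^bsub>quotient_module M H\<^esub>"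
    if X: "X \<in> carrier (quotient_module M H)" for X
  proof -
    obtain x where "x \<in> carrier M" "X = coset x" using X by (auto simp: carrier_quotient)
    then show ?thesis unfolding carrier_quotient
      by (intro bexI[of _ "coset (\<ominus>\<^bsub>M\<^esub> x)"]) (auto simp: coset_add zero M.l_neg)
  qed
  have "abelian_group (quotient_module M H)"
    using inv by (intro abelian_groupI)
      (auto simp: carrier_quotient coset_add zero M.a_assoc, auto simp: M.a_comm)
  then show ?thesis using R.ring_axioms
    by (intro left_module.intro left_module_axioms.intro)
       (auto simp: carrier_quotient coset_add coset_smult smult_closed smult_l_distr
          smult_r_distr smult_assoc smult_one)
qed

lemma quotient_simple:
  assumes proper: "H \<noteq> carrier M"
    and maximal: "\<And>K. \<lbrakk>submodule K R M; H \<subseteq> K\<rbrakk> \<Longrightarrow> K = H \<or> K = carrier M"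
  shows "simple_module R (quotient_module M H)"
proof -
  interpret Q: left_module R "quotient_module M H" by (rule quotient_left_module)
  obtain x where x: "x \<in> carrier M" "x \<notin> H" using proper HD(1) by blast
  then have "coset x \<in> carrier (quotient_module M H)" "coset x \<noteq> H"
    by (auto simp: carrier_quotient coset_eq_zero_iff)
  then have ne: "carrier (quotient_module M H) \<noteq> {\<zero>\<^bsub>quotient_module M H\<^esub>}"
    by (auto simp: quotient_sel)
  have "L = {H} \<or> L = carrier (quotient_module M H)"
    if L: "submodule L R (quotient_module M H)" for L
  proof -
    note LD = Q.submoduleD[OF L]
    define K where "K = {x \<in> carrier M. coset x \<in> L}"
    have L_eq: "L = coset ` K"
      using LD(1) by (auto simp: K_def carrier_quotient)
    have "submodule K R M"
    proof (rule submoduleI)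
      show "\<zero>\<^bsub>M\<^esub> \<in> K" using LD(2) coset_eq_zero_iff[of "\<zero>\<^bsub>M\<^esub>"] HD(2)
        by (auto simp: K_def quotient_sel)
      show "y \<oplus>\<^bsub>M\<^esub> z \<in> K" if "y \<in> K" "z \<in> K" for y z
        using that LD(3)[of "coset y" "coset z"] by (auto simp: K_def coset_add)
      show "a \<odot>\<^bsub>M\<^esub> y \<in> K" if "a \<in> carrier R" "y \<in> K" for a y
        using that LD(4)[of a "coset y"] by (auto simp: K_def coset_smult smult_closed)
    qed (auto simp: K_def)
    moreover have "H \<subseteq> K"
    proof
      fix x assume "x \<in> H"
      then have "x \<in> carrier M" "coset x = H" using HD(1) HA.a_rcos_const by blast+
      then show "x \<in> K" using LD(2) by (simp add: K_def quotient_sel)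
    qed
    ultimately have "K = H \<or> K = carrier M" by (rule maximal)
    moreover have "coset ` H = (\<lambda>_. H) ` H" by (rule image_cong) (simp_all add: HA.a_rcos_const)
    then have "coset ` H = {H}" using image_constant[OF HD(2)] by simp
    ultimately show ?thesis by (auto simp: L_eq carrier_quotient)
  qed
  then show ?thesis
    using ne quotient_left_module by (auto simp: simple_module_def quotient_sel)
qed

end

context left_module
begin

lemma series_factor_simple:
  assumes H: "submodule H R M" and K: "submodule K R M" and "K \<subset> H"
    and maximal: "\<And>L. \<lbrakk>submodule L R M; K \<subseteq> L; L \<subseteq> H\<rbrakk> \<Longrightarrow> L = K \<or> L = H"
  shows "simple_module R (quotient_module (M\<lparr>carrier := H\<rparr>) K)"
proof -
  interpret H: left_module R "M\<lparr>carrier := H\<rparr>" by (rule submodule_left_module) fact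
  interpret module_with_submodule R "M\<lparr>carrier := H\<rparr>" K
    using submodule_of_submodule[OF assms(1), of K] K \<open>K \<subset> H\<close>
    by (intro module_with_submodule.intro module_with_submodule_axioms.intro H.left_module_axioms) simp
  show ?thesis
  proof (rule quotient_simple)
    show "L = K \<or> L = carrier (M\<lparr>carrier := H\<rparr>)"
      if "submodule L R (M\<lparr>carrier := H\<rparr>)" "K \<subseteq> L" for L
      using that maximal[of L] submodule_of_submodule[OF assms(1), of L] by simp
  qed (use \<open>K \<subset> H\<close> in auto)
qed

text \<open>A rank function \<open>d\<close> that increases strictly along proper inclusions forces every descent to stop.
  Below a given submodule, one of largest rank among the proper submodules has a simple factor.\<close>

lemma composition_series_exists:
  assumes strict: "\<And>H K. \<lbrakk>submodule H R M; submodule K R M; K \<subset> H\<rbrakk> \<Longrightarrow> (d K :: nat) < d H"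
  shows "\<exists>r N. composition_series R M r N"
proof -
  have "\<exists>r N. N 0 = {\<zero>\<^bsub>M\<^esub>} \<and> N r = H \<and> (\<forall>i\<le>r. submodule (N i) R M) \<and>
      (\<forall>i<r. N i \<subseteq> N (Suc i) \<and> simple_module R (series_factor M N i))"
    if "submodule H R M" for H
    using that
  proof (induction "d H" arbitrary: H rule: less_induct)
    case less
    note HD = submoduleD[OF less.prems]
    show ?case
    proof (cases "H = {\<zero>\<^bsub>M\<^esub>}")
      case True
      then show ?thesis using submodule_zero by (intro exI[of _ 0] exI[of _ "\<lambda>_. H"]) auto
    next
      case False
      define P where "P K \<longleftrightarrow> submodule K R M \<and> K \<subset> H" for K
      have P0: "P {\<zero>\<^bsub>M\<^esub>}" using False HD submodule_zero by (auto simp: P_def)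
      have "\<forall>K. P K \<longrightarrow> d K < d H" using strict[OF less.prems] by (auto simp: P_def)
      then obtain K where K: "P K" "\<And>L. P L \<Longrightarrow> d L \<le> d K"
        using ex_has_greatest_nat[of P "{\<zero>\<^bsub>M\<^esub>}" d "d H", OF P0] by auto
      have sub: "submodule K R M" "K \<subset> H" using K(1) by (auto simp: P_def)
      have max: "L = K \<or> L = H" if "submodule L R M" "K \<subseteq> L" "L \<subseteq> H" for L
        using strict[OF that(1) sub(1)] K(2)[of L] that by (fastforce simp: P_def)
      have simp: "simple_module R (quotient_module (M\<lparr>carrier := H\<rparr>) K)"
        using series_factor_simple[OF less.prems sub max] .
      obtain r N where N: "N 0 = {\<zero>\<^bsub>M\<^esub>}" "N r = K" "\<forall>i\<le>r. submodule (N i) R M"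
        "\<forall>i<r. N i \<subseteq> N (Suc i) \<and> simple_module R (series_factor M N i)"
        using less.hyps[of K] strict[OF less.prems sub] sub by blast
      define N' where "N' i = (if i \<le> r then N i else H)" for i
      have "\<forall>i<Suc r. N' i \<subseteq> N' (Suc i) \<and> simple_module R (series_factor M N' i)"
        using N sub simp by (auto simp: N'_def series_factor_def less_Suc_eq)
      then show ?thesis using N less.prems
        by (intro exI[of _ "Suc r"] exI[of _ N']) (auto simp: N'_def le_Suc_eq)
    qed
  qed
  from this[OF submodule_carrier] show ?thesis
    using left_module_axioms by (auto simp: composition_series_def)
qed

end

section \<open>The group algebra as a ring type\<close>

lemma group_algebra_sel:
  "carrier (group_algebra G) = {a. finite {g. a g \<noteq> 0} \<and> {g. a g \<noteq> 0} \<subseteq> carrier G}"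
  "\<one>\<^bsub>group_algebra G\<^esub> = (\<lambda>x. if x = \<one>\<^bsub>G\<^esub> then 1 else 0)"
  "\<zero>\<^bsub>group_algebra G\<^esub> = (\<lambda>_. 0)"
  "a \<oplus>\<^bsub>group_algebra G\<^esub> b = (\<lambda>x. a x + b x)"
  by (simp_all add: group_algebra_def)

locale finite_group = group G for G (structure) +
  assumes finite_carrier [simp]: "finite (carrier G)"
begin

lemma group_algebra_carrier: "a \<in> carrier (group_algebra G) \<longleftrightarrow> (\<forall>x. x \<notin> carrier G \<longrightarrow> a x = 0)"
  unfolding group_algebra_sel using finite_subset[OF _ finite_carrier, of "{g. a g \<noteq> 0}"] by auto

lemma group_algebra_mult:
  assumes "a \<in> carrier (group_algebra G)"
  shows "a \<otimes>\<^bsub>group_algebra G\<^esub> b =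
    (\<lambda>x. if x \<in> carrier G then \<Sum>y\<in>carrier G. a y * b (inv y \<otimes> x) else 0)"
proof -
  have "(\<Sum>y | a y \<noteq> 0. a y * b (inv y \<otimes> x)) = (\<Sum>y\<in>carrier G. a y * b (inv y \<otimes> x))" for x
    using assms by (intro sum.mono_neutral_left) (auto simp: group_algebra_carrier)
  then show ?thesis by (simp add: group_algebra_def cong: if_cong)
qed

lemma sum_translate:
  assumes "y \<in> carrier G"
  shows "(\<Sum>z\<in>carrier G. f z) = (\<Sum>w\<in>carrier G. f (y \<otimes> w))"
  using assms
  by (intro sum.reindex_bij_witness[of _ "\<lambda>w. y \<otimes> w" "\<lambda>z. inv y \<otimes> z"])
     (auto simp: m_assoc[symmetric])

lemma group_algebra_mult_assoc:
  fixes a b c :: "'a \<Rightarrow> 'k::comm_ring_1"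
  assumes a: "a \<in> carrier (group_algebra G)" and b: "b \<in> carrier (group_algebra G)"
    and c: "c \<in> carrier (group_algebra G)"
  shows "a \<otimes>\<^bsub>group_algebra G\<^esub> b \<otimes>\<^bsub>group_algebra G\<^esub> c =
    a \<otimes>\<^bsub>group_algebra G\<^esub> (b \<otimes>\<^bsub>group_algebra G\<^esub> c)"
proof -
  have ab: "a \<otimes>\<^bsub>group_algebra G\<^esub> b \<in> carrier (group_algebra G)"
    using a by (simp add: group_algebra_mult group_algebra_carrier)
  have "(\<Sum>z\<in>carrier G. (\<Sum>y\<in>carrier G. a y * b (inv y \<otimes> z)) * c (inv z \<otimes> x)) =
      (\<Sum>y\<in>carrier G. a y * (\<Sum>w\<in>carrier G. b w * c (inv w \<otimes> (inv y \<otimes> x))))"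
    if x: "x \<in> carrier G" for x
  proof -
    have "(\<Sum>z\<in>carrier G. (\<Sum>y\<in>carrier G. a y * b (inv y \<otimes> z)) * c (inv z \<otimes> x)) =
        (\<Sum>y\<in>carrier G. \<Sum>z\<in>carrier G. a y * b (inv y \<otimes> z) * c (inv z \<otimes> x))"
      by (subst sum.swap) (simp add: sum_distrib_right)
    also have "\<dots> = (\<Sum>y\<in>carrier G. \<Sum>w\<in>carrier G. a y * b w * c (inv w \<otimes> (inv y \<otimes> x)))"
    proof (rule sum.cong[OF refl])
      fix y assume y: "y \<in> carrier G"
      show "(\<Sum>z\<in>carrier G. a y * b (inv y \<otimes> z) * c (inv z \<otimes> x)) =
          (\<Sum>w\<in>carrier G. a y * b w * c (inv w \<otimes> (inv y \<otimes> x)))"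
        using x y by (subst sum_translate[OF y])
          (auto intro!: sum.cong simp: m_assoc inv_mult_group, simp add: m_assoc[symmetric])
    qed
    finally show ?thesis by (simp add: sum_distrib_left mult.assoc)
  qed
  then show ?thesis
    using a b ab by (auto simp: group_algebra_mult intro!: ext)
qed

lemma group_algebra_ring: "ring (group_algebra G :: ('a \<Rightarrow> 'k::comm_ring_1) ring)"
proof -
  let ?R = "group_algebra G :: ('a \<Rightarrow> 'k) ring"
  have "abelian_group ?R"
  proof (rule abelian_groupI)
    show "\<exists>b\<in>carrier ?R. b \<oplus>\<^bsub>?R\<^esub> a = \<zero>\<^bsub>?R\<^esub>" if "a \<in> carrier ?R" for a
      using that by (intro bexI[of _ "\<lambda>x. - a x"]) (auto simp: group_algebra_carrier group_algebra_sel(2-))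
  qed (auto simp: group_algebra_carrier group_algebra_sel(2-) algebra_simps)
  moreover have "Group.monoid ?R"
  proof (rule monoidI)
    show "\<one>\<^bsub>?R\<^esub> \<in> carrier ?R" by (simp add: group_algebra_carrier group_algebra_sel(2))
    then show "\<one>\<^bsub>?R\<^esub> \<otimes>\<^bsub>?R\<^esub> a = a" if a: "a \<in> carrier ?R" for a
      using a by (auto simp: group_algebra_mult group_algebra_carrier group_algebra_sel(2)
        if_distrib[of "\<lambda>t. t * _"] sum.delta cong: if_cong intro!: ext)
    have eq: "(inv y \<otimes> x = \<one>) = (y = x)" if "x \<in> carrier G" "y \<in> carrier G" for x y
      using that by (metis inv_closed inv_equality inv_inv l_inv)
    show "a \<otimes>\<^bsub>?R\<^esub> \<one>\<^bsub>?R\<^esub> = a" if a: "a \<in> carrier ?R" for a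
      using a by (auto simp: group_algebra_mult group_algebra_carrier group_algebra_sel(2) eq
        if_distrib[of "\<lambda>t. _ * t"] sum.delta cong: if_cong sum.cong intro!: ext)
    show "a \<otimes>\<^bsub>?R\<^esub> b \<in> carrier ?R" if "a \<in> carrier ?R" for a b
      using that by (simp add: group_algebra_mult group_algebra_carrier)
  qed (simp add: group_algebra_mult_assoc)
  moreover have "(a \<oplus>\<^bsub>?R\<^esub> b) \<otimes>\<^bsub>?R\<^esub> c = a \<otimes>\<^bsub>?R\<^esub> c \<oplus>\<^bsub>?R\<^esub> b \<otimes>\<^bsub>?R\<^esub> c"
    if "a \<in> carrier ?R" "b \<in> carrier ?R" for a b c
  proof -
    have "a \<oplus>\<^bsub>?R\<^esub> b \<in> carrier ?R" using that by (simp add: group_algebra_carrier group_algebra_sel(4))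
    then show ?thesis using that
      by (auto simp: group_algebra_mult group_algebra_sel(4) distrib_right sum.distrib intro!: ext)
  qed
  moreover have "c \<otimes>\<^bsub>?R\<^esub> (a \<oplus>\<^bsub>?R\<^esub> b) = c \<otimes>\<^bsub>?R\<^esub> a \<oplus>\<^bsub>?R\<^esub> c \<otimes>\<^bsub>?R\<^esub> b"
    if "c \<in> carrier ?R" for a b c
    using that by (auto simp: group_algebra_mult group_algebra_sel(4) distrib_left sum.distrib intro!: ext)
  ultimately show ?thesis by (intro ring.intro ring_axioms.intro) auto
qed

end

interpretation A5: finite_group A5
proof (intro finite_group.intro finite_group_axioms.intro alt_group_is_group)
  show "finite (carrier A5)"
    using finite_permutations[of "{1..5::nat}"] by (simp add: alt_group_def)
qed

abbreviation kA5 :: "((nat \<Rightarrow> nat) \<Rightarrow> 'k::field) ring"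
  where "kA5 \<equiv> group_algebra A5"

type_synonym ('k, 'b) kA5_module = "((nat \<Rightarrow> nat) \<Rightarrow> 'k, 'b) module"
type_synonym ('k, 'b, 'm) kA5_scheme = "((nat \<Rightarrow> nat) \<Rightarrow> 'k, 'b, 'm) module_scheme"

interpretation kA5: ring kA5 by (rule A5.group_algebra_ring)

text \<open>A type of its own for the elements of the group algebra: multiplication then obeys the laws of
  the class \<open>ring_1\<close> without side conditions, and calculations reduce to rewriting.\<close>

typedef (overloaded) 'k alg = "carrier (kA5 :: ((nat \<Rightarrow> nat) \<Rightarrow> 'k::field) ring)"
  morphisms coeff Alg
  using kA5.zero_closed by blast

abbreviation act ("_ \<star>\<index> _" [70, 71] 70)
  where "act M a x \<equiv> coeff a \<odot>\<^bsub>M\<^esub> x"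

instantiation alg :: (field) ring_1
begin

definition "0 = Alg \<zero>\<^bsub>kA5\<^esub>"
definition "1 = Alg \<one>\<^bsub>kA5\<^esub>"
definition "a + b = Alg (coeff a \<oplus>\<^bsub>kA5\<^esub> coeff b)"
definition "a * b = Alg (coeff a \<otimes>\<^bsub>kA5\<^esub> coeff b)"
definition "- a = Alg (\<ominus>\<^bsub>kA5\<^esub> coeff a)"
definition "a - (b :: 'a alg) = a + - b"

lemma coeff_closed [simp]: "coeff a \<in> carrier kA5"
  by (rule coeff)

lemma coeff_ops:
  "coeff (0 :: 'a alg) = \<zero>\<^bsub>kA5\<^esub>" "coeff (1 :: 'a alg) = \<one>\<^bsub>kA5\<^esub>"
  "coeff (a + b) = coeff a \<oplus>\<^bsub>kA5\<^esub> coeff b" "coeff (a * b) = coeff a \<otimes>\<^bsub>kA5\<^esub> coeff b"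
  "coeff (- a) = \<ominus>\<^bsub>kA5\<^esub> coeff a"
  by (simp_all add: zero_alg_def one_alg_def plus_alg_def times_alg_def uminus_alg_def Alg_inverse)

instance
proof
  fix a b c :: "'a alg"
  show "(0 :: 'a alg) \<noteq> 1"
  proof
    assume "(0 :: 'a alg) = 1"
    then have "coeff (0 :: 'a alg) id = coeff 1 id" by simp
    then show False by (simp add: coeff_ops group_algebra_sel alt_group_one)
  qed
qed (auto simp: coeff_inject[symmetric] coeff_ops minus_alg_def kA5.m_assoc kA5.a_assoc
  kA5.l_distr kA5.r_distr kA5.l_neg intro: kA5.a_comm)

end

lemma carrier_kA5: "carrier (kA5 :: ((nat \<Rightarrow> nat) \<Rightarrow> 'k::field) ring) = range coeff"
  by (simp add: type_definition.Rep_range[OF type_definition_alg])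

lemma coeff_outside: "p \<notin> carrier A5 \<Longrightarrow> coeff a p = 0"
  using coeff_closed[of a] by (simp add: A5.group_algebra_carrier)

lemma coeff_add: "coeff (a + b) p = coeff a p + coeff b p"
  and coeff_zero: "coeff 0 p = 0"
  by (simp_all add: coeff_ops group_algebra_sel)

lemma coeff_sum: "coeff (\<Sum>i\<in>I. f i) p = (\<Sum>i\<in>I. coeff (f i) p)"
  by (induction I rule: infinite_finite_induct) (auto simp: coeff_add coeff_zero)

lemma alg_eqI: "(\<And>p. p \<in> carrier A5 \<Longrightarrow> coeff a p = coeff b p) \<Longrightarrow> a = b"
  by (metis coeff_inject coeff_outside ext)

lemma coeff_mult:
  "x \<in> carrier A5 \<Longrightarrow> coeff (a * b) x = (\<Sum>y\<in>carrier A5. coeff a y * coeff b (inv\<^bsub>A5\<^esub> y \<otimes>\<^bsub>A5\<^esub> x))"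
  by (simp add: coeff_ops A5.group_algebra_mult)

definition scal :: "'k::field \<Rightarrow> 'k alg \<Rightarrow> 'k alg" (infixr "\<cdot>" 75)
  where "c \<cdot> a = Alg (\<lambda>p. c * coeff a p)"

lemma coeff_scal: "coeff (c \<cdot> a) p = c * coeff a p"
  unfolding scal_def using coeff_outside[of _ a]
  by (subst Alg_inverse) (auto simp: A5.group_algebra_carrier)

definition delta :: "(nat \<Rightarrow> nat) \<Rightarrow> 'k::field alg"
  where "delta p = Alg (\<lambda>x. if x = p then 1 else 0)"

lemma coeff_delta: "p \<in> carrier A5 \<Longrightarrow> coeff (delta p) x = (if x = p then 1 else 0)"
  unfolding delta_def by (subst Alg_inverse) (auto simp: A5.group_algebra_carrier)

lemma delta_mult:
  assumes "p \<in> carrier A5" "q \<in> carrier A5"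
  shows "delta p * delta q = (delta (p \<circ> q) :: 'k::field alg)"
proof (rule alg_eqI)
  fix x assume x: "x \<in> carrier A5"
  have pq: "p \<circ> q \<in> carrier A5" using A5.m_closed[OF assms] by (simp add: alt_group_mult)
  have iff: "inv\<^bsub>A5\<^esub> p \<otimes>\<^bsub>A5\<^esub> x = q \<longleftrightarrow> x = p \<circ> q"
    using assms x A5.inv_solve_left'[of p q x] A5.inv_solve_left[of q p x]
    by (auto simp: alt_group_mult)
  have "coeff (delta p * delta q :: 'k alg) x =
      (\<Sum>y\<in>carrier A5. (if y = p then coeff (delta q) (inv\<^bsub>A5\<^esub> y \<otimes>\<^bsub>A5\<^esub> x) else 0))"
    unfolding coeff_mult[OF x] by (intro sum.cong refl) (auto simp: coeff_delta assms)
  also have "\<dots> = coeff (delta (p \<circ> q)) x"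
    using assms pq by (simp add: sum.delta coeff_delta iff)
  finally show "coeff (delta p * delta q :: 'k alg) x = coeff (delta (p \<circ> q)) x" .
qed

lemma delta_id: "delta id = (1 :: 'k::field alg)"
  by (simp add: delta_def one_alg_def group_algebra_sel alt_group_one)

lemma scal_mult [simp]: "(c \<cdot> a) * b = c \<cdot> (a * b)" "a * (c \<cdot> b) = c \<cdot> (a * b)"
  by (auto intro!: alg_eqI simp: coeff_mult coeff_scal sum_distrib_left mult_ac)

lemma alg_expand: "a = (\<Sum>p\<in>carrier A5. coeff a p \<cdot> delta p)"
proof (rule alg_eqI)
  fix q assume q: "q \<in> carrier A5"
  have "coeff (\<Sum>p\<in>carrier A5. coeff a p \<cdot> delta p) q = (\<Sum>p\<in>carrier A5. if p = q then coeff a p else 0)"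
    unfolding coeff_sum by (intro sum.cong refl) (auto simp: coeff_scal coeff_delta)
  then show "coeff a q = coeff (\<Sum>p\<in>carrier A5. coeff a p \<cdot> delta p) q" using q by (simp add: sum.delta)
qed

interpretation V: vector_space "scal :: 'k::field \<Rightarrow> 'k alg \<Rightarrow> 'k alg"
  by unfold_locales (auto intro!: alg_eqI simp: coeff_scal coeff_add algebra_simps)

lemma delta_independent: "V.independent (delta ` carrier A5 :: 'k::field alg set)"
proof -
  have inj: "inj_on (delta :: _ \<Rightarrow> 'k alg) (carrier A5)"
    by (rule inj_onI) (metis coeff_delta zero_neq_one)
  have "u p = 0" if u: "(\<Sum>a\<in>delta ` carrier A5. u (inv_into (carrier A5) delta a) \<cdot> a) = (0 :: 'k alg)"
    and p: "p \<in> carrier A5" for u p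
  proof -
    have "(\<Sum>p\<in>carrier A5. u p \<cdot> delta p) = (0 :: 'k alg)"
      using u inj by (subst (asm) sum.reindex) auto
    then have "coeff (\<Sum>p\<in>carrier A5. u p \<cdot> delta p :: 'k alg) p = 0" by (simp add: coeff_zero)
    moreover have "coeff (\<Sum>p\<in>carrier A5. u p \<cdot> delta p :: 'k alg) p = (\<Sum>q\<in>carrier A5. if q = p then u q else 0)"
      unfolding coeff_sum by (intro sum.cong refl) (auto simp: coeff_scal coeff_delta)
    ultimately show ?thesis using p by (simp add: sum.delta)
  qed note * = this
  show ?thesis
  proof (rule V.independent_if_scalars_zero)
    show "finite (delta ` carrier A5 :: 'k alg set)" by simp
    fix f :: "'k alg \<Rightarrow> 'k" and x :: "'k alg"
    assume f: "(\<Sum>x\<in>delta ` carrier A5. f x \<cdot> x) = 0" and x: "x \<in> delta ` carrier A5"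
    obtain p where p: "p \<in> carrier A5" "x = delta p" using x by blast
    have "(\<Sum>a\<in>delta ` carrier A5. (f \<circ> delta) (inv_into (carrier A5) delta a) \<cdot> a) = (0 :: 'k alg)"
      using f by (subst (asm) sum.cong[OF refl]) (auto simp: f_inv_into_f)
    from *[OF this p(1)] show "f x = 0" using p(2) by simp
  qed
qed

interpretation V: finite_dimensional_vector_space "scal :: 'k::field \<Rightarrow> 'k alg \<Rightarrow> 'k alg" "delta ` carrier A5"
proof
  show "V.span (delta ` carrier A5) = (UNIV :: 'k alg set)"
  proof (intro subset_antisym subsetI)
    fix a :: "'k alg"
    show "a \<in> V.span (delta ` carrier A5)"
      by (subst alg_expand) (intro V.span_sum V.span_scale V.span_base imageI)
  qed simp
qed (simp_all add: delta_independent)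

section \<open>Local idempotents\<close>

text \<open>The corner of \<open>e\<close> consists of scalars modulo nilpotent elements. Asking for square zero, not
  just nilpotency, keeps the arguments below equational.\<close>

definition local_idem :: "'k::field alg \<Rightarrow> bool"
  where "local_idem e \<longleftrightarrow> e * e = e \<and> (\<forall>a. \<exists>c. (e * a * e - c \<cdot> e) * (e * a * e - c \<cdot> e) = 0)"

lemma local_idemD:
  assumes "local_idem e"
  shows "e * e = e" "e * (e * a) = e * a" "a * e * e = a * e"
  using assms by (simp_all add: local_idem_def mult.assoc flip: mult.assoc[of e e a])

lemma local_idem_corner:
  assumes "local_idem e" "e * a * e = a"
  shows "\<exists>c. (a - c \<cdot> e) * (a - c \<cdot> e) = 0"
  using assms unfolding local_idem_def by metis

locale alg_module = left_module "kA5 :: ((nat \<Rightarrow> nat) \<Rightarrow> 'k::field) ring" M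
  for M :: "('k::field, 'b, 'm) kA5_scheme" (structure)
begin

lemma act_closed [simp]: "x \<in> carrier M \<Longrightarrow> a \<star> x \<in> carrier M"
  by (simp add: smult_closed)

lemma act_add: "x \<in> carrier M \<Longrightarrow> (a + b) \<star> x = a \<star> x \<oplus> b \<star> x"
  by (simp add: coeff_ops smult_l_distr)

lemma act_mult: "x \<in> carrier M \<Longrightarrow> (a * b) \<star> x = a \<star> (b \<star> x)"
  by (simp add: coeff_ops smult_assoc)

lemma act_one [simp]: "x \<in> carrier M \<Longrightarrow> 1 \<star> x = x"
  by (simp add: coeff_ops smult_one)

lemma act_zero [simp]: "x \<in> carrier M \<Longrightarrow> 0 \<star> x = \<zero>"
  by (simp add: coeff_ops)

lemma act_null [simp]: "a \<star> \<zero> = \<zero>"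
  by simp

lemma act_diff_eq_zero:
  assumes "x \<in> carrier M" "a \<star> x = b \<star> x"
  shows "(a - b) \<star> x = \<zero>"
  using act_add[OF assms(1), of "a - b" b] assms by (simp add: M.add.l_cancel_one)

lemma act_eq_of_diff:
  assumes "x \<in> carrier M" "(a - b) \<star> x = \<zero>"
  shows "a \<star> x = b \<star> x"
  using act_add[OF assms(1), of "a - b" b] assms by simp

lemma act_scal: "x \<in> carrier M \<Longrightarrow> (c \<cdot> a) \<star> x = (c \<cdot> 1) \<star> (a \<star> x)"
  by (simp flip: act_mult)

lemma act_scal_eq_zero:
  assumes "x \<in> carrier M" "(c \<cdot> 1) \<star> x = \<zero>" "c \<noteq> 0"
  shows "x = \<zero>"
proof -
  have "((1 / c) \<cdot> c \<cdot> 1) \<star> x = \<zero>"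
    using assms act_scal[of x "1 / c" "c \<cdot> 1"] by simp
  then show ?thesis using assms by simp
qed

text \<open>Write \<open>r = c \<cdot> e + n\<close> with \<open>n\<^sup>2 = 0\<close>. Then \<open>c\<close> is the only possible eigenvalue of \<open>r\<close> on vectors
  fixed by \<open>e\<close>; here \<open>0\<close> is one, so \<open>r = n\<close>.\<close>

lemma local_idem_kills:
  assumes e: "local_idem e" and r: "e * r * e = r"
    and x: "x \<in> carrier M" "x \<noteq> \<zero>" "e \<star> x = x" "r \<star> x = \<zero>"
  shows "r * r = 0"
proof -
  obtain c where c: "(r - c \<cdot> e) * (r - c \<cdot> e) = 0"
    using local_idem_corner[OF e r] by blast
  have er: "e * r = r" "r * e = r" using r local_idemD[OF e] by (metis mult.assoc)+
  have "(c * c) \<cdot> e = (c \<cdot> 1 + c \<cdot> 1 - r) * r"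
    using c local_idemD(1)[OF e] by (simp add: algebra_simps er)
  then have "((c * c) \<cdot> e) \<star> x = \<zero>"
    using x by (simp add: act_mult)
  then have "((c * c) \<cdot> 1) \<star> x = \<zero>"
    using act_scal[OF x(1), of "c * c" e] x by simp
  then have "c = 0" using act_scal_eq_zero[OF x(1)] x(2) by fastforce
  then show ?thesis using c by simp
qed

lemma local_idem_fixes:
  assumes e: "local_idem e" and r: "e * r * e = r"
    and x: "x \<in> carrier M" "x \<noteq> \<zero>" "e \<star> x = x" "r \<star> x = x"
  shows "(r - e) * (r - e) = 0"
proof (rule local_idem_kills[OF e _ x(1-3)])
  show "e * (r - e) * e = r - e"
    using r local_idemD[OF e] by (simp add: algebra_simps)
  show "(r - e) \<star> x = \<zero>" using x by (intro act_diff_eq_zero) auto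
qed

text \<open>Let \<open>u = r s\<close> with \<open>r = c \<cdot> e + n\<close> in the corner and \<open>n\<^sup>2 = 0\<close>. If \<open>n s\<close> were nonzero, simplicity
  would give some \<open>b\<close> with \<open>b n s = s\<close>. The element \<open>e b n\<close> fixes \<open>s\<close>, so it is \<open>e\<close> plus an element of
  square zero and invertible in the corner; but its product with \<open>n\<close> is zero.\<close>

lemma local_idem_eigenspace:
  assumes e: "local_idem e" and simple: "simple_module kA5 M"
    and s: "s \<in> carrier M" "s \<noteq> \<zero>" "e \<star> s = s"
    and u: "u \<in> carrier M" "e \<star> u = u"
  shows "\<exists>c. u = (c \<cdot> 1) \<star> s"
proof -
  obtain a where a: "a \<star> s = u"
    using simple_generated[OF simple s(1,2) u(1)] carrier_kA5 by (metis imageE)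
  define r where "r = e * a * e"
  have rs: "r \<star> s = u" using s u a by (simp add: r_def act_mult)
  have er: "e * r * e = r" "r * e = r" "e * r = r"
    using local_idemD[OF e] by (simp_all add: r_def mult.assoc)
  obtain c where c: "(r - c \<cdot> e) * (r - c \<cdot> e) = 0" using local_idem_corner[OF e er(1)] by blast
  define n where "n = r - c \<cdot> e"
  have n: "e * n = n" "n * e = n" "n * n = 0"
    using c er local_idemD(1)[OF e] by (simp_all add: n_def algebra_simps)
  have "n \<star> s = \<zero>"
  proof (rule ccontr)
    assume ne: "n \<star> s \<noteq> \<zero>"
    then obtain b where b: "b \<star> (n \<star> s) = s"
      using simple_generated[OF simple act_closed[OF s(1)] ne s(1)] by (auto simp: carrier_kA5)
    define q where "q = e * b * n"
    have q: "e * q * e = q" "q * e = q" "e * q = q"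
      using local_idemD[OF e] n by (simp_all add: q_def mult.assoc)
    have "q \<star> s = s" using b s by (simp add: q_def act_mult)
    then have "(q - e) * (q - e) = 0" using local_idem_fixes[OF e q(1) s] by blast
    then have "e = (2 - q) * q" using q local_idemD(1)[OF e] by (simp add: algebra_simps mult_2)
    then have "e * n = (2 - q) * (q * n)" by (metis mult.assoc)
    moreover have "q * n = 0" using n by (simp add: q_def mult.assoc)
    ultimately have "n = 0" using n by simp
    then show False using ne s by simp
  qed
  then have "r \<star> s = (c \<cdot> e) \<star> s"
    unfolding n_def by (intro act_eq_of_diff s)
  also have "\<dots> = (c \<cdot> 1) \<star> s" using act_scal[OF s(1), of c e] s by simp
  finally show ?thesis using rs by blast
qed

text \<open>As \<open>k\<close> kills \<open>s\<close>, the corner element \<open>e k\<close> has square zero, and \<open>e m = e - e k\<close> has the inverse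
  \<open>e + e k\<close> in the corner. This says that the kernel of \<open>a \<mapsto> a s\<close> on \<open>R e\<close> is superfluous.\<close>

lemma local_idem_superfluous:
  assumes e: "local_idem e"
    and s: "s \<in> carrier M" "s \<noteq> \<zero>" "e \<star> s = s"
    and m: "e = m + k" "m * e = m" "k * e = k" "k \<star> s = \<zero>"
  shows "\<exists>b. e = b * m"
proof -
  have "(e * k) * (e * k) = 0"
  proof (rule local_idem_kills[OF e _ s])
    show "e * (e * k) * e = e * k" using m(3) local_idemD[OF e] by (simp add: mult.assoc)
    show "(e * k) \<star> s = \<zero>" using m(4) s by (simp add: act_mult)
  qed
  moreover have "e * m = e - e * k"
    using local_idemD(1)[OF e] m(1) by (metis add_diff_cancel_right' distrib_left)
  moreover have "(e * k) * e = e * k" using m(3) by (simp add: mult.assoc)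
  moreover have "(e + e * k) * (e - e * k) = e * e - e * (e * k) + (e * k) * e - (e * k) * (e * k)"
    by (simp add: algebra_simps)
  ultimately have "(e + e * k) * (e * m) = e"
    using local_idemD(1,2)[OF e] by simp
  then show ?thesis by (metis mult.assoc)
qed

end

lemma left_module_isomorphicI:
  assumes "\<And>x. x \<in> carrier M \<Longrightarrow> f x \<in> carrier N"
    "\<And>x y. \<lbrakk>x \<in> carrier M; y \<in> carrier M\<rbrakk> \<Longrightarrow> f (x \<oplus>\<^bsub>M\<^esub> y) = f x \<oplus>\<^bsub>N\<^esub> f y"
    "\<And>a x. \<lbrakk>a \<in> carrier R; x \<in> carrier M\<rbrakk> \<Longrightarrow> f (a \<odot>\<^bsub>M\<^esub> x) = a \<odot>\<^bsub>N\<^esub> f x"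
    "bij_betw f (carrier M) (carrier N)"
  shows "left_module_isomorphic R M N"
  using assms unfolding left_module_isomorphic_def left_module_hom_def by blast

text \<open>Otherwise \<open>b a s = s\<close> for some \<open>b\<close>. The corner element \<open>e b a e\<close> kills \<open>t\<close>, hence has square zero,
  and at the same time fixes \<open>s\<close>.\<close>

lemma local_idem_annihilator:
  fixes T :: "('k::field, 'b, 'm) kA5_scheme"
    and S :: "('k::field, 'c, 'n) kA5_scheme"
  assumes e: "local_idem e" and T: "left_module kA5 T" and S: "simple_module kA5 S"
    and t: "t \<in> carrier T" "t \<noteq> \<zero>\<^bsub>T\<^esub>" "e \<star>\<^bsub>T\<^esub> t = t"
    and s: "s \<in> carrier S" "s \<noteq> \<zero>\<^bsub>S\<^esub>" "e \<star>\<^bsub>S\<^esub> s = s"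
    and a: "a \<star>\<^bsub>T\<^esub> t = \<zero>\<^bsub>T\<^esub>"
  shows "a \<star>\<^bsub>S\<^esub> s = \<zero>\<^bsub>S\<^esub>"
proof (rule ccontr)
  interpret T: alg_module T using T by (simp add: alg_module_def)
  interpret S: alg_module S using S by (simp add: simple_module_def alg_module_def)
  assume ne: "a \<star>\<^bsub>S\<^esub> s \<noteq> \<zero>\<^bsub>S\<^esub>"
  then obtain b where b: "b \<star>\<^bsub>S\<^esub> (a \<star>\<^bsub>S\<^esub> s) = s"
    using S.simple_generated[OF S S.act_closed[OF s(1)] ne s(1)] by (auto simp: carrier_kA5)
  have "(e * (b * a) * e) * (e * (b * a) * e) = 0"
  proof (rule T.local_idem_kills[OF e _ t])
    show "e * (e * (b * a) * e) * e = e * (b * a) * e"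
      using local_idemD(1,2)[OF e] by (simp add: mult.assoc)
    show "(e * (b * a) * e) \<star>\<^bsub>T\<^esub> t = \<zero>\<^bsub>T\<^esub>"
      using a t by (simp add: T.act_mult)
  qed
  moreover have "(e * (b * a) * e) \<star>\<^bsub>S\<^esub> s = s" using b s by (simp add: S.act_mult)
  ultimately show False using s S.act_mult[of s "e * (b * a) * e" "e * (b * a) * e"] by simp
qed

text \<open>Vectors \<open>t\<close> and \<open>s\<close> fixed by \<open>e\<close> have the same annihilator, and \<open>a t \<mapsto> a s\<close> is an isomorphism.\<close>

lemma local_idem_isomorphic:
  fixes T :: "('k::field, 'b, 'm) kA5_scheme"
    and S :: "('k::field, 'c, 'n) kA5_scheme"
  assumes e: "local_idem e" and T: "simple_module kA5 T" and S: "simple_module kA5 S"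
    and t: "t \<in> carrier T" "e \<star>\<^bsub>T\<^esub> t \<noteq> \<zero>\<^bsub>T\<^esub>"
    and s: "s \<in> carrier S" "e \<star>\<^bsub>S\<^esub> s \<noteq> \<zero>\<^bsub>S\<^esub>"
  shows "left_module_isomorphic kA5 T S"
proof -
  interpret T: alg_module T using T by (simp add: simple_module_def alg_module_def)
  interpret S: alg_module S using S by (simp add: simple_module_def alg_module_def)
  define t' where "t' = e \<star>\<^bsub>T\<^esub> t"
  define s' where "s' = e \<star>\<^bsub>S\<^esub> s"
  have t': "t' \<in> carrier T" "t' \<noteq> \<zero>\<^bsub>T\<^esub>" "e \<star>\<^bsub>T\<^esub> t' = t'"
    using t local_idemD(1)[OF e] T.act_mult[of t e e] by (simp_all add: t'_def)
  have s': "s' \<in> carrier S" "s' \<noteq> \<zero>\<^bsub>S\<^esub>" "e \<star>\<^bsub>S\<^esub> s' = s'"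
    using s local_idemD(1)[OF e] S.act_mult[of s e e] by (simp_all add: s'_def)
  have kill1: "a \<star>\<^bsub>S\<^esub> s' = \<zero>\<^bsub>S\<^esub>" if "a \<star>\<^bsub>T\<^esub> t' = \<zero>\<^bsub>T\<^esub>" for a
    by (rule local_idem_annihilator[OF e T.left_module_axioms S t' s' that])
  have kill2: "a \<star>\<^bsub>T\<^esub> t' = \<zero>\<^bsub>T\<^esub>" if "a \<star>\<^bsub>S\<^esub> s' = \<zero>\<^bsub>S\<^esub>" for a
    by (rule local_idem_annihilator[OF e S.left_module_axioms T s' t' that])
  have same: "a \<star>\<^bsub>T\<^esub> t' = b \<star>\<^bsub>T\<^esub> t' \<longleftrightarrow> a \<star>\<^bsub>S\<^esub> s' = b \<star>\<^bsub>S\<^esub> s'" for a b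
    using kill1[of "a - b"] kill2[of "a - b"] T.act_diff_eq_zero[OF t'(1)] S.act_diff_eq_zero[OF s'(1)]
      T.act_eq_of_diff[OF t'(1)] S.act_eq_of_diff[OF s'(1)] by blast
  have gen_T: "\<exists>a. y = a \<star>\<^bsub>T\<^esub> t'" if "y \<in> carrier T" for y
    using T.simple_generated[OF T t'(1,2) that] carrier_kA5 by (metis imageE)
  have gen_S: "\<exists>a. y = a \<star>\<^bsub>S\<^esub> s'" if "y \<in> carrier S" for y
    using S.simple_generated[OF S s'(1,2) that] carrier_kA5 by (metis imageE)
  define f where "f y = (SOME a. y = a \<star>\<^bsub>T\<^esub> t') \<star>\<^bsub>S\<^esub> s'" for y
  have f: "f (a \<star>\<^bsub>T\<^esub> t') = a \<star>\<^bsub>S\<^esub> s'" for a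
    unfolding f_def by (rule someI2[of _ a]) (simp_all add: same[symmetric])
  show ?thesis
  proof (rule left_module_isomorphicI)
    show "f y \<in> carrier S" if "y \<in> carrier T" for y using s' by (simp add: f_def)
    show "f (x \<oplus>\<^bsub>T\<^esub> y) = f x \<oplus>\<^bsub>S\<^esub> f y" if xy: "x \<in> carrier T" "y \<in> carrier T" for x y
    proof -
      obtain a b where "x = a \<star>\<^bsub>T\<^esub> t'" "y = b \<star>\<^bsub>T\<^esub> t'" using gen_T xy by blast
      then show ?thesis using t' s' by (simp add: f flip: T.act_add S.act_add)
    qed
    show "f (r \<odot>\<^bsub>T\<^esub> x) = r \<odot>\<^bsub>S\<^esub> f x" if r: "r \<in> carrier kA5" and x: "x \<in> carrier T" for r x
    proof -
      obtain a b where "r = coeff a" "x = b \<star>\<^bsub>T\<^esub> t'"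
        using gen_T[OF x] r carrier_kA5 by (metis imageE)
      then show ?thesis using t' s' by (simp add: f flip: T.act_mult S.act_mult)
    qed
    show "bij_betw f (carrier T) (carrier S)"
    proof (rule bij_betwI')
      show "f x = f y \<longleftrightarrow> x = y" if xy: "x \<in> carrier T" "y \<in> carrier T" for x y
      proof -
        obtain a b where "x = a \<star>\<^bsub>T\<^esub> t'" "y = b \<star>\<^bsub>T\<^esub> t'" using gen_T xy by blast
        then show ?thesis by (simp add: f same)
      qed
      show "f x \<in> carrier S" if "x \<in> carrier T" for x using s' by (simp add: f_def)
      show "\<exists>x\<in>carrier T. y = f x" if y: "y \<in> carrier S" for y
        using gen_S[OF y] f t' by (metis T.act_closed)
    qed
  qed
qed

section \<open>Projective covers are left ideals generated by local idempotents\<close>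

context alg_module
begin

text \<open>Choosing a preimage in \<open>R e\<close> for the image of each basis vector defines a map from the free
  module to \<open>R e\<close>; its composition with the embedding of the projective module is the section.\<close>

lemma projective_section:
  assumes proj: "projective_module kA5 M" and p: "p \<in> carrier M"
    and surj: "\<And>x. x \<in> carrier M \<Longrightarrow> \<exists>a. a * e = a \<and> a \<star> p = x"
  shows "\<exists>\<sigma>. (\<forall>x\<in>carrier M. \<sigma> x * e = \<sigma> x \<and> (\<sigma> x) \<star> p = x) \<and>
    (\<forall>x\<in>carrier M. \<forall>y\<in>carrier M. \<sigma> (x \<oplus> y) = \<sigma> x + \<sigma> y) \<and>
    (\<forall>a. \<forall>x\<in>carrier M. \<sigma> (a \<star> x) = a * \<sigma> x)"
proof -
  let ?R = "kA5 :: ((nat \<Rightarrow> nat) \<Rightarrow> 'k) ring"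
  obtain I :: "'b set" and \<iota> \<pi> where
    \<iota>: "\<iota> \<in> left_module_hom ?R M (free_module ?R I)" and
    \<pi>: "\<pi> \<in> left_module_hom ?R (free_module ?R I) M" and
    \<pi>\<iota>: "\<And>x. x \<in> carrier M \<Longrightarrow> \<pi> (\<iota> x) = x"
    using proj unfolding projective_module_def by blast
  let ?F = "free_module ?R I"
  let ?Z = "\<zero>\<^bsub>?R\<^esub>"
  have F: "f \<in> carrier ?F \<longleftrightarrow> (\<forall>i. f i \<in> carrier ?R) \<and> finite {i. f i \<noteq> ?Z} \<and> {i. f i \<noteq> ?Z} \<subseteq> I" for f
    by (auto simp: free_module_def)
  have Fadd: "f \<oplus>\<^bsub>?F\<^esub> g = (\<lambda>i. f i \<oplus>\<^bsub>?R\<^esub> g i)" for f g by (simp add: free_module_def)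
  have Fsmult: "a \<odot>\<^bsub>?F\<^esub> f = (\<lambda>i. a \<otimes>\<^bsub>?R\<^esub> f i)" for a f by (simp add: free_module_def)
  define \<delta> where "\<delta> j = (\<lambda>i. if i = j then \<one>\<^bsub>?R\<^esub> else ?Z)" for j :: 'b
  have \<delta>: "\<delta> j \<in> carrier ?F" if "j \<in> I" for j
  proof -
    have "{i. \<delta> j i \<noteq> ?Z} \<subseteq> {j}" by (auto simp: \<delta>_def)
    then show ?thesis using that unfolding F by (auto simp: \<delta>_def intro: finite_subset)
  qed
  have \<pi>_closed: "\<pi> f \<in> carrier M" if "f \<in> carrier ?F" for f
    using \<pi> that by (auto simp: left_module_hom_def)
  have \<pi>_add: "\<pi> (f \<oplus>\<^bsub>?F\<^esub> g) = \<pi> f \<oplus> \<pi> g" if "f \<in> carrier ?F" "g \<in> carrier ?F" for f g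
    using \<pi> that by (auto simp: left_module_hom_def)
  have \<pi>_smult: "\<pi> (a \<odot>\<^bsub>?F\<^esub> f) = a \<odot> \<pi> f" if "a \<in> carrier ?R" "f \<in> carrier ?F" for a f
    using \<pi> that by (auto simp: left_module_hom_def)
  have "\<forall>j\<in>I. \<exists>q. q * e = q \<and> q \<star> p = \<pi> (\<delta> j)"
    using surj \<pi>_closed \<delta> by blast
  then obtain q where q: "\<And>j. j \<in> I \<Longrightarrow> q j * e = q j \<and> q j \<star> p = \<pi> (\<delta> j)" by metis
  define lift where "lift f = (\<Sum>i | f i \<noteq> ?Z. Alg (f i) * q i)" for f
  have Alg_zero: "Alg ?Z = 0" by (simp add: zero_alg_def)
  have lift: "lift f = (\<Sum>i\<in>J. Alg (f i) * q i)" if "finite J" "{i. f i \<noteq> ?Z} \<subseteq> J" for f J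
    unfolding lift_def using that by (intro sum.mono_neutral_left) (auto simp: Alg_zero)
  have lift_add: "lift (f \<oplus>\<^bsub>?F\<^esub> g) = lift f + lift g" if "f \<in> carrier ?F" "g \<in> carrier ?F" for f g
  proof -
    let ?J = "{i. f i \<noteq> ?Z} \<union> {i. g i \<noteq> ?Z}"
    have J: "finite ?J" using that by (simp add: F)
    have "Alg (f i \<oplus>\<^bsub>?R\<^esub> g i) = Alg (f i) + Alg (g i)" for i
      using that by (simp add: F plus_alg_def Alg_inverse)
    moreover have "lift (f \<oplus>\<^bsub>?F\<^esub> g) = (\<Sum>i\<in>?J. Alg ((f \<oplus>\<^bsub>?F\<^esub> g) i) * q i)"
      using J by (rule lift) (auto simp: Fadd)
    ultimately show ?thesis
      using lift[OF J, of f] lift[OF J, of g]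
      by (simp add: Fadd distrib_right sum.distrib)
  qed
  have lift_smult: "lift (coeff a \<odot>\<^bsub>?F\<^esub> f) = a * lift f" if "f \<in> carrier ?F" for a f
  proof -
    let ?J = "{i. f i \<noteq> ?Z}"
    have J: "finite ?J" using that by (simp add: F)
    have "Alg (coeff a \<otimes>\<^bsub>?R\<^esub> f i) = a * Alg (f i)" for i
      using that by (simp add: F times_alg_def Alg_inverse)
    moreover have "lift (coeff a \<odot>\<^bsub>?F\<^esub> f) = (\<Sum>i\<in>?J. Alg ((coeff a \<odot>\<^bsub>?F\<^esub> f) i) * q i)"
      using J by (rule lift) (auto simp: Fsmult)
    ultimately show ?thesis
      using lift[OF J, of f] by (simp add: Fsmult sum_distrib_left mult.assoc)
  qed
  have lift_e: "lift f * e = lift f" if "f \<in> carrier ?F" for f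
  proof -
    have "q i * e = q i" if "f i \<noteq> ?Z" for i using q \<open>f \<in> carrier ?F\<close> that by (auto simp: F)
    then show ?thesis unfolding lift_def sum_distrib_right by (intro sum.cong) (auto simp: mult.assoc)
  qed
  have lift_p: "lift f \<star> p = \<pi> f" if f: "f \<in> carrier ?F" for f
  proof -
    have "(\<Sum>i\<in>J. Alg (f i) * q i) \<star> p = \<pi> f"
      if "finite J" "J \<subseteq> I" "f \<in> carrier ?F" "{i. f i \<noteq> ?Z} \<subseteq> J" for f J
      using that
    proof (induction J arbitrary: f rule: finite_induct)
      case empty
      then have "f = (\<lambda>i. ?Z)" by auto
      then have "f = ?Z \<odot>\<^bsub>?F\<^esub> f" by (simp add: Fsmult)
      then have "\<pi> f = ?Z \<odot> \<pi> f" using \<pi>_smult[of ?Z f] empty by (metis kA5.zero_closed)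
      then have "\<pi> f = \<zero>" by (rule trans) (rule smult_l_null[OF \<pi>_closed[OF empty.prems(2)]])
      then show ?case by (simp only: sum.empty act_zero[OF p])
    next
      case (insert j J)
      let ?g = "f(j := ?Z)"
      have fj: "f j \<in> carrier ?R" using insert by (simp add: F)
      have g: "?g \<in> carrier ?F" using insert by (auto simp: F intro: finite_subset[of _ "{i. f i \<noteq> ?Z}"])
      have "{i. ?g i \<noteq> ?Z} \<subseteq> J" using insert by auto
      then have IH: "(\<Sum>i\<in>J. Alg (?g i) * q i) \<star> p = \<pi> ?g"
        using insert g by blast
      have eq: "(\<Sum>i\<in>J. Alg (?g i) * q i) = (\<Sum>i\<in>J. Alg (f i) * q i)"
        using insert by (intro sum.cong) auto
      have smult: "f j \<odot>\<^bsub>?F\<^esub> \<delta> j \<in> carrier ?F"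
        unfolding F Fsmult using fj insert.prems
        by (auto simp: \<delta>_def intro: finite_subset[of _ "{j}"])
      have "f = ?g \<oplus>\<^bsub>?F\<^esub> (f j \<odot>\<^bsub>?F\<^esub> \<delta> j)"
        using fj insert.prems by (auto simp: Fadd Fsmult \<delta>_def F)
      then have "\<pi> f = \<pi> ?g \<oplus> \<pi> (f j \<odot>\<^bsub>?F\<^esub> \<delta> j)"
        by (rule trans[OF arg_cong[of _ _ \<pi>] \<pi>_add[OF g smult]])
      also have "\<pi> (f j \<odot>\<^bsub>?F\<^esub> \<delta> j) = f j \<odot> \<pi> (\<delta> j)"
        using fj \<delta>[of j] insert.prems by (intro \<pi>_smult) auto
      also have "\<dots> = (Alg (f j) * q j) \<star> p"
        using q[of j] insert.prems fj p by (simp add: act_mult Alg_inverse)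
      finally have "\<pi> f = (\<Sum>i\<in>J. Alg (f i) * q i) \<star> p \<oplus> (Alg (f j) * q j) \<star> p"
        by (simp only: IH[symmetric] eq)
      also have "\<dots> = (\<Sum>i\<in>insert j J. Alg (f i) * q i) \<star> p"
        using p insert.hyps by (simp add: add.commute flip: act_add)
      finally show ?case by (rule sym)
    qed
    then show ?thesis using f lift[of "{i. f i \<noteq> ?Z}" f] by (simp add: F)
  qed
  have \<iota>_closed: "\<iota> x \<in> carrier ?F" if "x \<in> carrier M" for x
    using \<iota> that by (auto simp: left_module_hom_def)
  have \<iota>_add: "\<iota> (x \<oplus> y) = \<iota> x \<oplus>\<^bsub>?F\<^esub> \<iota> y" if "x \<in> carrier M" "y \<in> carrier M" for x y
    using \<iota> that by (auto simp: left_module_hom_def)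
  have \<iota>_smult: "\<iota> (a \<star> x) = coeff a \<odot>\<^bsub>?F\<^esub> \<iota> x" if "x \<in> carrier M" for a x
    using \<iota> that by (auto simp: left_module_hom_def)
  show ?thesis
  proof (intro exI[of _ "\<lambda>x. lift (\<iota> x)"] conjI ballI allI)
    fix x y a assume x: "x \<in> carrier M" and y: "y \<in> carrier M"
    show "lift (\<iota> x) * e = lift (\<iota> x)" by (rule lift_e[OF \<iota>_closed[OF x]])
    show "(lift (\<iota> x)) \<star> p = x" by (rule trans[OF lift_p[OF \<iota>_closed[OF x]] \<pi>\<iota>[OF x]])
    show "lift (\<iota> (x \<oplus> y)) = lift (\<iota> x) + lift (\<iota> y)"
      unfolding \<iota>_add[OF x y] by (rule lift_add[OF \<iota>_closed[OF x] \<iota>_closed[OF y]])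
    show "lift (\<iota> (a \<star> x)) = a * lift (\<iota> x)"
      unfolding \<iota>_smult[OF x] by (rule lift_smult[OF \<iota>_closed[OF x]])
  qed
qed

end

lemma superfluousD:
  assumes "superfluous_submodule R M K" "submodule N R M"
    "\<And>x. x \<in> carrier M \<Longrightarrow> \<exists>y\<in>N. \<exists>z\<in>K. x = y \<oplus>\<^bsub>M\<^esub> z" "left_module R M"
  shows "N = carrier M"
proof -
  have "N \<subseteq> carrier M" "K \<subseteq> carrier M"
    using assms left_module.submoduleD(1) unfolding superfluous_submodule_def by blast+
  then have "N <+>\<^bsub>M\<^esub> K = carrier M"
    unfolding set_add_def'
  proof (intro subset_antisym subsetI)
    fix x assume "x \<in> (\<Union>h\<in>N. \<Union>k\<in>K. {h \<oplus>\<^bsub>M\<^esub> k})"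
    then obtain h k where "h \<in> N" "k \<in> K" "x = h \<oplus>\<^bsub>M\<^esub> k" by blast
    moreover have "h \<in> carrier M" "k \<in> carrier M" using \<open>N \<subseteq> carrier M\<close> \<open>K \<subseteq> carrier M\<close> calculation by blast+
    ultimately show "x \<in> carrier M"
      using left_module.submoduleD(3)[OF assms(4) left_module.submodule_carrier[OF assms(4)]] by blast
  next
    fix x assume "x \<in> carrier M"
    then obtain y z where "y \<in> N" "z \<in> K" "x = y \<oplus>\<^bsub>M\<^esub> z" using assms(3) by blast
    then show "x \<in> (\<Union>h\<in>N. \<Union>k\<in>K. {h \<oplus>\<^bsub>M\<^esub> k})" by blast
  qed
  then show ?thesis using assms(1,2) unfolding superfluous_submodule_def by blast
qed

text \<open>Lift a nonzero vector \<open>s\<close> of \<open>e S\<close> to \<open>p\<close> in \<open>e P\<close>. The submodule generated by \<open>p\<close> maps onto \<open>S\<close>,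
  so it is all of \<open>P\<close>. A section \<open>\<sigma>\<close> of \<open>a \<mapsto> a p\<close> embeds \<open>P\<close> into \<open>R e\<close>, and its image together
  with the superfluous kernel of \<open>R e \<rightarrow> S\<close> generates \<open>R e\<close>; so \<open>\<sigma>\<close> is onto.\<close>

lemma projective_cover_left_ideal:
  fixes P :: "('k::field, 'b, 'm) kA5_scheme"
    and S :: "('k::field, 'c, 'n) kA5_scheme"
  assumes cover: "is_projective_cover kA5 P \<pi> S" and S: "simple_module kA5 S" and e: "local_idem e"
    and s0: "s0 \<in> carrier S" "e \<star>\<^bsub>S\<^esub> s0 \<noteq> \<zero>\<^bsub>S\<^esub>"
  shows "\<exists>\<sigma>. bij_betw \<sigma> (carrier P) {a. a * e = a} \<and>
    (\<forall>x\<in>carrier P. \<forall>y\<in>carrier P. \<sigma> (x \<oplus>\<^bsub>P\<^esub> y) = \<sigma> x + \<sigma> y) \<and>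
    (\<forall>a. \<forall>x\<in>carrier P. \<sigma> (a \<star>\<^bsub>P\<^esub> x) = a * \<sigma> x)"
proof -
  have proj: "projective_module kA5 P" and sup: "superfluous_submodule kA5 P (a_kernel P S \<pi>)"
    and \<pi>: "\<pi> \<in> left_module_hom kA5 P S" and onto: "\<pi> ` carrier P = carrier S"
    using cover by (auto simp: is_projective_cover_def)
  interpret P: alg_module P using proj by (simp add: projective_module_def alg_module_def)
  interpret S: alg_module S using S by (simp add: simple_module_def alg_module_def)
  have \<pi>_closed: "\<pi> x \<in> carrier S" if "x \<in> carrier P" for x using \<pi> that by (auto simp: left_module_hom_def)
  have \<pi>_add: "\<pi> (x \<oplus>\<^bsub>P\<^esub> y) = \<pi> x \<oplus>\<^bsub>S\<^esub> \<pi> y" if "x \<in> carrier P" "y \<in> carrier P" for x y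
    using \<pi> that by (auto simp: left_module_hom_def)
  have \<pi>_act: "\<pi> (a \<star>\<^bsub>P\<^esub> x) = a \<star>\<^bsub>S\<^esub> \<pi> x" if "x \<in> carrier P" for a x
    using \<pi> that by (auto simp: left_module_hom_def)
  have kerI: "x \<in> a_kernel P S \<pi>" if "x \<in> carrier P" "\<pi> x = \<zero>\<^bsub>S\<^esub>" for x
    using that by (simp add: a_kernel_def')
  define s where "s = e \<star>\<^bsub>S\<^esub> s0"
  have s: "s \<in> carrier S" "s \<noteq> \<zero>\<^bsub>S\<^esub>" "e \<star>\<^bsub>S\<^esub> s = s"
    using s0 local_idemD(1)[OF e] S.act_mult[of s0 e e] by (simp_all add: s_def)
  obtain p0 where p0: "p0 \<in> carrier P" "\<pi> p0 = s" using onto s(1) by (metis imageE)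
  define p where "p = e \<star>\<^bsub>P\<^esub> p0"
  have p: "p \<in> carrier P" "\<pi> p = s" "e \<star>\<^bsub>P\<^esub> p = p"
    using p0 s local_idemD(1)[OF e] P.act_mult[of p0 e e] by (simp_all add: p_def \<pi>_act)
  define N where "N = range (\<lambda>a. a \<star>\<^bsub>P\<^esub> p)"
  have N: "submodule N kA5 P"
  proof (rule P.submoduleI)
    show "\<zero>\<^bsub>P\<^esub> \<in> N" unfolding N_def using p by (intro image_eqI[of _ _ 0]) auto
    show "x \<oplus>\<^bsub>P\<^esub> y \<in> N" if "x \<in> N" "y \<in> N" for x y
      using that p by (auto simp: N_def simp flip: P.act_add)
    show "a \<odot>\<^bsub>P\<^esub> x \<in> N" if "a \<in> carrier kA5" "x \<in> N" for a x
      using that p by (auto simp: N_def carrier_kA5 simp flip: P.act_mult)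
  qed (use p in \<open>auto simp: N_def\<close>)
  have "N = carrier P"
  proof (rule superfluousD[OF sup N _ P.left_module_axioms])
    fix x assume x: "x \<in> carrier P"
    obtain a where a: "a \<star>\<^bsub>S\<^esub> s = \<pi> x"
      using S.simple_generated[OF S s(1,2) \<pi>_closed[OF x]] by (auto simp: carrier_kA5)
    define y where "y = a \<star>\<^bsub>P\<^esub> p"
    have y: "y \<in> N" "y \<in> carrier P" "\<pi> y = \<pi> x" using p a by (auto simp: y_def N_def \<pi>_act)
    have "\<pi> (\<ominus>\<^bsub>P\<^esub> y) \<oplus>\<^bsub>S\<^esub> \<pi> y = \<pi> (\<zero>\<^bsub>P\<^esub>)" using y \<pi>_add[of "\<ominus>\<^bsub>P\<^esub> y" y] by (simp add: P.M.l_neg)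
    moreover have "\<pi> (\<zero>\<^bsub>P\<^esub>) = \<zero>\<^bsub>S\<^esub>" using \<pi>_act[of "\<zero>\<^bsub>P\<^esub>" 0] \<pi>_closed[of "\<zero>\<^bsub>P\<^esub>"] by simp
    ultimately have "\<pi> (\<ominus>\<^bsub>P\<^esub> y \<oplus>\<^bsub>P\<^esub> x) = \<zero>\<^bsub>S\<^esub>" using x y by (simp add: \<pi>_add)
    then have "\<ominus>\<^bsub>P\<^esub> y \<oplus>\<^bsub>P\<^esub> x \<in> a_kernel P S \<pi>" using x y by (intro kerI) auto
    moreover have "x = y \<oplus>\<^bsub>P\<^esub> (\<ominus>\<^bsub>P\<^esub> y \<oplus>\<^bsub>P\<^esub> x)" using x y
      by (metis P.M.a_assoc P.M.a_inv_closed P.M.l_zero P.M.r_neg)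
    ultimately show "\<exists>y\<in>N. \<exists>z\<in>a_kernel P S \<pi>. x = y \<oplus>\<^bsub>P\<^esub> z" using y(1) by blast
  qed
  have gen: "\<exists>a. a * e = a \<and> a \<star>\<^bsub>P\<^esub> p = x" if "x \<in> carrier P" for x
  proof -
    have "x \<in> N" using that \<open>N = carrier P\<close> by simp
    then obtain a where "x = a \<star>\<^bsub>P\<^esub> p" by (auto simp: N_def)
    then show ?thesis using p local_idemD(3)[OF e] by (intro exI[of _ "a * e"]) (auto simp: P.act_mult)
  qed
  obtain \<sigma> where \<sigma>: "\<And>x. x \<in> carrier P \<Longrightarrow> \<sigma> x * e = \<sigma> x"
    "\<And>x. x \<in> carrier P \<Longrightarrow> (\<sigma> x) \<star>\<^bsub>P\<^esub> p = x"
    "\<forall>x\<in>carrier P. \<forall>y\<in>carrier P. \<sigma> (x \<oplus>\<^bsub>P\<^esub> y) = \<sigma> x + \<sigma> y"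
    "\<forall>a. \<forall>x\<in>carrier P. \<sigma> (a \<star>\<^bsub>P\<^esub> x) = a * \<sigma> x"
    using P.projective_section[OF proj p(1) gen] by metis
  have "\<exists>b. e = b * \<sigma> p"
  proof (rule S.local_idem_superfluous[OF e s])
    show "e = \<sigma> p + (e - \<sigma> p)" by simp
    show "\<sigma> p * e = \<sigma> p" using \<sigma>(1) p by blast
    then show "(e - \<sigma> p) * e = e - \<sigma> p" using local_idemD(1)[OF e] by (simp add: algebra_simps)
    have "(e - \<sigma> p) \<star>\<^bsub>P\<^esub> p = \<zero>\<^bsub>P\<^esub>" using p \<sigma>(2) by (intro P.act_diff_eq_zero) auto
    moreover have "\<pi> (\<zero>\<^bsub>P\<^esub>) = \<zero>\<^bsub>S\<^esub>" using \<pi>_act[of "\<zero>\<^bsub>P\<^esub>" 0] \<pi>_closed[of "\<zero>\<^bsub>P\<^esub>"] by simp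
    ultimately show "(e - \<sigma> p) \<star>\<^bsub>S\<^esub> s = \<zero>\<^bsub>S\<^esub>" using \<pi>_act[OF p(1)] p(2) by metis
  qed
  then obtain b where b: "e = b * \<sigma> p" ..
  have "bij_betw \<sigma> (carrier P) {a. a * e = a}"
  proof (rule bij_betwI')
    show "\<sigma> x = \<sigma> y \<longleftrightarrow> x = y" if "x \<in> carrier P" "y \<in> carrier P" for x y
      using that \<sigma>(2) by metis
    show "\<sigma> x \<in> {a. a * e = a}" if "x \<in> carrier P" for x using that \<sigma>(1) by simp
    show "\<exists>x\<in>carrier P. a = \<sigma> x" if a: "a \<in> {a. a * e = a}" for a
    proof (intro bexI)
      show "a = \<sigma> ((a * b) \<star>\<^bsub>P\<^esub> p)" using a b \<sigma>(4) p(1) by (simp add: mult.assoc)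
    qed (use p in simp)
  qed
  then show ?thesis using \<sigma>(3,4) by blast
qed

text \<open>The left ideal \<open>R e\<close>, with functions as elements: the choice in \<open>projective_cover\<close> ranges over
  modules with this element type.\<close>

definition left_ideal_module :: "'k::field alg \<Rightarrow> ((nat \<Rightarrow> nat) \<Rightarrow> 'k, (nat \<Rightarrow> nat) \<Rightarrow> 'k) module"
  where "left_ideal_module e = \<lparr>carrier = coeff ` {a. a * e = a}, mult = undefined, one = undefined,
    zero = \<zero>\<^bsub>kA5\<^esub>, add = add kA5, smult = mult kA5\<rparr>"

lemma left_ideal_module_sel:
  "carrier (left_ideal_module e) = coeff ` {a. a * e = a}"
  "\<zero>\<^bsub>left_ideal_module e\<^esub> = coeff 0"
  "coeff a \<oplus>\<^bsub>left_ideal_module e\<^esub> coeff b = coeff (a + b)"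
  "coeff a \<odot>\<^bsub>left_ideal_module e\<^esub> coeff b = coeff (a * b)"
  by (simp_all add: left_ideal_module_def coeff_ops)

lemma left_ideal_left_module: "left_module kA5 (left_ideal_module e)"
proof -
  let ?L = "left_ideal_module e"
  have inv: "\<exists>y\<in>carrier ?L. y \<oplus>\<^bsub>?L\<^esub> x = \<zero>\<^bsub>?L\<^esub>" if x: "x \<in> carrier ?L" for x
  proof -
    obtain a where "x = coeff a" "a * e = a" using x by (auto simp: left_ideal_module_sel)
    then show ?thesis
      by (intro bexI[of _ "coeff (- a)"]) (auto simp: left_ideal_module_sel)
  qed
  have "abelian_group ?L"
    using inv by (intro abelian_groupI)
      (auto simp: left_ideal_module_sel distrib_right add_ac intro!: image_eqI[OF refl])
  then show ?thesis
    using kA5.ring_axioms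
    by (intro left_module.intro left_module_axioms.intro)
       (auto simp: left_ideal_module_sel carrier_kA5 mult.assoc distrib_left distrib_right
         simp flip: coeff_ops intro!: image_eqI[OF refl])
qed

lemma left_ideal_projective:
  assumes "e * e = e"
  shows "projective_module kA5 (left_ideal_module e)"
proof -
  let ?L = "left_ideal_module e"
  define z where "z = coeff (0 :: 'a alg)"
  define \<iota> where "\<iota> x = (\<lambda>i. if i = z then x else z)" for x
  define \<pi> where "\<pi> f = f z \<otimes>\<^bsub>kA5\<^esub> coeff e" for f :: "((nat \<Rightarrow> nat) \<Rightarrow> 'a) \<Rightarrow> ((nat \<Rightarrow> nat) \<Rightarrow> 'a)"
  have z: "z = \<zero>\<^bsub>kA5\<^esub>" by (simp add: z_def coeff_ops)
  have Fc: "f z \<in> carrier kA5" if "f \<in> carrier (free_module kA5 {z})" for f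
    using that by (auto simp: free_module_def)
  have "\<iota> \<in> left_module_hom kA5 ?L (free_module kA5 {z})"
  proof -
    have "{i. \<iota> x i \<noteq> z} \<subseteq> {z}" for x by (auto simp: \<iota>_def)
    moreover have "finite {i. \<iota> x i \<noteq> z}" for x using \<open>{i. \<iota> x i \<noteq> z} \<subseteq> {z}\<close> finite_subset by blast
    ultimately show ?thesis
      by (auto simp: left_module_hom_def free_module_def left_ideal_module_def \<iota>_def z intro!: ext)
  qed
  moreover have "\<pi> \<in> left_module_hom kA5 (free_module kA5 {z}) ?L"
  proof -
    have "\<pi> f \<in> carrier ?L" if f: "f \<in> carrier (free_module kA5 {z})" for f
    proof -
      obtain a where "f z = coeff a" using Fc[OF f] by (auto simp: carrier_kA5)
      then show ?thesis using assms
        by (auto simp: \<pi>_def left_ideal_module_sel mult.assoc simp flip: coeff_ops)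
    qed
    moreover have "\<pi> (f \<oplus>\<^bsub>free_module kA5 {z}\<^esub> g) = \<pi> f \<oplus>\<^bsub>?L\<^esub> \<pi> g"
      if "f \<in> carrier (free_module kA5 {z})" "g \<in> carrier (free_module kA5 {z})" for f g
      using Fc[OF that(1)] Fc[OF that(2)]
      by (simp add: \<pi>_def free_module_def left_ideal_module_def kA5.l_distr)
    moreover have "\<pi> (a \<odot>\<^bsub>free_module kA5 {z}\<^esub> f) = a \<odot>\<^bsub>?L\<^esub> \<pi> f"
      if "a \<in> carrier kA5" "f \<in> carrier (free_module kA5 {z})" for a f
      using Fc[OF that(2)] that(1)
      by (simp add: \<pi>_def free_module_def left_ideal_module_def kA5.m_assoc)
    ultimately show ?thesis by (simp add: left_module_hom_def)
  qed
  moreover have "\<pi> (\<iota> x) = x" if "x \<in> carrier ?L" for x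
    using that by (auto simp: \<pi>_def \<iota>_def left_ideal_module_sel simp flip: coeff_ops)
  ultimately have "\<exists>\<iota>\<in>left_module_hom kA5 ?L (free_module kA5 {z}).
      \<exists>\<pi>\<in>left_module_hom kA5 (free_module kA5 {z}) ?L. \<forall>x\<in>carrier ?L. \<pi> (\<iota> x) = x"
    by (intro bexI[of _ \<iota>] bexI[of _ \<pi>]) auto
  then show ?thesis
    unfolding projective_module_def by (intro conjI left_ideal_left_module exI[of _ "{z}"])
qed

lemma left_ideal_projective_cover:
  fixes S :: "('k::field, 'c, 'n) kA5_scheme"
  assumes S: "simple_module kA5 S" and e: "local_idem e"
    and s0: "s0 \<in> carrier S" "e \<star>\<^bsub>S\<^esub> s0 \<noteq> \<zero>\<^bsub>S\<^esub>"
  shows "\<exists>\<pi>. is_projective_cover kA5 (left_ideal_module e) \<pi> S"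
proof -
  let ?L = "left_ideal_module e"
  interpret S: alg_module S using S by (simp add: simple_module_def alg_module_def)
  interpret L: alg_module ?L using left_ideal_left_module by (simp add: alg_module_def)
  define s where "s = e \<star>\<^bsub>S\<^esub> s0"
  have s: "s \<in> carrier S" "s \<noteq> \<zero>\<^bsub>S\<^esub>" "e \<star>\<^bsub>S\<^esub> s = s"
    using s0 local_idemD(1)[OF e] S.act_mult[of s0 e e] by (simp_all add: s_def)
  define \<pi> where "\<pi> x = x \<odot>\<^bsub>S\<^esub> s" for x
  have \<pi>: "\<pi> \<in> left_module_hom kA5 ?L S"
    using s by (auto simp: left_module_hom_def \<pi>_def left_ideal_module_sel carrier_kA5
      S.act_add S.act_mult)
  have onto: "\<pi> ` carrier ?L = carrier S"
  proof (intro subset_antisym subsetI)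
    fix y assume "y \<in> carrier S"
    then obtain a where "a \<star>\<^bsub>S\<^esub> s = y"
      using S.simple_generated[OF S s(1,2)] by (auto simp: carrier_kA5)
    then have "y = \<pi> (coeff (a * e))" using s by (simp add: \<pi>_def S.act_mult)
    then show "y \<in> \<pi> ` carrier ?L"
      using local_idemD(3)[OF e] by (auto simp: left_ideal_module_sel)
  qed (use \<pi> in \<open>auto simp: left_module_hom_def\<close>)
  let ?K = "a_kernel ?L S \<pi>"
  have K: "x \<in> ?K \<longleftrightarrow> x \<in> carrier ?L \<and> x \<odot>\<^bsub>S\<^esub> s = \<zero>\<^bsub>S\<^esub>" for x
    by (auto simp: a_kernel_def' \<pi>_def)
  have sub: "submodule ?K kA5 ?L"
  proof (rule L.submoduleI)
    show "?K \<subseteq> carrier ?L" using K by blast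
    show "\<zero>\<^bsub>?L\<^esub> \<in> ?K" using K s by (auto simp: left_ideal_module_sel)
    show "x \<oplus>\<^bsub>?L\<^esub> y \<in> ?K" if "x \<in> ?K" "y \<in> ?K" for x y
      using that s unfolding K by (auto simp: left_ideal_module_sel S.act_add distrib_right)
    show "a \<odot>\<^bsub>?L\<^esub> x \<in> ?K" if "a \<in> carrier kA5" "x \<in> ?K" for a x
      using that s unfolding K by (auto simp: left_ideal_module_sel carrier_kA5 S.act_mult mult.assoc)
  qed
  have "N = carrier ?L" if N: "submodule N kA5 ?L" and sum: "N <+>\<^bsub>?L\<^esub> ?K = carrier ?L" for N
  proof -
    note ND = L.submoduleD[OF N]
    have ee: "e * e = e" by (rule local_idemD(1)[OF e])
    have "coeff e \<in> N <+>\<^bsub>?L\<^esub> ?K" unfolding sum using ee by (auto simp: left_ideal_module_sel)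
    then obtain m k where mk: "m \<in> N" "k \<in> ?K" "coeff e = m \<oplus>\<^bsub>?L\<^esub> k" by (auto simp: set_add_def')
    have "m \<in> carrier ?L" "k \<in> carrier ?L" using mk(1,2) ND(1) K by blast+
    then obtain m' k' where m': "m = coeff m'" "m' * e = m'" "k = coeff k'" "k' * e = k'"
      by (auto simp: left_ideal_module_sel)
    have "\<exists>b. e = b * m'"
    proof (rule S.local_idem_superfluous[OF e s])
      show "e = m' + k'" using mk(3) m' by (simp add: left_ideal_module_sel coeff_inject)
      show "k' \<star>\<^bsub>S\<^esub> s = \<zero>\<^bsub>S\<^esub>" using mk(2) K m' by blast
    qed (use m' in auto)
    then obtain b where b: "e = b * m'" ..
    have "x \<in> N" if x: "x \<in> carrier ?L" for x
    proof -
      obtain a where a: "x = coeff a" "a * e = a" using x by (auto simp: left_ideal_module_sel)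
      then have "x = coeff (a * b) \<odot>\<^bsub>?L\<^esub> m" using b m' by (simp add: left_ideal_module_sel mult.assoc)
      then show ?thesis using ND(4) mk(1) by simp
    qed
    then show ?thesis using ND(1) by blast
  qed
  then have "superfluous_submodule kA5 ?L ?K" using sub by (simp add: superfluous_submodule_def)
  then have "is_projective_cover kA5 ?L \<pi> S"
    using left_ideal_projective[OF local_idemD(1)[OF e]] \<pi> onto by (simp add: is_projective_cover_def)
  then show ?thesis by blast
qed

section \<open>Counting composition factors with a local idempotent\<close>

text \<open>Transport a composition series \<open>N\<close> of \<open>P\<close> to \<open>R e\<close> and let \<open>W\<close> send a term to the image of its
  \<open>f\<close>-part. If the factor \<open>N (Suc i) / N i\<close> is isomorphic to \<open>S\<close>, the \<open>f\<close>-part of the factor is a line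
  and \<open>W\<close> gains one dimension. If not, \<open>f\<close> kills the factor, since \<open>f\<close> is local and \<open>f S \<noteq> 0\<close>, and \<open>W\<close>
  does not change. So the number of factors isomorphic to \<open>S\<close> is the final dimension.\<close>

lemma composition_multiplicity_left_ideal:
  fixes P :: "('k::field, 'b, 'm) kA5_scheme"
    and S :: "('k::field, 'c, 'n) kA5_scheme"
  assumes P: "left_module kA5 P"
    and bij: "bij_betw \<sigma> (carrier P) {a. a * e = a}"
    and \<sigma>_add: "\<And>x y. \<lbrakk>x \<in> carrier P; y \<in> carrier P\<rbrakk> \<Longrightarrow> \<sigma> (x \<oplus>\<^bsub>P\<^esub> y) = \<sigma> x + \<sigma> y"
    and \<sigma>_act: "\<And>a x. x \<in> carrier P \<Longrightarrow> \<sigma> (a \<star>\<^bsub>P\<^esub> x) = a * \<sigma> x"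
    and e: "e * e = e"
    and S: "simple_module kA5 S" and f: "local_idem f"
    and s0: "s0 \<in> carrier S" "f \<star>\<^bsub>S\<^esub> s0 \<noteq> \<zero>\<^bsub>S\<^esub>"
  shows "composition_multiplicity kA5 P S = V.dim (range (\<lambda>a. f * a * e))"
proof -
  interpret P: alg_module P using P by (simp add: alg_module_def)
  interpret S: alg_module S using S by (simp add: simple_module_def alg_module_def)
  note ff = local_idemD[OF f]
  have inj: "x = y" if "x \<in> carrier P" "y \<in> carrier P" "\<sigma> x = \<sigma> y" for x y
    using bij that by (auto simp: bij_betw_def inj_on_def)
  have \<sigma>_zero: "\<sigma> \<zero>\<^bsub>P\<^esub> = 0" using \<sigma>_act[of "\<zero>\<^bsub>P\<^esub>" 0] by simp
  have subspace: "V.subspace (\<sigma> ` H)"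
    if "H \<subseteq> carrier P" "\<zero>\<^bsub>P\<^esub> \<in> H" "\<And>x y. \<lbrakk>x \<in> H; y \<in> H\<rbrakk> \<Longrightarrow> x \<oplus>\<^bsub>P\<^esub> y \<in> H"
      "\<And>c x. x \<in> H \<Longrightarrow> (c \<cdot> 1) \<star>\<^bsub>P\<^esub> x \<in> H" for H
  proof (rule V.subspaceI)
    show "0 \<in> \<sigma> ` H" using \<sigma>_zero that(2) by (metis imageI)
    show "x + y \<in> \<sigma> ` H" if xy: "x \<in> \<sigma> ` H" "y \<in> \<sigma> ` H" for x y
    proof -
      obtain u v where "x = \<sigma> u" "y = \<sigma> v" "u \<in> H" "v \<in> H" using xy by blast
      then show ?thesis using that(1) \<open>\<And>x y. \<lbrakk>x \<in> H; y \<in> H\<rbrakk> \<Longrightarrow> x \<oplus>\<^bsub>P\<^esub> y \<in> H\<close> \<open>H \<subseteq> carrier P\<close>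
        by (intro image_eqI[of _ _ "u \<oplus>\<^bsub>P\<^esub> v"]) (auto simp: \<sigma>_add subset_iff)
    qed
    show "c \<cdot> x \<in> \<sigma> ` H" if x: "x \<in> \<sigma> ` H" for c x
    proof -
      obtain u where "x = \<sigma> u" "u \<in> H" using x by blast
      then show ?thesis using \<open>\<And>c x. x \<in> H \<Longrightarrow> (c \<cdot> 1) \<star>\<^bsub>P\<^esub> x \<in> H\<close> \<open>H \<subseteq> carrier P\<close>
        by (intro image_eqI[of _ _ "(c \<cdot> 1) \<star>\<^bsub>P\<^esub> u"]) (auto simp: \<sigma>_act subset_iff)
    qed
  qed
  define W where "W H = (\<lambda>x. \<sigma> (f \<star>\<^bsub>P\<^esub> x)) ` H" for H
  have W_sub: "V.subspace (W H)" if H: "submodule H kA5 P" for H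
  proof -
    note HD = P.submoduleD[OF H]
    have "W H = \<sigma> ` ((\<lambda>x. f \<star>\<^bsub>P\<^esub> x) ` H)" by (simp add: W_def image_image)
    also have "V.subspace \<dots>"
    proof (rule subspace)
      show "(\<lambda>x. f \<star>\<^bsub>P\<^esub> x) ` H \<subseteq> carrier P" using HD(1) by auto
      show "\<zero>\<^bsub>P\<^esub> \<in> (\<lambda>x. f \<star>\<^bsub>P\<^esub> x) ` H" using HD(2) by (intro image_eqI[of _ _ "\<zero>\<^bsub>P\<^esub>"]) auto
      show "x \<oplus>\<^bsub>P\<^esub> y \<in> (\<lambda>x. f \<star>\<^bsub>P\<^esub> x) ` H"
        if "x \<in> (\<lambda>x. f \<star>\<^bsub>P\<^esub> x) ` H" "y \<in> (\<lambda>x. f \<star>\<^bsub>P\<^esub> x) ` H" for x y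
        using that HD(1,3) by (force simp: subset_iff simp flip: P.smult_r_distr)
      show "(c \<cdot> 1) \<star>\<^bsub>P\<^esub> x \<in> (\<lambda>x. f \<star>\<^bsub>P\<^esub> x) ` H"
        if x: "x \<in> (\<lambda>x. f \<star>\<^bsub>P\<^esub> x) ` H" for c x
      proof -
        obtain u where u: "x = f \<star>\<^bsub>P\<^esub> u" "u \<in> H" using x by blast
        have "(c \<cdot> 1) \<star>\<^bsub>P\<^esub> x = f \<star>\<^bsub>P\<^esub> ((c \<cdot> 1) \<star>\<^bsub>P\<^esub> u)"
          using u HD(1) by (auto simp flip: P.act_mult)
        then show ?thesis using u HD(4)[of "coeff (c \<cdot> 1)" u] by simp
      qed
    qed
    finally show ?thesis .
  qed
  have count: "n = V.dim (range (\<lambda>a. f * a * e))"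
    if ser: "composition_series kA5 P r N"
      and n: "n = card {i. i < r \<and> left_module_isomorphic kA5 (series_factor P N i) S}" for r N n
  proof -
    let ?iso = "\<lambda>i. left_module_isomorphic kA5 (series_factor P N i) S"
    have N: "submodule (N i) kA5 P" if "i \<le> r" for i using ser that by (auto simp: composition_series_def)
    have "i \<le> r \<Longrightarrow> V.dim (W (N i)) = card {j. j < i \<and> ?iso j}" for i
    proof (induction i)
      case 0
      have "N 0 = {\<zero>\<^bsub>P\<^esub>}" using ser by (simp add: composition_series_def)
      then have "W (N 0) = {0}" by (simp add: W_def \<sigma>_zero)
      then show ?case by simp
    next
      case (Suc i)
      let ?H = "N (Suc i)" and ?K = "N i"
      have H: "submodule ?H kA5 P" and K: "submodule ?K kA5 P" and KH: "?K \<subseteq> ?H"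
        and simple: "simple_module kA5 (series_factor P N i)"
        using N[of i] N[of "Suc i"] Suc.prems ser by (auto simp: composition_series_def)
      note HD = P.submoduleD[OF H] and KD = P.submoduleD[OF K]
      interpret H: module_with_submodule kA5 "P\<lparr>carrier := ?H\<rparr>" ?K
        using P.submodule_of_submodule[OF H, of ?K] K KH P.submodule_left_module[OF H]
        by (intro module_with_submodule.intro module_with_submodule_axioms.intro) simp_all
      let ?T = "series_factor P N i"
      have T: "?T = quotient_module (P\<lparr>carrier := ?H\<rparr>) ?K" by (simp add: series_factor_def)
      interpret T: alg_module ?T using simple by (simp add: simple_module_def alg_module_def)
      have coset_zero: "H.coset x = \<zero>\<^bsub>?T\<^esub> \<longleftrightarrow> x \<in> ?K" if "x \<in> ?H" for x
        using H.coset_eq_zero_iff[of x] that by (simp add: T quotient_sel)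
      have coset_act: "a \<star>\<^bsub>?T\<^esub> H.coset x = H.coset (a \<star>\<^bsub>P\<^esub> x)" if "x \<in> ?H" for a x
        using H.coset_smult[of "coeff a" x] that by (simp add: T)
      have coset_eq: "H.coset x = H.coset y \<longleftrightarrow> x \<oplus>\<^bsub>P\<^esub> \<ominus>\<^bsub>P\<^esub> y \<in> ?K" if "x \<in> ?H" "y \<in> ?H" for x y
      proof -
        have "\<ominus>\<^bsub>P\<lparr>carrier := ?H\<rparr>\<^esub> y = \<ominus>\<^bsub>P\<^esub> y"
          using that HD H.M.minus_equality[of "\<ominus>\<^bsub>P\<^esub> y" y] P.M.l_neg[of y] by auto
        then show ?thesis using H.coset_eq_iff[of x y] that by simp
      qed
      have carrT: "carrier ?T = H.coset ` ?H" using H.carrier_quotient by (simp add: T)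
      have mono: "W ?K \<subseteq> W ?H" using KH by (auto simp: W_def)
      show ?case
      proof (cases "?iso i")
        case True
        have "\<exists>t\<in>carrier ?T. f \<star>\<^bsub>?T\<^esub> t \<noteq> \<zero>\<^bsub>?T\<^esub>"
        proof -
          obtain h where h: "h \<in> left_module_hom kA5 ?T S" "bij_betw h (carrier ?T) (carrier S)"
            using True by (auto simp: left_module_isomorphic_def)
          obtain t where t: "t \<in> carrier ?T" "h t = s0" 
          proof -
            have "s0 \<in> h ` carrier ?T" using bij_betw_imp_surj_on[OF h(2)] s0(1) by simp
            then show thesis using that by auto
          qed
          have h_act: "h (a \<star>\<^bsub>?T\<^esub> x) = a \<star>\<^bsub>S\<^esub> h x" if "x \<in> carrier ?T" for a x
            using h(1) that by (auto simp: left_module_hom_def)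
          have "h x \<in> carrier S" if "x \<in> carrier ?T" for x using h(1) that by (auto simp: left_module_hom_def)
          then have "h \<zero>\<^bsub>?T\<^esub> = \<zero>\<^bsub>S\<^esub>" using h_act[of "\<zero>\<^bsub>?T\<^esub>" 0] by simp
          then have "f \<star>\<^bsub>?T\<^esub> t \<noteq> \<zero>\<^bsub>?T\<^esub>" using h_act[OF t(1), of f] t(2) s0(2) by metis
          then show ?thesis using t(1) by blast
        qed
        then obtain x0 where x0: "x0 \<in> ?H" "f \<star>\<^bsub>?T\<^esub> H.coset x0 \<noteq> \<zero>\<^bsub>?T\<^esub>" by (auto simp: carrT)
        define x where "x = f \<star>\<^bsub>P\<^esub> x0"
        have x: "x \<in> ?H" "f \<star>\<^bsub>P\<^esub> x = x"
          using x0(1) HD(1,4) P.act_mult[of x0 f f] ff(1) by (auto simp: x_def)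
        have xK: "x \<notin> ?K" using x0 x(1) coset_zero[of x] by (simp add: coset_act x_def)
        have xP: "x \<in> carrier P" using x HD(1) by blast
        have "\<sigma> x \<notin> W ?K"
        proof
          assume "\<sigma> x \<in> W ?K"
          then obtain y where "y \<in> ?K" "\<sigma> x = \<sigma> (f \<star>\<^bsub>P\<^esub> y)" by (auto simp: W_def)
          then have "x = f \<star>\<^bsub>P\<^esub> y" using KD(1) xP by (intro inj) auto
          then show False using xK KD(4) \<open>y \<in> ?K\<close> by simp
        qed
        moreover have xW: "\<sigma> x \<in> W ?H" using x by (auto simp: W_def intro!: image_eqI[of _ _ x])
        moreover have "W ?H \<subseteq> V.span (insert (\<sigma> x) (W ?K))"
        proof
          fix w assume "w \<in> W ?H"
          then obtain u0 where u0: "u0 \<in> ?H" "w = \<sigma> (f \<star>\<^bsub>P\<^esub> u0)" by (auto simp: W_def)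
          define u where "u = f \<star>\<^bsub>P\<^esub> u0"
          have u: "u \<in> ?H" "f \<star>\<^bsub>P\<^esub> u = u" "w = \<sigma> u"
            using u0 HD(1,4) P.act_mult[of u0 f f] ff(1) by (auto simp: u_def)
          \<comment> \<open>The \<open>f\<close>-part of the simple factor is a line spanned by the coset of \<open>x\<close>.\<close>
          have "\<exists>c. H.coset u = (c \<cdot> 1) \<star>\<^bsub>?T\<^esub> H.coset x"
          proof (rule T.local_idem_eigenspace[OF f simple])
            show "H.coset x \<noteq> \<zero>\<^bsub>?T\<^esub>" using xK x coset_zero by blast
          qed (use x u in \<open>auto simp: carrT coset_act\<close>)
          then obtain c where c: "H.coset u = (c \<cdot> 1) \<star>\<^bsub>?T\<^esub> H.coset x" ..
          define y where "y = (c \<cdot> 1) \<star>\<^bsub>P\<^esub> x"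
          have y: "y \<in> ?H" using x HD(4) by (simp add: y_def)
          have uP: "u \<in> carrier P" "y \<in> carrier P" using u y HD(1) by auto
          define z where "z = u \<oplus>\<^bsub>P\<^esub> \<ominus>\<^bsub>P\<^esub> y"
          have z: "z \<in> ?K" using c coset_act[OF x(1)] coset_eq[OF u(1) y] by (simp add: y_def z_def)
          have "f \<star>\<^bsub>P\<^esub> y = (c \<cdot> f) \<star>\<^bsub>P\<^esub> x" using xP by (simp add: y_def flip: P.act_mult)
          also have "\<dots> = y" using P.act_scal[OF xP, of c f] x by (simp add: y_def)
          finally have "f \<star>\<^bsub>P\<^esub> z = z"
            using uP u(2) by (simp add: z_def P.smult_r_distr P.smult_r_minus)
          then have "\<sigma> z \<in> W ?K" using z by (auto simp: W_def intro!: image_eqI[of _ _ z])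
          moreover have "u = z \<oplus>\<^bsub>P\<^esub> y" using uP by (simp add: z_def P.M.a_assoc P.M.l_neg)
          then have "w = \<sigma> z + c \<cdot> \<sigma> x"
            using u(3) uP z KD(1) xP by (auto simp: \<sigma>_add \<sigma>_act y_def subset_iff)
          ultimately show "w \<in> V.span (insert (\<sigma> x) (W ?K))"
            by (simp only:) (intro V.span_add V.span_scale V.span_base; simp)
        qed
        moreover have "V.span (W ?K) = W ?K" using W_sub[OF K] by (simp add: V.span_eq_iff)
        moreover have "\<sigma> x \<notin> V.span (W ?K)"
          using \<open>\<sigma> x \<notin> W ?K\<close> by (simp only: \<open>V.span (W ?K) = W ?K\<close> not_False_eq_True)
        ultimately have "V.dim (W ?H) = V.dim (insert (\<sigma> x) (W ?K))"
          using mono by (intro V.span_eq_dim V.span_eq[THEN iffD2]) (auto intro: V.span_base)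
        also have "\<dots> = Suc (V.dim (W ?K))"
          using \<open>\<sigma> x \<notin> V.span (W ?K)\<close> by (simp add: V.dim_insert)
        also have "{j. j < Suc i \<and> ?iso j} = insert i {j. j < i \<and> ?iso j}" using True by (auto simp: less_Suc_eq)
        ultimately show ?thesis using Suc by simp
      next
        case False
        \<comment> \<open>As \<open>f\<close> is local and \<open>f S \<noteq> 0\<close>, it kills every simple module that is not isomorphic to \<open>S\<close>.\<close>
        have kill_T: "f \<star>\<^bsub>?T\<^esub> t = \<zero>\<^bsub>?T\<^esub>" if "t \<in> carrier ?T" for t
          using local_idem_isomorphic[OF f simple S that _ s0] False by blast
        have kill: "f \<star>\<^bsub>P\<^esub> x \<in> ?K" if "x \<in> ?H" for x
        proof -
          have "f \<star>\<^bsub>?T\<^esub> H.coset x = \<zero>\<^bsub>?T\<^esub>" using that by (intro kill_T) (simp add: carrT)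
          then show ?thesis using coset_act[OF that] coset_zero[OF HD(4)[OF coeff_closed that]] by simp
        qed
        have "W ?H \<subseteq> W ?K"
        proof
          fix w assume "w \<in> W ?H"
          then obtain x where x: "x \<in> ?H" "w = \<sigma> (f \<star>\<^bsub>P\<^esub> x)" by (auto simp: W_def)
          have "f \<star>\<^bsub>P\<^esub> x = f \<star>\<^bsub>P\<^esub> (f \<star>\<^bsub>P\<^esub> x)"
            using x HD(1) P.act_mult[of x f f] ff(1) by auto
          then show "w \<in> W ?K" using kill[OF x(1)] x(2) unfolding W_def by (metis imageI)
        qed
        moreover have "{j. j < Suc i \<and> ?iso j} = {j. j < i \<and> ?iso j}" using False by (auto simp: less_Suc_eq)
        ultimately show ?thesis using Suc mono by (simp add: subset_antisym)
      qed
    qed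
    from this[of r] have "V.dim (W (carrier P)) = n" using ser n by (simp add: composition_series_def)
    moreover have "W (carrier P) = (\<lambda>a. f * a) ` (\<sigma> ` carrier P)"
      by (auto simp: W_def \<sigma>_act image_image)
    moreover have "\<sigma> ` carrier P = range (\<lambda>a. a * e)"
    proof -
      have "{a. a * e = a} = range (\<lambda>a. a * e)"
      proof (intro subset_antisym subsetI)
        fix a assume "a \<in> {a. a * e = a}"
        then show "a \<in> range (\<lambda>a. a * e)" by (intro image_eqI[of _ _ a]) simp_all
      qed (use e in \<open>auto simp: mult.assoc\<close>)
      then show ?thesis using bij_betw_imp_surj_on[OF bij] by simp
    qed
    ultimately show ?thesis by (simp add: image_image mult.assoc)
  qed
  have "\<exists>r N. composition_series kA5 P r N"
  proof (rule P.composition_series_exists)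
    fix H K assume H: "submodule H kA5 P" and K: "submodule K kA5 P" and "K \<subset> H"
    note HD = P.submoduleD[OF H] and KD = P.submoduleD[OF K]
    have "\<sigma> ` K \<subset> \<sigma> ` H"
      using \<open>K \<subset> H\<close> inj_on_subset[OF bij_betw_imp_inj_on[OF bij] HD(1)]
      by (intro image_strict_mono)
    moreover have "V.subspace (\<sigma> ` H)" by (rule subspace; (rule HD coeff_closed | assumption)+)
    moreover have "V.subspace (\<sigma> ` K)" by (rule subspace; (rule KD coeff_closed | assumption)+)
    ultimately have "V.span (\<sigma> ` K) \<subset> V.span (\<sigma> ` H)"
      by (simp only: V.span_eq_iff[THEN iffD2])
    then show "V.dim (\<sigma> ` K) < V.dim (\<sigma> ` H)" by (rule V.dim_psubset)
  qed
  then obtain r N where ser: "composition_series kA5 P r N" by blast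
  show ?thesis unfolding composition_multiplicity_def
  proof (rule the_equality)
    show "\<exists>r N. composition_series kA5 P r N \<and> V.dim (range (\<lambda>a. f * a * e)) =
        card {i. i < r \<and> left_module_isomorphic kA5 (series_factor P N i) S}"
      using ser count[OF ser refl] by (intro exI[of _ r] exI[of _ N]) simp
    show "n = V.dim (range (\<lambda>a. f * a * e))"
      if "\<exists>r N. composition_series kA5 P r N \<and>
        n = card {i. i < r \<and> left_module_isomorphic kA5 (series_factor P N i) S}" for n
      using that count by (elim exE conjE)
  qed
qed

theorem cartan_invariant_eq_dim:
  fixes S :: "('k::field, 'c, 'n) kA5_scheme"
    and T :: "('k::field, 'd, 'l) kA5_scheme"
  assumes S: "simple_module kA5 S" and f: "local_idem f"
    and s: "s \<in> carrier S" "f \<star>\<^bsub>S\<^esub> s \<noteq> \<zero>\<^bsub>S\<^esub>"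
    and T: "simple_module kA5 T" and e: "local_idem e"
    and t: "t \<in> carrier T" "e \<star>\<^bsub>T\<^esub> t \<noteq> \<zero>\<^bsub>T\<^esub>"
  shows "cartan_invariant kA5 S T = V.dim (range (\<lambda>a. f * a * e))"
proof -
  obtain \<pi> where \<pi>: "is_projective_cover kA5 (projective_cover kA5 T) \<pi> T"
    using someI_ex[of "\<lambda>P. \<exists>\<pi>. is_projective_cover kA5 P \<pi> T"] left_ideal_projective_cover[OF T e t]
    unfolding projective_cover_def by blast
  obtain \<sigma> where \<sigma>: "bij_betw \<sigma> (carrier (projective_cover kA5 T)) {a. a * e = a}"
    "\<forall>x\<in>carrier (projective_cover kA5 T). \<forall>y\<in>carrier (projective_cover kA5 T).
      \<sigma> (x \<oplus>\<^bsub>projective_cover kA5 T\<^esub> y) = \<sigma> x + \<sigma> y"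
    "\<forall>a. \<forall>x\<in>carrier (projective_cover kA5 T). \<sigma> (a \<star>\<^bsub>projective_cover kA5 T\<^esub> x) = a * \<sigma> x"
    using projective_cover_left_ideal[OF \<pi> T e t] by blast
  have "left_module kA5 (projective_cover kA5 T)"
    using \<pi> by (simp add: is_projective_cover_def projective_module_def)
  then show ?thesis
    unfolding cartan_invariant_def using \<sigma> local_idemD(1)[OF e] S f s
    by (intro composition_multiplicity_left_ideal[where \<sigma> = \<sigma>]) blast+
qed

section \<open>A normal form for the elements of the alternating group\<close>

text \<open>The 5-cycle \<open>(1 2 3 4 5)\<close>, an involution \<open>pn\<close> that inverts it, and an involution \<open>pg\<close> that
  generates a Klein four group together with \<open>pn\<close>. As products of transpositions they are visibly
  even.\<close>

definition pc :: "nat \<Rightarrow> nat" where "pc = transpose 1 2 \<circ> transpose 3 5 \<circ> (transpose 2 5 \<circ> transpose 3 4)"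
definition pn :: "nat \<Rightarrow> nat" where "pn = transpose 2 5 \<circ> transpose 3 4"
definition pg :: "nat \<Rightarrow> nat" where "pg = transpose 2 3 \<circ> transpose 4 5"

lemma pc_values [simp]: "pc 1 = 2" "pc (Suc 0) = 2" "pc 2 = 3" "pc 3 = 4" "pc 4 = 5" "pc 5 = 1"
  by (simp_all add: pc_def transpose_def)

lemma pn_values [simp]: "pn 1 = 1" "pn (Suc 0) = 1" "pn 2 = 5" "pn 3 = 4" "pn 4 = 3" "pn 5 = 2"
  by (simp_all add: pn_def transpose_def)

lemma pg_values [simp]: "pg 1 = 1" "pg (Suc 0) = 1" "pg 2 = 3" "pg 3 = 2" "pg 4 = 5" "pg 5 = 4"
  by (simp_all add: pg_def transpose_def)

lemma double_transposition_in_A5: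
  assumes "a \<in> {1..5}" "b \<in> {1..5}" "c \<in> {1..5}" "d \<in> {1..5}" "a \<noteq> b" "c \<noteq> d"
  shows "transpose a b \<circ> transpose c d \<in> carrier A5"
proof -
  have "transpose a b \<circ> transpose c d permutes {1..5}"
    using assms by (intro permutes_compose permutes_swap_id)
  moreover have "evenperm (transpose a b \<circ> transpose c d)"
    using assms by (simp add: evenperm_comp permutation_swap_id evenperm_swap)
  ultimately show ?thesis by (simp add: alt_group_carrier)
qed

lemma comp_in_A5: "p \<in> carrier A5 \<Longrightarrow> q \<in> carrier A5 \<Longrightarrow> p \<circ> q \<in> carrier A5"
  using A5.m_closed by (simp add: alt_group_mult)

lemma generators_in_A5 [simp]: "pc \<in> carrier A5" "pn \<in> carrier A5" "pg \<in> carrier A5"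
  unfolding pc_def pn_def pg_def by (intro comp_in_A5 double_transposition_in_A5; simp)+

lemma id_in_A5 [simp]: "id \<in> carrier A5"
  using A5.one_closed by (simp add: alt_group_one)

lemma A5_eqI:
  assumes "p \<in> carrier A5" "q \<in> carrier A5" "map p [1,2,3,4,5] = map q [1,2,3,4,5]"
  shows "p = q"
proof
  fix x
  show "p x = q x"
  proof (cases "x \<in> {1..5}")
    case True
    then have "x \<in> {1,2,3,4,5}" by auto
    then show ?thesis using assms(3) by auto
  next
    case False
    then show ?thesis using assms(1,2) by (auto simp: alt_group_carrier permutes_not_in)
  qed
qed

fun word :: "nat \<times> nat \<times> nat \<Rightarrow> nat \<Rightarrow> nat" where
  "word (i, w, j) = (pc ^^ i) \<circ> [id, pn, pg, pg \<circ> pn] ! w \<circ> (pc ^^ j)"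

text \<open>The identity and \<open>pn\<close> normalize the subgroup generated by \<open>pc\<close>, so a power of \<open>pc\<close> on the right
  would be redundant for them; the double cosets of \<open>pg\<close> and \<open>pg \<circ> pn\<close> have 25 elements each.\<close>

definition indices :: "(nat \<times> nat \<times> nat) list" where
  "indices = [(i, w, 0). w \<leftarrow> [0,1], i \<leftarrow> [0..<5]] @ [(i, w, j). w \<leftarrow> [2,3], i \<leftarrow> [0..<5], j \<leftarrow> [0..<5]]"

lemma pow_in_A5: "pc ^^ i \<in> carrier A5"
proof (induction i)
  case (Suc i)
  then show ?case unfolding funpow.simps by (intro comp_in_A5 generators_in_A5)
qed (simp flip: id_def)

lemma word_in_A5: "w < 4 \<Longrightarrow> word (i, w, j) \<in> carrier A5"
proof -
  assume "w < 4"
  then consider "w = 0" | "w = 1" | "w = 2" | "w = 3" by linarith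
  then have "[id, pn, pg, pg \<circ> pn] ! w \<in> carrier A5" by cases (auto intro: comp_in_A5)
  then show ?thesis unfolding word.simps by (intro comp_in_A5 pow_in_A5)
qed

lemma set_indices: "set indices = {0..<5} \<times> {0,1} \<times> {0} \<union> {0..<5} \<times> {2,3} \<times> {0..<5}"
  by (auto simp: indices_def)

lemma word_values:
  "(pc ^^ 0) x = x" "(pc ^^ 1) x = pc x" "(pc ^^ 2) x = pc (pc x)" "(pc ^^ 3) x = pc (pc (pc x))"
  "(pc ^^ 4) x = pc (pc (pc (pc x)))"
  by (simp_all add: eval_nat_numeral)

lemma upto_5: "[0..<5] = [0, 1, 2, 3, 4::nat]"
  by (simp add: upt_rec)

lemma word_distinct: "distinct (map (\<lambda>u. map (word u) [1,2,3,4,5]) indices)"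
  by (simp add: indices_def upto_5 word_values[unfolded One_nat_def] word_values del: One_nat_def)

lemma inj_on_word: "inj_on word (set indices)"
  using word_distinct by (auto simp: distinct_map inj_on_def)

text \<open>The words are 60 different elements of a group of order 60.\<close>

lemma word_surj:
  assumes "p \<in> carrier A5"
  shows "\<exists>u\<in>set indices. p = word u"
proof -
  have sub: "word ` set indices \<subseteq> carrier A5"
    unfolding set_indices using word_in_A5 by (fastforce simp del: word.simps)
  have "distinct indices" using word_distinct by (simp add: distinct_map)
  then have "card (set indices) = length indices" by (rule distinct_card)
  also have "\<dots> = 60" by (simp add: indices_def upto_5)
  finally have "card (word ` set indices) = 60" using card_image[OF inj_on_word] by simp
  moreover have "card (carrier A5) = 60"
    using alt_group_card_carrier[of 5] by (simp add: fact_numeral)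
  ultimately have "word ` set indices = carrier A5"
    using sub by (intro card_subset_eq) auto
  then show ?thesis using assms by blast
qed

section \<open>Relations between generators\<close>

definition gC :: "'k::field alg" where "gC = delta pc"
definition gN :: "'k::field alg" where "gN = delta pn"
definition gG :: "'k::field alg" where "gG = delta pg"

lemma delta_eqI:
  "p \<in> carrier A5 \<Longrightarrow> q \<in> carrier A5 \<Longrightarrow> map p [1,2,3,4,5] = map q [1,2,3,4,5] \<Longrightarrow> delta p = delta q"
  using A5_eqI by metis

text \<open>The first five relations describe the dihedral group of order ten and the Klein four group. The
  others give the normal form of \<open>gG * gC ^ i * gG\<close>; they determine all products.\<close>

lemma relations:
  "gC * (gC * (gC * (gC * gC))) = (1 :: 'k::field alg)"
  "gN * gN = (1 :: 'k alg)"
  "gG * gG = (1 :: 'k alg)"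
  "gN * gC = (gC * (gC * (gC * (gC * gN))) :: 'k alg)"
  "gN * gG = (gG * gN :: 'k alg)"
  "gG * (gC * gG) = (gC * (gC * (gC * (gC * (gG * (gC * (gC * (gC * gC))))))) :: 'k alg)"
  "gG * (gC * (gC * gG)) = (gC * (gC * (gG * (gN * (gC * gC)))) :: 'k alg)"
  "gG * (gC * (gC * (gC * gG))) = (gC * (gC * (gC * (gG * (gN * (gC * (gC * gC)))))) :: 'k alg)"
  "gG * (gC * (gC * (gC * (gC * gG)))) = (gC * (gG * gC) :: 'k alg)"
  unfolding gC_def gN_def gG_def delta_id[symmetric]
  by (simp_all only: delta_mult comp_in_A5 generators_in_A5 id_in_A5)
     (rule delta_eqI; (intro comp_in_A5 generators_in_A5 id_in_A5)?; simp)+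

lemma relations_assoc:
  fixes y :: "'k::field alg"
  shows "gC * (gC * (gC * (gC * (gC * y)))) = y"
  "gN * (gN * y) = y"
  "gG * (gG * y) = y"
  "gN * (gC * y) = gC * (gC * (gC * (gC * (gN * y))))"
  "gN * (gG * y) = gG * (gN * y)"
  "gG * (gC * (gG * y)) = gC * (gC * (gC * (gC * (gG * (gC * (gC * (gC * (gC * y))))))))"
  "gG * (gC * (gC * (gG * y))) = gC * (gC * (gG * (gN * (gC * (gC * y)))))"
  "gG * (gC * (gC * (gC * (gG * y)))) = gC * (gC * (gC * (gG * (gN * (gC * (gC * (gC * y)))))))"
  "gG * (gC * (gC * (gC * (gC * (gG * y))))) = gC * (gG * (gC * y))"
  using relations[where 'k = 'k, THEN arg_cong[of _ _ "\<lambda>u. u * y"]]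
  by (simp_all only: mult.assoc mult_1_left)

lemmas rels = relations relations_assoc

lemma delta_word:
  assumes "u \<in> set indices"
  shows "\<exists>i w j. u = (i, w, j) \<and> delta (word u) = gC ^ i * [1, gN, gG, gG * gN] ! w * gC ^ j"
proof -
  obtain i w j where u: "u = (i, w, j)" by (cases u)
  have pow: "delta (pc ^^ i) = (gC ^ i :: 'a alg)" for i
  proof (induction i)
    case (Suc i)
    have "delta (pc ^^ Suc i) = (delta pc * delta (pc ^^ i) :: 'a alg)"
      unfolding funpow.simps by (rule delta_mult[symmetric]) (simp_all add: pow_in_A5)
    then show ?case unfolding Suc power_Suc gC_def .
  qed (simp add: delta_id flip: id_def)
  have w: "w < 4" using assms u by (auto simp: set_indices)
  then consider "w = 0" | "w = 1" | "w = 2" | "w = 3" by linarith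
  then have "delta ([id, pn, pg, pg \<circ> pn] ! w) = ([1, gN, gG, gG * gN] ! w :: 'a alg) \<and>
      [id, pn, pg, pg \<circ> pn] ! w \<in> carrier A5"
    by cases (auto simp: delta_id gN_def gG_def delta_mult comp_in_A5)
  then have "delta (word (i, w, j)) = gC ^ i * [1, gN, gG, gG * gN] ! w * (gC ^ j :: 'a alg)"
    unfolding word.simps pow[symmetric]
    by (simp add: pow_in_A5 comp_in_A5 flip: delta_mult)
  then show ?thesis using u by blast
qed

lemma subspace_eq_UNIV:
  assumes "V.subspace (H :: 'k::field alg set)"
    "\<And>i w j. w < 4 \<Longrightarrow> gC ^ i * [1, gN, gG, gG * gN] ! w * gC ^ j \<in> H"
  shows "a \<in> H"
proof -
  have "delta p \<in> H" if p: "p \<in> carrier A5" for p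
  proof -
    obtain u where u: "u \<in> set indices" "p = word u" using word_surj[OF p] by blast
    obtain i w j where "u = (i, w, j)" "delta (word u) = gC ^ i * [1, gN, gG, gG * gN] ! w * (gC ^ j :: 'k alg)"
      using delta_word[OF u(1)] by metis
    moreover from this have "w < 4" using u(1) by (auto simp: set_indices)
    ultimately show ?thesis using assms(2) u(2) by simp
  qed
  then have "(\<Sum>p\<in>carrier A5. coeff a p \<cdot> delta p) \<in> H"
    using assms(1) by (intro V.subspace_sum V.subspace_scale) auto
  then show ?thesis by (simp flip: alg_expand)
qed

section \<open>Products in the corner spaces\<close>

text \<open>This is the sum of the \<open>x\<^sup>-\<^sup>i \<cdot> gC ^ i\<close> when \<open>x\<^sup>5 = 1\<close>.\<close>

definition eig :: "'k::field \<Rightarrow> 'k alg" where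
  "eig x = 1 + x ^ 4 \<cdot> gC + x ^ 3 \<cdot> gC * gC + x ^ 2 \<cdot> gC * (gC * gC) + x \<cdot> gC * (gC * (gC * gC))"

text \<open>The spanning elements of \<open>eig a R eig b\<close> that come from the two large double cosets.\<close>

definition X :: "'k::field \<Rightarrow> 'k \<Rightarrow> 'k alg" where "X a b = eig a * (gG * eig b)"
definition Y :: "'k::field \<Rightarrow> 'k \<Rightarrow> 'k alg" where "Y a b = eig a * (gG * (gN * eig b))"

text \<open>The sum of all involutions.\<close>

definition tau :: "'k::field alg" where
  "tau = (\<Sum>i<5. gC ^ i * gN) + (\<Sum>i<5. gC ^ i * (gG + gG * gN) * gC ^ (5 - i))"

text \<open>Conjugation permutes the involutions; in terms of generators this is a comparison of normal
  forms.\<close>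

lemma tau_central: "a * tau = tau * (a :: 'k::field alg)"
proof -
  let ?Z = "{a :: 'k alg. a * tau = tau * a}"
  have mult: "x * y \<in> ?Z" if "x \<in> ?Z" "y \<in> ?Z" for x y
    using that by (metis (mono_tags, lifting) mem_Collect_eq mult.assoc)
  have gen: "gC \<in> ?Z" "gN \<in> ?Z" "gG \<in> ?Z"
    by (simp_all add: tau_def lessThan_nat_numeral numeral_eq_Suc distrib_left distrib_right mult.assoc rels add_ac)
  have pow: "gC ^ i \<in> ?Z" for i by (induction i) (use mult gen in auto)
  have "V.subspace ?Z"
    by (rule V.subspaceI) (simp_all add: distrib_left distrib_right)
  then show ?thesis
  proof (rule subspace_eq_UNIV[of ?Z, THEN CollectD])
    fix i w j :: nat assume "w < 4"
    then consider "w = 0" | "w = 1" | "w = 2" | "w = 3" by linarith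
    then have "[1, gN, gG, gG * gN] ! w \<in> ?Z"
      by cases (use gen mult[of gG gN] in auto)
    then show "gC ^ i * [1, gN, gG, gG * gN] ! w * gC ^ j \<in> ?Z"
      using pow mult by blast
  qed
qed

locale char_two =
  fixes dummy :: "'k::field itself"
  assumes two: "(2 :: 'k) = 0"
begin

lemma add_self [simp]: "(a :: 'k) + a = 0" "(a :: 'k) + (a + b) = b"
  using two mult_2[of a] by (auto simp flip: add.assoc)

lemma alg_add_self [simp]: "(u :: 'k alg) + u = 0" "u + (u + v) = v"
  using V.scale_left_distrib[of 1 1 u] by (auto simp flip: add.assoc)

lemma alg_uminus [simp]: "- (u :: 'k alg) = u"
  using alg_add_self(1) by (metis add.inverse_unique)

lemma alg_diff [simp]: "(u :: 'k alg) - v = u + v"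
  using alg_uminus[of v] by (simp only: diff_conv_add_uminus)

lemma uminus_self [simp]: "- (a :: 'k) = a"
  using add_self(1) by (metis add.inverse_unique)

lemma root_power:
  assumes "x ^ 5 = (1 :: 'k)"
  shows "x ^ 6 = x" "x ^ 7 = x ^ 2" "x ^ 8 = x ^ 3" "x ^ 9 = x ^ 4" "x ^ 10 = 1" "x ^ 11 = x"
    "x ^ 12 = x ^ 2" "x ^ 13 = x ^ 3" "x ^ 14 = x ^ 4" "x ^ 15 = 1" "x ^ 16 = x" "x ^ 17 = x ^ 2"
    "x ^ 18 = x ^ 3" "x ^ 19 = x ^ 4" "x ^ 20 = 1" "x ^ 24 = x ^ 4"
proof -
  have "x ^ (5 * m + n) = x ^ n" for m n using assms by (simp add: power_add power_mult)
  from this[of 1 1] this[of 1 2] this[of 1 3] this[of 1 4] this[of 2 0] this[of 2 1] this[of 2 2]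
    this[of 2 3] this[of 2 4] this[of 3 0] this[of 3 1] this[of 3 2] this[of 3 3] this[of 3 4]
    this[of 4 0] this[of 4 4]
  show "x ^ 6 = x" "x ^ 7 = x ^ 2" "x ^ 8 = x ^ 3" "x ^ 9 = x ^ 4" "x ^ 10 = 1" "x ^ 11 = x"
    "x ^ 12 = x ^ 2" "x ^ 13 = x ^ 3" "x ^ 14 = x ^ 4" "x ^ 15 = 1" "x ^ 16 = x" "x ^ 17 = x ^ 2"
    "x ^ 18 = x ^ 3" "x ^ 19 = x ^ 4" "x ^ 20 = 1" "x ^ 24 = x ^ 4"
    by simp_all
qed

lemma eig_C:
  assumes "x ^ 5 = (1 :: 'k)"
  shows "eig x * gC = x \<cdot> eig x" "eig x * (gC * u) = x \<cdot> eig x * u"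
    "gC * eig x = x \<cdot> eig x" "gC * (eig x * u) = x \<cdot> eig x * u"
proof -
  have p: "x * x ^ 4 = 1" "x * x ^ 3 = x ^ 4" "x * x ^ 2 = x ^ 3" "x * x = x ^ 2"
    using assms by (simp_all add: eval_nat_numeral)
  show "eig x * gC = x \<cdot> eig x" "gC * eig x = x \<cdot> eig x"
    by (simp_all add: eig_def distrib_left distrib_right mult.assoc rels p V.scale_right_distrib add_ac)
  then show "eig x * (gC * u) = x \<cdot> eig x * u" "gC * (eig x * u) = x \<cdot> eig x * u"
    by (metis mult.assoc scal_mult(1))+
qed

lemma eig_idem:
  assumes "x ^ 5 = (1 :: 'k)"
  shows "eig x * eig x = eig x" "eig x * (eig x * u) = eig x * u"
proof -
  have p: "x * x ^ 4 = 1" "x ^ 2 * x ^ 3 = 1" "x ^ 4 * x = 1" "x ^ 3 * (x * x) = 1" "x ^ 2 * (x * (x * x)) = 1"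
    "x * (x * (x * (x * x))) = 1"
    using assms by (simp_all add: eval_nat_numeral mult_ac)
  show *: "eig x * eig x = eig x"
    by (subst (2) eig_def) (simp add: distrib_left eig_C[OF assms] p add_ac)
  show "eig x * (eig x * u) = eig x * u" using * by (metis mult.assoc)
qed

lemma eig_orth:
  assumes "x ^ 5 = (1 :: 'k)" "y ^ 5 = 1" "x \<noteq> y"
  shows "eig x * eig y = 0" "eig x * (eig y * u) = 0"
proof -
  have "x \<cdot> (eig x * eig y) = y \<cdot> (eig x * eig y)"
    using eig_C(2)[OF assms(1), of "eig y"] unfolding eig_C(3)[OF assms(2)] scal_mult by (rule sym)
  then have "(x - y) \<cdot> (eig x * eig y) = 0" by (simp only: V.scale_left_diff_distrib diff_self)
  then show *: "eig x * eig y = 0" using assms(3) unfolding V.scale_eq_0_iff by fastforce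
  show "eig x * (eig y * u) = 0" using * by (metis mult.assoc mult_zero_left)
qed

lemma eig_N:
  assumes "x ^ 5 = (1 :: 'k)"
  shows "gN * eig x = eig (x ^ 4) * gN" "gN * (eig x * u) = eig (x ^ 4) * (gN * u)"
proof -
  note p = root_power[OF assms]
  show *: "gN * eig x = eig (x ^ 4) * gN"
    by (simp add: eig_def distrib_left distrib_right mult.assoc rels p add_ac)
  show "gN * (eig x * u) = eig (x ^ 4) * (gN * u)" using * by (metis mult.assoc)
qed

lemma pow4_root: "x ^ 5 = (1 :: 'k) \<Longrightarrow> (x ^ 4) ^ 5 = 1"
  by (metis power_commutes power_mult power_one mult.commute)

text \<open>The structure constants of the products of the elements \<open>X\<close> and \<open>Y\<close>. For fifth roots of unity
  both are of the form \<open>t + t\<^sup>-\<^sup>1\<close>, since \<open>gG * gC ^ i * gG\<close> and \<open>gG * gC ^ (5 - i) * gG\<close> are conjugate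
  under \<open>gN\<close>.\<close>

definition P :: "'k \<Rightarrow> 'k \<Rightarrow> 'k \<Rightarrow> 'k" where "P a b d = b ^ 4 * a ^ 4 * d ^ 4 + b * a * d"
definition Q :: "'k \<Rightarrow> 'k \<Rightarrow> 'k \<Rightarrow> 'k" where "Q a b d = b ^ 3 * a ^ 2 * d ^ 2 + b ^ 2 * a ^ 3 * d ^ 3"

text \<open>Expand the idempotent \<open>eig b\<close> between the two factors \<open>gG\<close> and let the outer idempotents absorb the
  powers of \<open>gC\<close> in the normal form of \<open>gG * gC ^ i * gG\<close>.\<close>

lemma X_mult_X:
  assumes "a ^ 5 = (1 :: 'k)" "b ^ 5 = 1" "d ^ 5 = 1"
  shows "X a b * X b d = eig a * eig d + P a b d \<cdot> X a d +
    Q a b d \<cdot> Y a d"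
proof -
  have "X a b * X b d = eig a * (gG * (eig b * (gG * eig d)))"
    by (simp add: X_def mult.assoc eig_idem[OF assms(2)])
  also have "\<dots> = eig a * eig d + P a b d \<cdot> X a d +
    Q a b d \<cdot> Y a d"
    by (simp add: eig_def[of b] P_def Q_def X_def Y_def distrib_left distrib_right mult.assoc rels
        eig_C[OF assms(1)] eig_C[OF assms(3)] V.scale_left_distrib V.scale_right_distrib)
       (simp add: eval_nat_numeral mult_ac add_ac)
  finally show ?thesis .
qed

lemma Y_eq:
  assumes "a ^ 5 = (1 :: 'k)" "b ^ 5 = 1"
  shows "Y a b = X a (b ^ 4) * gN" "gN * X a b = Y (a ^ 4) b" "gN * Y a b = X (a ^ 4) b"
    "X a b * gN = Y a (b ^ 4)" "Y a b * gN = X a (b ^ 4)"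
  by (simp_all add: X_def Y_def mult.assoc eig_N[OF assms(2)] eig_N[OF assms(1)] rels
      eig_N[OF pow4_root[OF assms(2)]] root_power[OF assms(2)])

text \<open>The remaining products reduce to the previous one because \<open>gN\<close> commutes with \<open>gG\<close> and exchanges
  \<open>eig b\<close> with \<open>eig (b ^ 4)\<close>.\<close>

lemma X_mult_Y:
  assumes "a ^ 5 = (1 :: 'k)" "b ^ 5 = 1" "d ^ 5 = 1"
  shows "X a b * Y b d = eig a * (gN * eig d) + P a b (d ^ 4) \<cdot> Y a d + Q a b (d ^ 4) \<cdot> X a d"
proof -
  have "X a b * Y b d = X a b * X b (d ^ 4) * gN"
    by (simp only: Y_eq(1)[OF assms(2,3)] mult.assoc)
  also have "\<dots> = eig a * (eig (d ^ 4) * gN) + P a b (d ^ 4) \<cdot> (X a (d ^ 4) * gN) + Q a b (d ^ 4) \<cdot> (Y a (d ^ 4) * gN)"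
    by (simp only: X_mult_X[OF assms(1,2) pow4_root[OF assms(3)]] distrib_right scal_mult mult.assoc)
  finally show ?thesis
    by (simp only: eig_N(1)[OF assms(3)] Y_eq(4,5)[OF assms(1) pow4_root[OF assms(3)]]
        Y_eq(1)[OF assms(1,3), symmetric] root_power[OF assms(3)] flip: power_mult) (simp add: root_power[OF assms(3)])
qed

lemma Y_mult_X:
  assumes "a ^ 5 = (1 :: 'k)" "b ^ 5 = 1" "d ^ 5 = 1"
  shows "Y a b * X b d = eig a * (gN * eig d) + P a (b ^ 4) (d ^ 4) \<cdot> Y a d + Q a (b ^ 4) (d ^ 4) \<cdot> X a d"
proof -
  have "Y a b * X b d = X a (b ^ 4) * Y (b ^ 4) d"
    using assms by (simp add: Y_eq(1)[of a b] mult.assoc Y_eq(2))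
  then show ?thesis using X_mult_Y[OF assms(1) pow4_root[OF assms(2)] assms(3)] by simp
qed

lemma Y_mult_Y:
  assumes "a ^ 5 = (1 :: 'k)" "b ^ 5 = 1" "d ^ 5 = 1"
  shows "Y a b * Y b d = eig a * eig d + P a (b ^ 4) d \<cdot> X a d + Q a (b ^ 4) d \<cdot> Y a d"
proof -
  have "Y a b * Y b d = X a (b ^ 4) * X (b ^ 4) d"
    using assms by (simp add: Y_eq(1)[of a b] mult.assoc Y_eq(3))
  then show ?thesis using X_mult_X[OF assms(1) pow4_root[OF assms(2)] assms(3)] by simp
qed

text \<open>Each group element is a word \<open>gC ^ i * w * gC ^ j\<close>, and the powers of \<open>gC\<close> are absorbed by the
  idempotents.\<close>

lemma corner_spanned:
  assumes "a ^ 5 = (1 :: 'k)" "b ^ 5 = 1"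
  shows "\<exists>\<alpha> \<beta> \<gamma> \<delta>. eig a * r * eig b =
    \<alpha> \<cdot> (eig a * eig b) + \<beta> \<cdot> (eig a * (gN * eig b)) + \<gamma> \<cdot> X a b + \<delta> \<cdot> Y a b" (is "?P r")
proof -
  let ?H = "{r. ?P r}"
  have pow: "eig a * gC ^ i = a ^ i \<cdot> eig a" "gC ^ i * eig b = b ^ i \<cdot> eig b" for i
    by (induction i) (simp_all add: power_Suc2 eig_C[OF assms(1)] eig_C[OF assms(2)] mult_ac
      flip: mult.assoc, simp_all add: mult.assoc eig_C[OF assms(2)] mult.commute)
  have "V.subspace ?H"
  proof (rule V.subspaceI)
    show "0 \<in> ?H" by (simp, rule exI[of _ 0], rule exI[of _ 0], rule exI[of _ 0], rule exI[of _ 0], simp)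
    show "r + s \<in> ?H" if rs: "r \<in> ?H" "s \<in> ?H" for r s
    proof -
      obtain \<alpha> \<beta> \<gamma> \<delta> \<alpha>' \<beta>' \<gamma>' \<delta>' where
        "eig a * r * eig b = \<alpha> \<cdot> (eig a * eig b) + \<beta> \<cdot> (eig a * (gN * eig b)) + \<gamma> \<cdot> X a b + \<delta> \<cdot> Y a b"
        "eig a * s * eig b = \<alpha>' \<cdot> (eig a * eig b) + \<beta>' \<cdot> (eig a * (gN * eig b)) + \<gamma>' \<cdot> X a b + \<delta>' \<cdot> Y a b"
        using rs by blast
      then have "eig a * (r + s) * eig b = (\<alpha> + \<alpha>') \<cdot> (eig a * eig b) + (\<beta> + \<beta>') \<cdot> (eig a * (gN * eig b)) +
          (\<gamma> + \<gamma>') \<cdot> X a b + (\<delta> + \<delta>') \<cdot> Y a b"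
        by (simp add: distrib_left distrib_right V.scale_left_distrib add_ac)
      then show ?thesis by blast
    qed
    show "c \<cdot> r \<in> ?H" if r: "r \<in> ?H" for c r
    proof -
      obtain \<alpha> \<beta> \<gamma> \<delta> where
        "eig a * r * eig b = \<alpha> \<cdot> (eig a * eig b) + \<beta> \<cdot> (eig a * (gN * eig b)) + \<gamma> \<cdot> X a b + \<delta> \<cdot> Y a b"
        using r by blast
      then have "eig a * (c \<cdot> r) * eig b = (c * \<alpha>) \<cdot> (eig a * eig b) + (c * \<beta>) \<cdot> (eig a * (gN * eig b)) +
          (c * \<gamma>) \<cdot> X a b + (c * \<delta>) \<cdot> Y a b"
        by (simp add: V.scale_right_distrib)
      then show ?thesis by blast
    qed
  qed
  moreover have "gC ^ i * [1, gN, gG, gG * gN] ! w * gC ^ j \<in> ?H" if w: "w < 4" for i w j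
  proof -
    let ?w = "[1, gN, gG, gG * gN] ! w :: 'k alg"
    have eq: "eig a * (gC ^ i * ?w * gC ^ j) * eig b = (a ^ i * b ^ j) \<cdot> (eig a * ?w * eig b)"
    proof -
      have "eig a * (gC ^ i * ?w * gC ^ j) * eig b = (eig a * gC ^ i) * ?w * (gC ^ j * eig b)"
        by (simp only: mult.assoc)
      then show ?thesis by (simp add: pow)
    qed
    consider "w = 0" | "w = 1" | "w = 2" | "w = 3" using w by linarith
    then have "\<exists>\<alpha> \<beta> \<gamma> \<delta>. eig a * ?w * eig b = \<alpha> \<cdot> (eig a * eig b) + \<beta> \<cdot> (eig a * (gN * eig b)) + \<gamma> \<cdot> X a b + \<delta> \<cdot> Y a b"
    proof cases
      case 1
      then have e: "?w = 1" by simp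
      show ?thesis unfolding e by (rule exI[of _ 1], rule exI[of _ 0], rule exI[of _ 0], rule exI[of _ 0], simp)
    next
      case 2
      then have e: "?w = gN" by simp
      show ?thesis unfolding e by (rule exI[of _ 0], rule exI[of _ 1], rule exI[of _ 0], rule exI[of _ 0], simp add: mult.assoc)
    next
      case 3
      then have e: "?w = gG" by simp
      show ?thesis unfolding e by (rule exI[of _ 0], rule exI[of _ 0], rule exI[of _ 1], rule exI[of _ 0], simp add: mult.assoc X_def)
    next
      case 4
      then have e: "?w = gG * gN" by simp
      show ?thesis unfolding e by (rule exI[of _ 0], rule exI[of _ 0], rule exI[of _ 0], rule exI[of _ 1], simp add: mult.assoc Y_def)
    qed
    then obtain \<alpha> \<beta> \<gamma> \<delta> where "eig a * ?w * eig b = \<alpha> \<cdot> (eig a * eig b) + \<beta> \<cdot> (eig a * (gN * eig b)) + \<gamma> \<cdot> X a b + \<delta> \<cdot> Y a b"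
      by blast
    then have "eig a * (gC ^ i * ?w * gC ^ j) * eig b = (a ^ i * b ^ j * \<alpha>) \<cdot> (eig a * eig b) +
        (a ^ i * b ^ j * \<beta>) \<cdot> (eig a * (gN * eig b)) + (a ^ i * b ^ j * \<gamma>) \<cdot> X a b + (a ^ i * b ^ j * \<delta>) \<cdot> Y a b"
      unfolding eq by (simp add: V.scale_right_distrib)
    then show ?thesis by blast
  qed
  ultimately show ?thesis by (rule subspace_eq_UNIV[of ?H, THEN CollectD])
qed

end

section \<open>Local idempotents of the group algebra and their corner spaces\<close>

lemma coeff_delta_A5:
  "p \<in> carrier A5 \<Longrightarrow> q \<in> carrier A5 \<Longrightarrow>
    coeff (delta p) q = (if map q [1,2,3,4,5] = map p [1,2,3,4,5] then 1 else 0)"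
  using A5_eqI[of q p] by (auto simp: coeff_delta)

text \<open>The coefficients at representatives of the four double cosets separate the spanning elements of the
  corner spaces.\<close>

lemma coeff_basis:
  fixes a b :: "'k::field"
  shows "coeff (eig a) id = 1" "coeff (eig a) pn = 0" "coeff (eig a) pg = 0" "coeff (eig a) (pg \<circ> pn) = 0"
    "coeff (eig a * gN) id = 0" "coeff (eig a * gN) pn = 1" "coeff (eig a * gN) pg = 0" "coeff (eig a * gN) (pg \<circ> pn) = 0"
    "coeff (X a b) id = 0" "coeff (X a b) pn = 0" "coeff (X a b) pg = 1" "coeff (X a b) (pg \<circ> pn) = 0"
    "coeff (Y a b) id = 0" "coeff (Y a b) pn = 0" "coeff (Y a b) pg = 0" "coeff (Y a b) (pg \<circ> pn) = 1"
  unfolding X_def Y_def eig_def gC_def gN_def gG_def delta_id[symmetric]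
  by (simp_all only: distrib_left distrib_right scal_mult V.scale_right_distrib V.scale_scale delta_mult
      comp_in_A5 generators_in_A5 id_in_A5 coeff_add coeff_scal coeff_delta_A5)
     (simp_all del: One_nat_def)

lemma dim_two:
  assumes u: "u \<in> H" and v: "v \<in> H" and H: "\<And>w. w \<in> H \<Longrightarrow> \<exists>\<alpha> \<beta>. w = \<alpha> \<cdot> u + \<beta> \<cdot> v"
    and p: "coeff u p = 1" "coeff v p = 0" and q: "coeff u q = 0" "coeff v q \<noteq> (0 :: 'k::field)"
  shows "V.dim H = 2"
proof (rule V.dim_unique[of "{u, v}"])
  show "H \<subseteq> V.span {u, v}"
  proof
    fix w assume "w \<in> H"
    then obtain \<alpha> \<beta> where "w = \<alpha> \<cdot> u + \<beta> \<cdot> v" using H by blast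
    then show "w \<in> V.span {u, v}"
      by (simp only:) (intro V.span_add V.span_scale V.span_base; simp)
  qed
  have "v \<noteq> 0" using q coeff_zero by metis
  moreover have "u \<notin> V.span {v}"
  proof
    assume "u \<in> V.span {v}"
    then obtain k where "u = k \<cdot> v" by (auto simp: V.span_singleton)
    then show False using p by (simp add: coeff_scal)
  qed
  ultimately show "V.independent {u, v}"
    by (simp add: V.independent_insert)
  have "u \<noteq> v" using p by auto
  then show "card {u, v} = 2" by simp
qed (use u v in auto)

lemma dim_one:
  assumes u: "u \<in> H" and H: "\<And>w. w \<in> H \<Longrightarrow> \<exists>\<alpha>. w = \<alpha> \<cdot> u" and "u \<noteq> (0 :: 'k::field alg)"
  shows "V.dim H = 1"
proof (rule V.dim_unique[of "{u}"])
  show "H \<subseteq> V.span {u}" using H by (auto simp: V.span_singleton)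
qed (use u assms(3) in auto)

context char_two
begin

text \<open>For a primitive fifth root of unity \<open>a\<close>, \<open>E a\<close> is the product of \<open>tau\<close> with \<open>eig a\<close> (\<open>tau_eig\<close>), and
  \<open>F a\<close> is the complementary idempotent; signs do not matter in characteristic two.\<close>

definition E :: "'k \<Rightarrow> 'k alg" where "E a = X a a + Y a a"
definition F :: "'k \<Rightarrow> 'k alg" where "F a = eig a + E a"

definition N1 :: "'k alg" where "N1 = eig 1 * gN"

lemmas f1 = eig_idem[OF power_one] eig_C[OF power_one, unfolded V.scale_one]
lemmas f1N = eig_N[OF power_one, unfolded power_one]

lemma N1_eq: "eig 1 * (gN * eig 1) = N1" "gN * eig 1 = N1"
  by (simp_all add: N1_def f1N f1)

text \<open>The corner at the trivial character multiplies like the Klein four group: the constants \<open>P 1 1 1\<close>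
  and \<open>Q 1 1 1\<close> are \<open>1 + 1 = 0\<close>.\<close>

lemma trivial_corner:
  "eig 1 * N1 = N1" "N1 * eig 1 = N1" "N1 * N1 = eig 1"
  "eig (1 :: 'k) * X 1 1 = X 1 1" "X (1 :: 'k) 1 * eig 1 = X 1 1" "eig (1 :: 'k) * Y 1 1 = Y 1 1" "Y (1 :: 'k) 1 * eig 1 = Y 1 1"
  "N1 * X 1 1 = Y 1 1" "N1 * Y 1 1 = X 1 1" "X 1 1 * N1 = Y 1 1" "Y 1 1 * N1 = X 1 1"
  "X (1 :: 'k) 1 * X 1 1 = eig 1" "Y (1 :: 'k) 1 * Y 1 1 = eig 1" "X 1 1 * Y 1 1 = N1" "Y 1 1 * X 1 1 = N1"
proof -
  show N: "eig 1 * N1 = N1" by (simp add: N1_def f1)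
  show "N1 * eig 1 = N1" "N1 * N1 = eig 1"
    "eig (1 :: 'k) * X 1 1 = X 1 1" "X (1 :: 'k) 1 * eig 1 = X 1 1" "eig (1 :: 'k) * Y 1 1 = Y 1 1" "Y (1 :: 'k) 1 * eig 1 = Y 1 1"
    by (simp_all add: mult.assoc N1_def X_def Y_def f1 f1N rels)
  show "N1 * X 1 1 = Y 1 1" "N1 * Y 1 1 = X 1 1" "X 1 1 * N1 = Y 1 1" "Y 1 1 * N1 = X 1 1"
    by (simp_all add: mult.assoc N1_def X_def Y_def f1 f1N rels)
  show "X (1 :: 'k) 1 * X 1 1 = eig 1" "Y (1 :: 'k) 1 * Y 1 1 = eig 1" "X 1 1 * Y 1 1 = N1" "Y 1 1 * X 1 1 = N1"
    by (simp_all add: X_mult_X X_mult_Y Y_mult_X Y_mult_Y P_def Q_def f1 N1_eq N)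
qed

lemma trivial_spanned:
  "\<exists>\<alpha> \<beta> \<gamma> \<delta>. eig 1 * r * eig 1 = \<alpha> \<cdot> eig 1 + \<beta> \<cdot> N1 + \<gamma> \<cdot> X 1 1 + \<delta> \<cdot> Y 1 1"
  using corner_spanned[of 1 1 r] by (simp add: f1 N1_eq trivial_corner)

text \<open>In characteristic two the square of a combination of \<open>1\<close>, \<open>n\<close>, \<open>g\<close>, \<open>gn\<close> is the square of the sum of
  the coefficients.\<close>

lemma local_trivial: "local_idem (eig (1 :: 'k))"
  unfolding local_idem_def
proof (intro conjI allI)
  show "eig 1 * eig 1 = (eig 1 :: 'k alg)" by (simp add: f1)
  fix r :: "'k alg"
  obtain \<alpha> \<beta> \<gamma> \<delta> where r: "eig 1 * r * eig 1 = \<alpha> \<cdot> eig 1 + \<beta> \<cdot> N1 + \<gamma> \<cdot> X 1 1 + \<delta> \<cdot> Y 1 1"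
    using trivial_spanned by blast
  let ?r = "\<alpha> \<cdot> eig 1 + \<beta> \<cdot> N1 + \<gamma> \<cdot> X 1 1 + \<delta> \<cdot> Y 1 1" and ?c = "\<alpha> + \<beta> + \<gamma> + \<delta>"
  have "(?r - ?c \<cdot> eig 1) * (?r - ?c \<cdot> eig 1) = 0"
    by (simp add: distrib_left distrib_right trivial_corner f1 V.scale_left_distrib V.scale_right_distrib
        mult_ac add_ac)
  then show "\<exists>c. (eig 1 * r * eig 1 - c \<cdot> eig 1) * (eig 1 * r * eig 1 - c \<cdot> eig 1) = 0" unfolding r by blast
qed

lemma tau_trivial: "eig 1 * tau = N1 + X 1 1 + Y 1 1"
proof -
  have "eig 1 * tau = eig (1 :: 'k) * (tau * eig 1)" by (simp only: tau_central[of "eig (1 :: 'k)", symmetric] f1)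
  also have "\<dots> = N1 + X 1 1 + Y 1 1"
    by (simp add: tau_def lessThan_nat_numeral numeral_eq_Suc distrib_left distrib_right mult.assoc
        f1 N1_eq trivial_corner(1) X_def Y_def add_ac)
  finally show ?thesis .
qed

lemma tau_trivial_square: "eig 1 * tau * tau = (eig 1 :: 'k alg)"
proof -
  have "eig 1 * tau * tau = (eig (1 :: 'k) * tau) * (eig 1 * tau)"
  proof -
    have "(eig 1 * tau) * (eig (1 :: 'k) * tau) = eig 1 * (tau * eig 1) * tau" by (simp only: mult.assoc)
    also have "\<dots> = eig 1 * eig 1 * tau * tau" unfolding tau_central[of "eig 1", symmetric] by (simp only: mult.assoc)
    finally show ?thesis by (simp add: f1)
  qed
  also have "\<dots> = eig 1" unfolding tau_trivial
    by (simp add: distrib_left distrib_right trivial_corner add_ac)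
  finally show ?thesis .
qed

end

locale prim_root = char_two "TYPE('k::field)" +
  fixes x :: "'k::field"
  assumes phi: "1 + x + x ^ 2 + x ^ 3 + x ^ 4 = 0"
begin

lemma x5: "x ^ 5 = 1"
proof -
  have "x ^ 5 - 1 = (1 + x + x ^ 2 + x ^ 3 + x ^ 4) * (x - 1)"
    by (simp add: algebra_simps eval_nat_numeral)
  then show ?thesis using phi by simp
qed

lemma x_neq_1: "x \<noteq> 1"
  using phi by auto

lemma pow_neq: "x ^ 2 \<noteq> 1" "x ^ 3 \<noteq> 1" "x ^ 4 \<noteq> 1" "x ^ 2 \<noteq> x" "x ^ 4 \<noteq> x" "x ^ 3 \<noteq> x"
  "x ^ 4 \<noteq> x ^ 2" "x ^ 3 \<noteq> x ^ 2" "x ^ 4 \<noteq> x ^ 3" "x \<noteq> 0"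
proof -
  show x0: "x \<noteq> 0" using x5 by auto
  have e: "x ^ 5 = x ^ 2 * x ^ 2 * x" "x ^ 5 = x ^ 3 * x ^ 2" "x ^ 5 = x ^ 4 * x"
    by (simp_all flip: power_add power_Suc2)
  show 2: "x ^ 2 \<noteq> 1" using e(1) x5 x_neq_1 by (metis mult_1_left)
  show 3: "x ^ 3 \<noteq> 1" using e(2) x5 2 by (metis mult_1_left)
  show 4: "x ^ 4 \<noteq> 1" using e(3) x5 x_neq_1 by (metis mult_1_left)
  have "x ^ 2 = x * x" "x ^ 4 = x * x ^ 3" "x ^ 3 = x * x ^ 2" "x ^ 4 = x ^ 2 * x ^ 2" "x ^ 3 = x ^ 2 * x" "x ^ 4 = x ^ 3 * x"
    by (simp_all add: eval_nat_numeral)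
  then show "x ^ 2 \<noteq> x" "x ^ 4 \<noteq> x" "x ^ 3 \<noteq> x" "x ^ 4 \<noteq> x ^ 2" "x ^ 3 \<noteq> x ^ 2" "x ^ 4 \<noteq> x ^ 3"
    using x0 2 3 x_neq_1 by simp_all
qed

lemma prim_root_square: "prim_root (x ^ 2)"
proof
  have "1 + x ^ 2 + (x ^ 2) ^ 2 + (x ^ 2) ^ 3 + (x ^ 2) ^ 4 = 1 + x ^ 2 + x ^ 4 + x ^ 6 + x ^ 8"
    by (simp flip: power_mult)
  also have "\<dots> = 1 + x + x ^ 2 + x ^ 3 + x ^ 4" by (simp add: root_power[OF x5] add_ac)
  finally show "1 + x ^ 2 + (x ^ 2) ^ 2 + (x ^ 2) ^ 3 + (x ^ 2) ^ 4 = 0" using phi by simp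
qed

lemmas fx = eig_idem[OF x5] eig_C[OF x5]

lemma fNf: "eig x * (gN * eig x) = 0"
  using eig_orth(2)[OF x5 pow4_root[OF x5]] pow_neq eig_N(1)[OF x5] by simp

lemma phi': "x + x ^ 2 + x ^ 3 + x ^ 4 = 1"
proof -
  have "1 + (x + x ^ 2 + x ^ 3 + x ^ 4) = 0" using phi by (simp add: add_ac)
  then show ?thesis using uminus_self by (metis add_eq_0_iff)
qed

lemma absorb:
  "eig x * X x x = X x x" "X x x * eig x = X x x" "eig x * Y x x = Y x x" "Y x x * eig x = Y x x"
  by (simp_all add: X_def Y_def mult.assoc fx)

lemma X_mult_X_root: "X x x * X x x = eig x + (x ^ 2 + x ^ 3) \<cdot> X x x + (x ^ 2 + x ^ 3) \<cdot> Y x x"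
  and X_mult_Y_root: "X x x * Y x x = (x + x ^ 4) \<cdot> Y x x + (x ^ 2 + x ^ 3) \<cdot> X x x"
  and Y_mult_X_root: "Y x x * X x x = (x + x ^ 4) \<cdot> Y x x + (x ^ 2 + x ^ 3) \<cdot> X x x"
  and Y_mult_Y_root: "Y x x * Y x x = eig x + (x + x ^ 4) \<cdot> X x x + (x + x ^ 4) \<cdot> Y x x"
proof -
  have p: "P x x x = x ^ 2 + x ^ 3" "Q x x x = x ^ 2 + x ^ 3" "P x x (x ^ 4) = x + x ^ 4" "Q x x (x ^ 4) = x ^ 2 + x ^ 3"
    "P x (x ^ 4) (x ^ 4) = x + x ^ 4" "Q x (x ^ 4) (x ^ 4) = x ^ 2 + x ^ 3" "P x (x ^ 4) x = x + x ^ 4" "Q x (x ^ 4) x = x + x ^ 4"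
    unfolding P_def Q_def
    by (simp_all add: root_power[OF x5] x5 add_ac flip: power_mult power_add power_Suc power_Suc2)
       (simp_all add: eval_nat_numeral mult_ac)
  show "X x x * X x x = eig x + (x ^ 2 + x ^ 3) \<cdot> X x x + (x ^ 2 + x ^ 3) \<cdot> Y x x"
    "X x x * Y x x = (x + x ^ 4) \<cdot> Y x x + (x ^ 2 + x ^ 3) \<cdot> X x x"
    "Y x x * X x x = (x + x ^ 4) \<cdot> Y x x + (x ^ 2 + x ^ 3) \<cdot> X x x"
    "Y x x * Y x x = eig x + (x + x ^ 4) \<cdot> X x x + (x + x ^ 4) \<cdot> Y x x"
    by (simp_all only: X_mult_X[OF x5 x5 x5] X_mult_Y[OF x5 x5 x5] Y_mult_X[OF x5 x5 x5] Y_mult_Y[OF x5 x5 x5] p fNf fx add_0_left)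
qed

lemma s_sum: "(x + x ^ 4) \<cdot> u + (x ^ 2 + x ^ 3) \<cdot> u = u" "(x ^ 2 + x ^ 3) \<cdot> u + (x + x ^ 4) \<cdot> u = u"
  "(x + x ^ 4) \<cdot> u + ((x ^ 2 + x ^ 3) \<cdot> u + v) = u + v"
  "(x ^ 2 + x ^ 3) \<cdot> u + ((x + x ^ 4) \<cdot> u + v) = u + v"
proof -
  have s: "(x + x ^ 4) + (x ^ 2 + x ^ 3) = 1" using phi' by (simp add: add_ac)
  show *: "(x + x ^ 4) \<cdot> u + (x ^ 2 + x ^ 3) \<cdot> u = u" for u
    unfolding V.scale_left_distrib[symmetric] s by simp
  then show "(x ^ 2 + x ^ 3) \<cdot> u + (x + x ^ 4) \<cdot> u = u" by (simp add: add.commute)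
  then show "(x + x ^ 4) \<cdot> u + ((x ^ 2 + x ^ 3) \<cdot> u + v) = u + v"
    "(x ^ 2 + x ^ 3) \<cdot> u + ((x + x ^ 4) \<cdot> u + v) = u + v" using * by (simp_all flip: add.assoc)
qed

text \<open>These four identities contain what is needed about the corner of \<open>eig x\<close>: they rest on
  \<open>(x + x\<^sup>4) + (x\<^sup>2 + x\<^sup>3) = 1\<close>.\<close>

lemma XE: "X x x * E x = eig x + Y x x" and YE: "Y x x * E x = eig x + X x x"
  and EX: "E x * X x x = eig x + Y x x" and EY: "E x * Y x x = eig x + X x x"
  unfolding E_def distrib_left distrib_right X_mult_X_root X_mult_Y_root Y_mult_X_root Y_mult_Y_root
  by (simp_all only: add_ac s_sum alg_add_self)

lemma EE: "E x * E x = E x" "E x * eig x = E x" "eig x * E x = E x"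
proof -
  have "E x * E x = X x x * E x + Y x x * E x" by (subst (1) E_def) (rule distrib_right)
  also have "\<dots> = E x" unfolding XE YE by (simp add: E_def add_ac)
  finally show "E x * E x = E x" .
qed (simp_all add: E_def distrib_left distrib_right absorb)

lemma EF: "E x * F x = 0" "F x * E x = 0" "F x * F x = F x" "X x x * F x = F x" "Y x x * F x = F x"
  "eig x * F x = F x" "F x * eig x = F x"
  by (simp_all add: F_def distrib_left distrib_right EE fx XE YE absorb)
     (simp_all add: E_def add_ac)

end

context prim_root
begin

text \<open>In \<open>eig x * tau * eig x\<close> the reflections \<open>gC ^ i * gN\<close> contribute zero, because \<open>gN\<close> maps the
  \<open>x\<close>-eigenspace to another one, and the five conjugates of \<open>gG + gG * gN\<close> contribute equally.\<close>

lemma tau_eig: "tau * eig x = E x" "eig x * tau = E x"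
proof -
  have "tau * eig x = tau * (eig x * eig x)" by (simp only: fx)
  also have "\<dots> = eig x * (tau * eig x)" by (metis tau_central mult.assoc)
  also have "\<dots> = E x"
  proof -
    have "x * (x * (x * (x * x))) = 1" using x5 by (simp add: eval_nat_numeral mult_ac)
    then show ?thesis
      by (simp add: tau_def lessThan_nat_numeral numeral_eq_Suc distrib_left distrib_right mult.assoc
        fx fNf E_def X_def Y_def add_ac)
  qed
  finally show "tau * eig x = E x" .
  then show "eig x * tau = E x" using tau_central[of "eig x"] by simp
qed

lemma tau_EF: "tau * E x = E x" "E x * tau = E x" "tau * F x = 0" "F x * tau = 0"
proof -
  show 1: "tau * E x = E x"
    using tau_eig EE by (metis mult.assoc)
  show "E x * tau = E x" using 1 tau_central by metis
  show 2: "tau * F x = 0" by (simp add: F_def distrib_left tau_eig 1)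
  show "F x * tau = 0" using 2 tau_central by metis
qed

lemma corner_x: "\<exists>\<alpha> \<gamma> \<delta>. eig x * r * eig x = \<alpha> \<cdot> eig x + \<gamma> \<cdot> X x x + \<delta> \<cdot> Y x x"
  using corner_spanned[OF x5 x5, of r] by (simp add: fx fNf)

lemma corner_E_products: "(eig x + Y x x) * (eig x + Y x x) = (x + x ^ 4) \<cdot> E x"
  "E x * (eig x + Y x x) = eig x + Y x x" "(eig x + Y x x) * E x = eig x + Y x x"
proof -
  show "(eig x + Y x x) * (eig x + Y x x) = (x + x ^ 4) \<cdot> E x"
    by (simp add: distrib_left distrib_right fx absorb Y_mult_Y_root E_def V.scale_right_distrib add_ac)
  show "E x * (eig x + Y x x) = eig x + Y x x"
    unfolding distrib_left EE EY by (simp add: E_def add_ac)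
  show "(eig x + Y x x) * E x = eig x + Y x x"
    unfolding distrib_right EE YE by (simp add: E_def add_ac)
qed

lemma corner_E: "\<exists>u v. E x * r * E x = u \<cdot> E x + v \<cdot> (eig x + Y x x)"
proof -
  obtain \<alpha> \<gamma> \<delta> where r: "eig x * r * eig x = \<alpha> \<cdot> eig x + \<gamma> \<cdot> X x x + \<delta> \<cdot> Y x x"
    using corner_x by blast
  have "E x * r * E x = E x * (eig x * r * eig x) * E x"
  proof -
    have "E x * (eig x * r * eig x) * E x = (E x * eig x) * r * (eig x * E x)" by (simp only: mult.assoc)
    then show ?thesis by (simp only: EE)
  qed
  also have "\<dots> = (\<alpha> + \<delta>) \<cdot> E x + (\<gamma> + \<delta>) \<cdot> (eig x + Y x x)"
    unfolding r
    by (simp add: distrib_left distrib_right EE EX EY XE YE V.scale_left_distrib V.scale_right_distrib absorb)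
       (simp add: E_def V.scale_right_distrib add_ac)
  finally show ?thesis by blast
qed

text \<open>The corner of \<open>E x\<close> is spanned by \<open>E x\<close> and \<open>W = X x x * E x\<close> with \<open>W\<^sup>2 = (x + x\<^sup>4) \<cdot> E x\<close>. As
  \<open>x + x\<^sup>4 = (x\<^sup>2 + x\<^sup>3)\<^sup>2\<close>, the element \<open>W + (x\<^sup>2 + x\<^sup>3) \<cdot> E x\<close> has square zero.\<close>

lemma local_E: "local_idem (E x)"
  unfolding local_idem_def
proof (intro conjI allI)
  show "E x * E x = E x" by (rule EE)
  fix r
  obtain u v where r: "E x * r * E x = u \<cdot> E x + v \<cdot> (eig x + Y x x)" using corner_E by blast
  let ?W = "eig x + Y x x"
  define s where "s = x ^ 2 + x ^ 3"
  let ?c = "u + v * s"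
  have s: "s * s = x + x ^ 4"
    by (simp add: s_def distrib_left distrib_right root_power[OF x5] x5 add_ac flip: power_add)
  have eq: "E x * r * E x - ?c \<cdot> E x = v \<cdot> (s \<cdot> E x + ?W)"
    unfolding r by (simp add: V.scale_left_distrib V.scale_right_distrib add_ac)
  have "(s \<cdot> E x + ?W) * (s \<cdot> E x + ?W) = (s * s) \<cdot> E x + ?W * ?W"
    unfolding distrib_left[of "_ + _" "_ \<cdot> _"] distrib_right[of "_ \<cdot> _" _ "_ \<cdot> _"]
      distrib_right[of "_ \<cdot> _" _ "eig x + _"]
    by (simp only: scal_mult corner_E_products(2,3) EE V.scale_scale add_ac alg_add_self)
  also have "\<dots> = 0" unfolding s corner_E_products(1) by simp
  finally have "(s \<cdot> E x + ?W) * (s \<cdot> E x + ?W) = 0" .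
  then have "(E x * r * E x - ?c \<cdot> E x) * (E x * r * E x - ?c \<cdot> E x) = 0"
    unfolding eq by simp
  then show "\<exists>c. (E x * r * E x - c \<cdot> E x) * (E x * r * E x - c \<cdot> E x) = 0" by blast
qed

lemma corner_F: "\<exists>c. F x * r * F x = c \<cdot> F x"
proof -
  obtain \<alpha> \<gamma> \<delta> where r: "eig x * r * eig x = \<alpha> \<cdot> eig x + \<gamma> \<cdot> X x x + \<delta> \<cdot> Y x x"
    using corner_x by blast
  have "F x * r * F x = F x * (eig x * r * eig x) * F x"
  proof -
    have "F x * (eig x * r * eig x) * F x = (F x * eig x) * r * (eig x * F x)" by (simp only: mult.assoc)
    then show ?thesis by (simp only: EF)
  qed
  also have "\<dots> = F x * (\<alpha> \<cdot> F x + \<gamma> \<cdot> F x + \<delta> \<cdot> F x)"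
    unfolding r by (simp add: distrib_right mult.assoc EF del: alg_add_self)
  also have "\<dots> = (\<alpha> + \<gamma> + \<delta>) \<cdot> F x"
    by (simp add: distrib_left EF V.scale_left_distrib)
  finally show ?thesis by blast
qed

lemma local_F: "local_idem (F x)"
  unfolding local_idem_def
proof (intro conjI allI)
  fix r
  obtain c where "F x * r * F x = c \<cdot> F x" using corner_F by blast
  then have "(F x * r * F x - c \<cdot> F x) * (F x * r * F x - c \<cdot> F x) = 0" by simp
  then show "\<exists>c. (F x * r * F x - c \<cdot> F x) * (F x * r * F x - c \<cdot> F x) = 0" by blast
qed (rule EF)

lemma dim_EE: "V.dim (range (\<lambda>r. E x * r * E x)) = 2"
proof (rule dim_two)
  show "E x \<in> range (\<lambda>r. E x * r * E x)" by (rule range_eqI[of _ _ 1]) (simp add: EE)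
  show "eig x + Y x x \<in> range (\<lambda>r. E x * r * E x)"
    by (rule range_eqI[of _ _ "X x x"]) (simp only: EX corner_E_products(3))
  show "\<exists>\<alpha> \<beta>. w = \<alpha> \<cdot> E x + \<beta> \<cdot> (eig x + Y x x)" if "w \<in> range (\<lambda>r. E x * r * E x)" for w
    using that corner_E by blast
  show "coeff (E x) pg = 1" "coeff (eig x + Y x x) pg = 0" "coeff (E x) id = 0" "coeff (eig x + Y x x) id \<noteq> 0"
    by (simp_all add: E_def coeff_add coeff_basis)
qed

lemma dim_FF: "V.dim (range (\<lambda>r. F x * r * F x)) = 1"
proof (rule dim_one)
  show "F x \<in> range (\<lambda>r. F x * r * F x)" by (rule range_eqI[of _ _ 1]) (simp add: EF)
  show "\<exists>c. w = c \<cdot> F x" if "w \<in> range (\<lambda>r. F x * r * F x)" for w using that corner_F by blast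
  have "coeff (F x) id = 1" by (simp add: F_def E_def coeff_add coeff_basis)
  then show "F x \<noteq> 0" by (metis zero_neq_one coeff_zero)
qed

text \<open>The central element \<open>tau\<close> acts invertibly on \<open>e\<close> and as zero on \<open>F x\<close>.\<close>

lemma block_orthogonal:
  assumes "e * tau * tau = e"
  shows "e * r * F x = 0" "F x * r * e = 0"
proof -
  have "e * r * F x = e * (tau * (tau * r)) * F x" using assms by (metis mult.assoc)
  also have "tau * (tau * r) = r * tau * tau" by (metis tau_central mult.assoc)
  finally have "e * r * F x = e * r * tau * (tau * F x)" by (simp only: mult.assoc)
  then show "e * r * F x = 0" by (simp add: tau_EF)
  have "F x * r * e = F x * r * (e * tau) * tau" using assms by (metis mult.assoc)
  also have "\<dots> = F x * tau * (r * (e * tau))" by (metis tau_central mult.assoc)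
  finally show "F x * r * e = 0" by (simp add: tau_EF)
qed

lemma tau_EE: "E x * tau * tau = E x"
  by (simp add: tau_EF)

lemma cross_zero:
  "eig 1 * eig x = 0" "eig 1 * (gN * eig x) = 0" "eig x * eig 1 = 0" "eig x * (gN * eig 1) = 0"
proof -
  show "eig 1 * eig x = 0" by (rule eig_orth(1)[OF power_one x5 x_neq_1[symmetric]])
  show "eig x * eig 1 = 0" by (rule eig_orth(1)[OF x5 power_one x_neq_1])
  show "eig 1 * (gN * eig x) = 0"
    unfolding eig_N(1)[OF x5] by (rule eig_orth(2)[OF power_one pow4_root[OF x5] pow_neq(3)[symmetric]])
  show "eig x * (gN * eig 1) = 0"
    unfolding f1N(1) by (rule eig_orth(2)[OF x5 power_one x_neq_1])
qed

lemma E_trivial: "eig 1 * r * E x = eig 1 * r * eig x" "E x * r * eig 1 = eig x * r * eig 1"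
proof -
  have E: "E x = eig x + F x" by (simp add: F_def)
  show "eig 1 * r * E x = eig 1 * r * eig x"
    unfolding E distrib_left by (simp add: block_orthogonal[OF tau_trivial_square])
  show "E x * r * eig 1 = eig x * r * eig 1"
    unfolding E distrib_right by (simp add: block_orthogonal[OF tau_trivial_square])
qed

lemma dim_trivial_E: "V.dim (range (\<lambda>r. eig 1 * r * E x)) = 2"
proof (rule dim_two[where p = pg and q = "pg \<circ> pn"])
  show "X 1 x \<in> range (\<lambda>r. eig 1 * r * E x)"
    by (rule range_eqI[of _ _ gG]) (subst E_trivial, simp add: X_def mult.assoc)
  show "Y 1 x \<in> range (\<lambda>r. eig 1 * r * E x)"
    by (rule range_eqI[of _ _ "gG * gN"]) (subst E_trivial, simp add: Y_def mult.assoc)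
  show "\<exists>\<alpha> \<beta>. w = \<alpha> \<cdot> X 1 x + \<beta> \<cdot> Y 1 x" if "w \<in> range (\<lambda>r. eig 1 * r * E x)" for w
    using that corner_spanned[OF power_one x5] by (auto simp: E_trivial cross_zero)
qed (simp_all add: coeff_basis)

lemma dim_E_trivial: "V.dim (range (\<lambda>r. E x * r * eig 1)) = 2"
proof (rule dim_two[where p = pg and q = "pg \<circ> pn"])
  show "X x 1 \<in> range (\<lambda>r. E x * r * eig 1)"
    by (rule range_eqI[of _ _ gG]) (subst E_trivial, simp add: X_def mult.assoc)
  show "Y x 1 \<in> range (\<lambda>r. E x * r * eig 1)"
    by (rule range_eqI[of _ _ "gG * gN"]) (subst E_trivial, simp add: Y_def mult.assoc)
  show "\<exists>\<alpha> \<beta>. w = \<alpha> \<cdot> X x 1 + \<beta> \<cdot> Y x 1" if "w \<in> range (\<lambda>r. E x * r * eig 1)" for w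
    using that corner_spanned[OF x5 power_one] by (auto simp: E_trivial cross_zero)
qed (simp_all add: coeff_basis)

text \<open>Multiplication by \<open>E b\<close> maps the two spanning elements \<open>X x b\<close> and \<open>Y x b\<close> to proportional ones,
  with ratio \<open>s'\<close>, because \<open>s' * s = 1\<close>.\<close>

lemma dim_cross:
  assumes b: "b = x ^ 2 \<and> s = x ^ 2 + x ^ 3 \<and> s' = x + x ^ 4 \<or> b = x ^ 3 \<and> s = x + x ^ 4 \<and> s' = x ^ 2 + x ^ 3"
    and pb: "prim_root b"
  shows "V.dim (range (\<lambda>r. E x * r * E b)) = 1"
proof -
  interpret B: prim_root b by (rule pb)
  have s: "s' * s = 1"
    using b phi' by (elim disjE conjE)
      (simp_all add: distrib_left distrib_right root_power[OF x5] x5 add_ac flip: power_add power_Suc power_Suc2)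
  have neq: "x \<noteq> b" "x \<noteq> b ^ 4"
  proof -
    have "(x ^ 2) ^ 4 = x ^ 3" "(x ^ 3) ^ 4 = x ^ 2" by (simp_all add: root_power[OF x5] flip: power_mult)
    then have "b = x ^ 2 \<and> b ^ 4 = x ^ 3 \<or> b = x ^ 3 \<and> b ^ 4 = x ^ 2" using b by metis
    then show "x \<noteq> b" "x \<noteq> b ^ 4" using pow_neq by metis+
  qed
  have zero: "eig x * eig b = 0" "eig x * (gN * eig b) = 0"
    using eig_orth[OF x5 B.x5 neq(1)] eig_orth[OF x5 pow4_root[OF B.x5] neq(2)] eig_N[OF B.x5] by auto
  have coeffs: "P x b b + Q x b (b ^ 4) = s'" "Q x b b + P x b (b ^ 4) = 1"
    "Q x (b ^ 4) (b ^ 4) + P x (b ^ 4) b = 1" "P x (b ^ 4) (b ^ 4) + Q x (b ^ 4) b = s"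
  proof -
    have red: "x ^ n = x ^ (n mod 5)" for n
    proof -
      have "x ^ n = x ^ (5 * (n div 5) + n mod 5)" by simp
      then show ?thesis by (simp only: power_add power_mult x5 power_one mult_1_left)
    qed
    have sucs: "Suc (Suc (Suc 0)) = 3" "Suc (Suc (Suc (Suc 0))) = 4" "Suc (Suc (Suc (Suc (Suc 0)))) = 5" by simp_all
    have xx: "x * x = x ^ 2" by (simp add: power2_eq_square)
    note reds = red[of 34] red[of 38] red[of 39] red[of 40] red[of 42] red[of 49] red[of 54] red[of 68] red[of 100]
      red[of 26] red[of 27] red[of 28] red[of 29] red[of 30] red[of 32] red[of 33] red[of 36] red[of 44] red[of 46] red[of 48]
      red[of 50] red[of 52] red[of 56] red[of 60] red[of 64] red[of 72]
    show "P x b b + Q x b (b ^ 4) = s'" "Q x b b + P x b (b ^ 4) = 1"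
      "Q x (b ^ 4) (b ^ 4) + P x (b ^ 4) b = 1" "P x (b ^ 4) (b ^ 4) + Q x (b ^ 4) b = s"
      using b phi' unfolding P_def Q_def
      by (auto simp: root_power[OF x5] x5 reds sucs xx add_ac simp flip: power_mult power_add power_Suc power_Suc2)
  qed
  have XEb: "X x b * E b = s' \<cdot> X x b + Y x b"
  proof -
    have "X x b * E b = (P x b b + Q x b (b ^ 4)) \<cdot> X x b + (Q x b b + P x b (b ^ 4)) \<cdot> Y x b"
      by (simp add: E_def distrib_left X_mult_X[OF x5 B.x5 B.x5] X_mult_Y[OF x5 B.x5 B.x5] zero V.scale_left_distrib add_ac)
    then show ?thesis unfolding coeffs by simp
  qed
  have YEb: "Y x b * E b = X x b + s \<cdot> Y x b"
  proof -
    have "Y x b * E b = (Q x (b ^ 4) (b ^ 4) + P x (b ^ 4) b) \<cdot> X x b +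
        (P x (b ^ 4) (b ^ 4) + Q x (b ^ 4) b) \<cdot> Y x b"
      by (simp add: E_def distrib_left Y_mult_X[OF x5 B.x5 B.x5] Y_mult_Y[OF x5 B.x5 B.x5] zero V.scale_left_distrib add_ac)
    then show ?thesis unfolding coeffs by simp
  qed
  have E: "E x * r * E b = eig x * r * eig b * E b" for r
  proof -
    have "E x * r * E b = eig x * (tau * r) * E b" by (simp only: tau_eig(2)[symmetric] mult.assoc)
    also have "\<dots> = eig x * r * (tau * E b)" by (simp only: tau_central[symmetric] mult.assoc)
    also have "\<dots> = eig x * r * (eig b * E b)" by (simp only: B.tau_EF B.EE)
    finally show ?thesis by (simp only: mult.assoc)
  qed
  let ?v = "X x b + s \<cdot> Y x b"
  show ?thesis
  proof (rule dim_one)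
    show "?v \<in> range (\<lambda>r. E x * r * E b)"
      by (rule range_eqI[of _ _ "gG * gN"]) (simp only: YEb[symmetric], simp only: E, simp only: Y_def mult.assoc)
    show "\<exists>\<alpha>. w = \<alpha> \<cdot> ?v" if w: "w \<in> range (\<lambda>r. E x * r * E b)" for w
    proof -
      obtain r where r: "w = E x * r * E b" using w by blast
      obtain \<alpha> \<beta> \<gamma> \<delta> where "eig x * r * eig b =
          \<alpha> \<cdot> (eig x * eig b) + \<beta> \<cdot> (eig x * (gN * eig b)) + \<gamma> \<cdot> X x b + \<delta> \<cdot> Y x b"
        using corner_spanned[OF x5 B.x5] by blast
      then have "w = (\<gamma> \<cdot> X x b + \<delta> \<cdot> Y x b) * E b" by (simp add: r E zero)
      also have "\<dots> = \<gamma> \<cdot> (s' \<cdot> X x b + Y x b) + \<delta> \<cdot> ?v" by (simp only: distrib_right scal_mult XEb YEb)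
      also have "s' \<cdot> X x b + Y x b = s' \<cdot> ?v" by (simp add: V.scale_right_distrib s)
      also have "\<gamma> \<cdot> s' \<cdot> ?v + \<delta> \<cdot> ?v = (\<gamma> * s' + \<delta>) \<cdot> ?v" by (simp only: V.scale_left_distrib V.scale_scale)
      finally show ?thesis by blast
    qed
    have "coeff ?v pg = 1" by (simp add: coeff_add coeff_scal coeff_basis)
    then show "?v \<noteq> 0" by (metis zero_neq_one coeff_zero)
  qed
qed

end

context char_two
begin

lemma dim_trivial: "V.dim (range (\<lambda>r. eig (1 :: 'k) * r * eig 1)) = 4"
proof (rule V.dim_unique[of "{eig 1, N1, X 1 1, Y 1 1}"])
  have ne: "u \<noteq> v" if "coeff u p \<noteq> coeff v p" for u v :: "'k alg" and p using that by blast
  have co: "coeff N1 id = 0" "coeff N1 pn = 1" "coeff N1 pg = 0" "coeff N1 (pg \<circ> pn) = 0"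
    by (simp_all only: N1_def coeff_basis)
  show "{eig 1, N1, X 1 1, Y 1 1} \<subseteq> range (\<lambda>r. eig (1 :: 'k) * r * eig 1)"
  proof -
    have "eig 1 \<in> range (\<lambda>r. eig (1 :: 'k) * r * eig 1)" by (rule range_eqI[of _ _ 1]) (simp add: f1)
    moreover have "N1 \<in> range (\<lambda>r. eig (1 :: 'k) * r * eig 1)" by (rule range_eqI[of _ _ gN]) (simp add: N1_eq mult.assoc trivial_corner)
    moreover have "X 1 1 \<in> range (\<lambda>r. eig (1 :: 'k) * r * eig 1)" by (rule range_eqI[of _ _ gG]) (simp add: X_def mult.assoc)
    moreover have "Y 1 1 \<in> range (\<lambda>r. eig (1 :: 'k) * r * eig 1)" by (rule range_eqI[of _ _ "gG * gN"]) (simp add: Y_def mult.assoc)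
    ultimately show ?thesis by blast
  qed
  show "range (\<lambda>r. eig (1 :: 'k) * r * eig 1) \<subseteq> V.span {eig 1, N1, X 1 1, Y 1 1}"
  proof
    fix w assume "w \<in> range (\<lambda>r. eig (1 :: 'k) * r * eig 1)"
    then obtain \<alpha> \<beta> \<gamma> \<delta> where "w = \<alpha> \<cdot> eig 1 + \<beta> \<cdot> N1 + \<gamma> \<cdot> X 1 1 + \<delta> \<cdot> Y 1 1"
      using trivial_spanned by blast
    then show "w \<in> V.span {eig 1, N1, X 1 1, Y 1 1}"
      by (simp only:) (intro V.span_add V.span_scale V.span_base; simp)
  qed
  have dist: "eig 1 \<noteq> N1" "eig (1 :: 'k) \<noteq> X 1 1" "eig (1 :: 'k) \<noteq> Y 1 1" "N1 \<noteq> X 1 1" "N1 \<noteq> Y 1 1" "X 1 1 \<noteq> (Y 1 1 :: 'k alg)"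
  proof -
    show "eig 1 \<noteq> N1" "eig (1 :: 'k) \<noteq> X 1 1" "eig (1 :: 'k) \<noteq> Y 1 1" by (rule ne[of _ id]; simp add: coeff_basis co)+
    show "N1 \<noteq> X 1 1" "N1 \<noteq> Y 1 1" by (rule ne[of _ pn]; simp add: coeff_basis co)+
    show "X 1 1 \<noteq> (Y 1 1 :: 'k alg)" by (rule ne[of _ pg]; simp add: coeff_basis co)
  qed
  show "card {eig 1, N1, X 1 1, Y 1 1} = 4" using dist by simp
  show "V.independent {eig 1, N1, X 1 1, Y 1 1}"
  proof (rule V.independent_if_scalars_zero)
    fix u v assume sum: "(\<Sum>v\<in>{eig 1, N1, X 1 1, Y 1 1}. u v \<cdot> v) = 0" and v: "v \<in> {eig 1, N1, X 1 1, Y 1 1}"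
    have eq: "u (eig 1) \<cdot> eig 1 + (u N1 \<cdot> N1 + (u (X 1 1) \<cdot> X 1 1 + u (Y 1 1) \<cdot> Y 1 1)) = 0"
      using sum dist by simp
    have "coeff (u (eig 1) \<cdot> eig 1 + (u N1 \<cdot> N1 + (u (X 1 1) \<cdot> X 1 1 + u (Y 1 1) \<cdot> Y 1 1))) p = 0" for p
      unfolding eq by (simp add: coeff_zero)
    from this[of id] this[of pn] this[of pg] this[of "pg \<circ> pn"]
    have "u (eig 1) = 0" "u N1 = 0" "u (X 1 1) = 0" "u (Y 1 1) = 0"
      by (simp_all only: coeff_add coeff_scal coeff_basis co mult_zero_right mult_1_right add_0_left add_0_right)
    then show "u v = 0" using v by auto
  qed simp
qed

end

section \<open>Modules given by matrix representations\<close>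

locale matrix_rep =
  fixes n :: nat and \<rho> :: "(nat \<Rightarrow> nat) \<Rightarrow> 'k::field mat"
  assumes dim: "g \<in> carrier A5 \<Longrightarrow> \<rho> g \<in> carrier_mat n n"
    and hom: "\<lbrakk>g \<in> carrier A5; h \<in> carrier A5\<rbrakk> \<Longrightarrow> \<rho> (g \<circ> h) = \<rho> g * \<rho> h"
    and one: "\<rho> id = 1\<^sub>m n"
begin

abbreviation "Md \<equiv> representation_module n \<rho>"

lemma sel: "carrier Md = carrier_vec n" "\<zero>\<^bsub>Md\<^esub> = 0\<^sub>v n" "u \<oplus>\<^bsub>Md\<^esub> v = u + v"
  by (simp_all add: representation_module_def)

lemma act_eq: "a \<star>\<^bsub>Md\<^esub> v = vec n (\<lambda>i. \<Sum>g\<in>carrier A5. coeff a g * (\<rho> g *\<^sub>v v) $ i)"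
proof -
  have "(\<Sum>g | coeff a g \<noteq> 0. coeff a g * (\<rho> g *\<^sub>v v) $ i) = (\<Sum>g\<in>carrier A5. coeff a g * (\<rho> g *\<^sub>v v) $ i)" for i
    using coeff_outside[of _ a] by (intro sum.mono_neutral_left) auto
  then show ?thesis by (simp add: representation_module_def)
qed

lemma act_delta: "p \<in> carrier A5 \<Longrightarrow> v \<in> carrier_vec n \<Longrightarrow> delta p \<star>\<^bsub>Md\<^esub> v = \<rho> p *\<^sub>v v"
  using dim[of p] by (intro eq_vecI) (auto simp: act_eq coeff_delta if_distrib[of "\<lambda>t. t * _"] cong: if_cong)

lemma act_scalar: "(c \<cdot> a) \<star>\<^bsub>Md\<^esub> v = c \<cdot>\<^sub>v (a \<star>\<^bsub>Md\<^esub> v)"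
  by (intro eq_vecI) (auto simp: act_eq coeff_scal sum_distrib_left mult.assoc)

lemma mult_act:
  assumes y: "y \<in> carrier A5" and v: "v \<in> carrier_vec n" and i: "i < n"
  shows "(\<rho> y *\<^sub>v (b \<star>\<^bsub>Md\<^esub> v)) $ i = (\<Sum>h\<in>carrier A5. coeff b h * (\<rho> (y \<circ> h) *\<^sub>v v) $ i)"
proof -
  have "(\<rho> y *\<^sub>v (b \<star>\<^bsub>Md\<^esub> v)) $ i =
      (\<Sum>j<n. \<rho> y $$ (i, j) * (\<Sum>h\<in>carrier A5. coeff b h * (\<rho> h *\<^sub>v v) $ j))"
    using dim[OF y] i by (auto simp: act_eq scalar_prod_def atLeast0LessThan intro!: sum.cong)
  also have "\<dots> = (\<Sum>h\<in>carrier A5. coeff b h * (\<Sum>j<n. \<rho> y $$ (i, j) * (\<rho> h *\<^sub>v v) $ j))"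
    unfolding sum_distrib_left by (subst sum.swap) (simp add: mult_ac)
  also have "\<dots> = (\<Sum>h\<in>carrier A5. coeff b h * (\<rho> (y \<circ> h) *\<^sub>v v) $ i)"
  proof (rule sum.cong[OF refl])
    fix h assume h: "h \<in> carrier A5"
    have "\<rho> (y \<circ> h) *\<^sub>v v = \<rho> y *\<^sub>v (\<rho> h *\<^sub>v v)"
      unfolding hom[OF y h] using dim[OF y] dim[OF h] v by (rule assoc_mult_mat_vec)
    moreover have "(\<rho> y *\<^sub>v (\<rho> h *\<^sub>v v)) $ i = (\<Sum>j<n. \<rho> y $$ (i, j) * (\<rho> h *\<^sub>v v) $ j)"
      using dim[OF y] dim[OF h] i by (auto simp: scalar_prod_def atLeast0LessThan intro!: sum.cong)
    ultimately show "coeff b h * (\<Sum>j<n. \<rho> y $$ (i, j) * (\<rho> h *\<^sub>v v) $ j) = coeff b h * (\<rho> (y \<circ> h) *\<^sub>v v) $ i"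
      by simp
  qed
  finally show ?thesis .
qed

lemma act_assoc:
  assumes v: "v \<in> carrier_vec n"
  shows "(a * b) \<star>\<^bsub>Md\<^esub> v = a \<star>\<^bsub>Md\<^esub> (b \<star>\<^bsub>Md\<^esub> v)"
proof (rule eq_vecI)
  fix i assume "i < dim_vec (a \<star>\<^bsub>Md\<^esub> (b \<star>\<^bsub>Md\<^esub> v))"
  then have i: "i < n" by (simp add: act_eq)
  have "((a * b) \<star>\<^bsub>Md\<^esub> v) $ i =
      (\<Sum>y\<in>carrier A5. \<Sum>x\<in>carrier A5. coeff a y * (coeff b (inv\<^bsub>A5\<^esub> y \<otimes>\<^bsub>A5\<^esub> x) * (\<rho> x *\<^sub>v v) $ i))"
    using i by (subst sum.swap) (simp add: act_eq coeff_mult sum_distrib_right mult.assoc)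
  also have "\<dots> = (\<Sum>y\<in>carrier A5. coeff a y * (\<Sum>h\<in>carrier A5. coeff b h * (\<rho> (y \<circ> h) *\<^sub>v v) $ i))"
  proof (rule sum.cong[OF refl])
    fix y assume y: "y \<in> carrier A5"
    show "(\<Sum>x\<in>carrier A5. coeff a y * (coeff b (inv\<^bsub>A5\<^esub> y \<otimes>\<^bsub>A5\<^esub> x) * (\<rho> x *\<^sub>v v) $ i)) =
        coeff a y * (\<Sum>h\<in>carrier A5. coeff b h * (\<rho> (y \<circ> h) *\<^sub>v v) $ i)"
      unfolding sum_distrib_left using y
      by (subst A5.sum_translate[OF y], intro sum.cong refl)
         (simp add: A5.m_assoc[symmetric] del: A5.m_assoc, simp add: alt_group_mult)
  qed
  also have "\<dots> = (a \<star>\<^bsub>Md\<^esub> (b \<star>\<^bsub>Md\<^esub> v)) $ i"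
    using i by (simp add: act_eq[of a] mult_act[OF _ v])
  finally show "((a * b) \<star>\<^bsub>Md\<^esub> v) $ i = (a \<star>\<^bsub>Md\<^esub> (b \<star>\<^bsub>Md\<^esub> v)) $ i" .
qed (simp add: act_eq)

lemma act_closed': "a \<star>\<^bsub>Md\<^esub> v \<in> carrier_vec n"
  by (simp add: act_eq)

lemma rep_left_module: "left_module kA5 Md"
proof -
  have inv: "\<exists>y\<in>carrier Md. y \<oplus>\<^bsub>Md\<^esub> x = \<zero>\<^bsub>Md\<^esub>" if "x \<in> carrier Md" for x
    using that by (intro bexI[of _ "- x"]) (auto simp: sel)
  have "abelian_group Md"
    using inv by (intro abelian_groupI) (auto simp: sel assoc_add_vec[of _ n] comm_add_vec[of _ n])
  moreover have "(a + b) \<star>\<^bsub>Md\<^esub> v = a \<star>\<^bsub>Md\<^esub> v + b \<star>\<^bsub>Md\<^esub> v" for a b v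
    by (intro eq_vecI) (auto simp: act_eq coeff_add distrib_right sum.distrib)
  moreover have "a \<star>\<^bsub>Md\<^esub> (u + v) = a \<star>\<^bsub>Md\<^esub> u + a \<star>\<^bsub>Md\<^esub> v"
    if "u \<in> carrier_vec n" "v \<in> carrier_vec n" for a u v
  proof (rule eq_vecI)
    fix i assume "i < dim_vec (a \<star>\<^bsub>Md\<^esub> u + a \<star>\<^bsub>Md\<^esub> v)"
    then have i: "i < n" by (simp add: act_eq)
    have "(\<rho> g *\<^sub>v (u + v)) $ i = (\<rho> g *\<^sub>v u) $ i + (\<rho> g *\<^sub>v v) $ i" if g: "g \<in> carrier A5" for g
      using dim[OF g] i \<open>u \<in> carrier_vec n\<close> \<open>v \<in> carrier_vec n\<close> by (simp add: mult_add_distrib_mat_vec)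
    then show "(a \<star>\<^bsub>Md\<^esub> (u + v)) $ i = (a \<star>\<^bsub>Md\<^esub> u + a \<star>\<^bsub>Md\<^esub> v) $ i"
      using i by (simp add: act_eq distrib_left sum.distrib)
  qed (simp add: act_eq)
  moreover have "1 \<star>\<^bsub>Md\<^esub> v = v" if "v \<in> carrier_vec n" for v
    using act_delta[OF id_in_A5 that] that by (simp add: delta_id one)
  ultimately show ?thesis
    using kA5.ring_axioms act_closed'
    by (intro left_module.intro left_module_axioms.intro)
       (auto simp: sel carrier_kA5 act_assoc simp flip: coeff_ops)
qed

sublocale A: alg_module Md
  using rep_left_module by (simp add: alg_module_def)

lemma act_sum: "v \<in> carrier_vec n \<Longrightarrow> (a + b) \<star>\<^bsub>Md\<^esub> v = a \<star>\<^bsub>Md\<^esub> v + b \<star>\<^bsub>Md\<^esub> v"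
  using A.act_add[of v a b] by (simp add: sel)

lemma act_const: "v \<in> carrier_vec n \<Longrightarrow> (c \<cdot> 1) \<star>\<^bsub>Md\<^esub> v = c \<cdot>\<^sub>v v"
  using A.act_one[of v] by (simp add: act_scalar sel)

lemma act_gens:
  assumes "v \<in> carrier_vec n"
  shows "gC \<star>\<^bsub>Md\<^esub> v = \<rho> pc *\<^sub>v v" "gN \<star>\<^bsub>Md\<^esub> v = \<rho> pn *\<^sub>v v" "gG \<star>\<^bsub>Md\<^esub> v = \<rho> pg *\<^sub>v v"
  using assms by (simp_all add: gC_def gN_def gG_def act_delta)

lemma act_eig:
  assumes v: "v \<in> carrier_vec n"
  shows "eig y \<star>\<^bsub>Md\<^esub> v = v + y ^ 4 \<cdot>\<^sub>v (\<rho> pc *\<^sub>v v) + y ^ 3 \<cdot>\<^sub>v (\<rho> pc *\<^sub>v (\<rho> pc *\<^sub>v v)) +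
    y ^ 2 \<cdot>\<^sub>v (\<rho> pc *\<^sub>v (\<rho> pc *\<^sub>v (\<rho> pc *\<^sub>v v))) +
    y \<cdot>\<^sub>v (\<rho> pc *\<^sub>v (\<rho> pc *\<^sub>v (\<rho> pc *\<^sub>v (\<rho> pc *\<^sub>v v))))"
proof -
  have c: "\<rho> pc *\<^sub>v u \<in> carrier_vec n" if "u \<in> carrier_vec n" for u
    using dim[of pc] that by auto
  have [simp]: "1 \<star>\<^bsub>Md\<^esub> u = u" if "u \<in> carrier_vec n" for u
    using that by (simp add: sel)
  show ?thesis
    unfolding eig_def scal_mult using v
    by (simp add: act_sum act_scalar act_assoc act_gens c)
qed

end

text \<open>An isomorphism invariant of \<open>M\<close>; its values at three idempotents tell the four modules apart.\<close>

definition kills :: "'k::field alg \<Rightarrow> ('k, 'b, 'm) kA5_scheme \<Rightarrow> bool"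
  where "kills a M \<longleftrightarrow> (\<forall>v\<in>carrier M. a \<star>\<^bsub>M\<^esub> v = \<zero>\<^bsub>M\<^esub>)"

lemma kills_isomorphic:
  fixes T :: "('k::field, 'b, 'm) kA5_scheme"
    and S :: "('k::field, 'c, 'n) kA5_scheme"
  assumes T: "left_module kA5 T" and S: "left_module kA5 S" and iso: "left_module_isomorphic kA5 T S"
  shows "kills a T \<longleftrightarrow> kills a S"
proof -
  interpret T: alg_module T using T by (simp add: alg_module_def)
  interpret S: alg_module S using S by (simp add: alg_module_def)
  obtain h where h: "h \<in> left_module_hom kA5 T S" "bij_betw h (carrier T) (carrier S)"
    using iso by (auto simp: left_module_isomorphic_def)
  have act: "h (a \<star>\<^bsub>T\<^esub> x) = a \<star>\<^bsub>S\<^esub> h x" if "x \<in> carrier T" for a x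
    using h(1) that by (auto simp: left_module_hom_def)
  have cl: "h x \<in> carrier S" if "x \<in> carrier T" for x using h(1) that by (auto simp: left_module_hom_def)
  have zero: "h \<zero>\<^bsub>T\<^esub> = \<zero>\<^bsub>S\<^esub>" using act[of "\<zero>\<^bsub>T\<^esub>" 0] cl[of "\<zero>\<^bsub>T\<^esub>"] by simp
  have im: "h ` carrier T = carrier S" using h(2) by (rule bij_betw_imp_surj_on)
  have inj: "inj_on h (carrier T)" using h(2) by (rule bij_betw_imp_inj_on)
  have "a \<star>\<^bsub>T\<^esub> x = \<zero>\<^bsub>T\<^esub> \<longleftrightarrow> a \<star>\<^bsub>S\<^esub> h x = \<zero>\<^bsub>S\<^esub>" if "x \<in> carrier T" for x
    using inj_on_eq_iff[OF inj T.act_closed[OF that] T.M.zero_closed, of a] zero act[OF that, of a] by simp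
  then show ?thesis unfolding kills_def im[symmetric] by simp
qed

context prim_root
begin

text \<open>For each nonzero exponent \<open>i\<close> the coefficients of \<open>gC ^ i\<close> are the five fifth roots of unity, with
  sum zero; the coefficient of \<open>1\<close> is \<open>5 = 1\<close>.\<close>

lemma eig_sum: "eig 1 + eig x + eig (x ^ 2) + eig (x ^ 3) + eig (x ^ 4) = (1 :: 'k alg)"
proof -
  have s: "u + (x \<cdot> u + (x ^ 2 \<cdot> u + (x ^ 3 \<cdot> u + x ^ 4 \<cdot> u))) = 0" for u :: "'k alg"
  proof -
    have "u + (x \<cdot> u + (x ^ 2 \<cdot> u + (x ^ 3 \<cdot> u + x ^ 4 \<cdot> u))) = (1 + x + x ^ 2 + x ^ 3 + x ^ 4) \<cdot> u"
      by (simp add: V.scale_left_distrib add_ac)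
    then show ?thesis by (simp add: phi)
  qed
  have "eig 1 + eig x + eig (x ^ 2) + eig (x ^ 3) + eig (x ^ 4) = 1 +
      (gC + (x \<cdot> gC + (x ^ 2 \<cdot> gC + (x ^ 3 \<cdot> gC + x ^ 4 \<cdot> gC)))) +
      (gC * gC + (x \<cdot> (gC * gC) + (x ^ 2 \<cdot> (gC * gC) + (x ^ 3 \<cdot> (gC * gC) + x ^ 4 \<cdot> (gC * gC))))) +
      (gC * (gC * gC) + (x \<cdot> (gC * (gC * gC)) + (x ^ 2 \<cdot> (gC * (gC * gC)) + (x ^ 3 \<cdot> (gC * (gC * gC)) + x ^ 4 \<cdot> (gC * (gC * gC)))))) +
      (gC * (gC * (gC * gC)) + (x \<cdot> (gC * (gC * (gC * gC))) + (x ^ 2 \<cdot> (gC * (gC * (gC * gC))) + (x ^ 3 \<cdot> (gC * (gC * (gC * gC))) + x ^ 4 \<cdot> (gC * (gC * (gC * gC)))))))"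
    by (simp add: eig_def root_power[OF x5] x5 add_ac flip: power_mult)
  then show ?thesis unfolding s by simp
qed

end

context prim_root
begin

lemma component_nonzero:
  fixes M :: "('k, 'b, 'm) kA5_scheme"
  assumes "left_module kA5 M" "v \<in> carrier M" "v \<noteq> \<zero>\<^bsub>M\<^esub>"
  shows "\<exists>y\<in>{1, x, x ^ 2, x ^ 3, x ^ 4}. eig y \<star>\<^bsub>M\<^esub> v \<noteq> \<zero>\<^bsub>M\<^esub>"
proof (rule ccontr)
  interpret M: alg_module M using assms(1) by (simp add: alg_module_def)
  assume "\<not> ?thesis"
  then have "(eig 1 + eig x + eig (x ^ 2) + eig (x ^ 3) + eig (x ^ 4)) \<star>\<^bsub>M\<^esub> v = \<zero>\<^bsub>M\<^esub>"
    using assms(2) by (simp add: M.act_add)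
  then show False using assms(2,3) by (simp add: eig_sum)
qed

end

context char_two
begin

text \<open>The involution \<open>gN\<close> exchanges the eigenspaces of \<open>gC\<close> for \<open>y\<close> and \<open>y\<^sup>-\<^sup>1 = y\<^sup>4\<close>.\<close>

lemma component_flip:
  fixes M :: "('k, 'b, 'm) kA5_scheme"
  assumes "left_module kA5 M" "v \<in> carrier M" "(eig (y ^ 4)) \<star>\<^bsub>M\<^esub> v \<noteq> \<zero>\<^bsub>M\<^esub>" "y ^ 5 = 1"
  shows "eig y \<star>\<^bsub>M\<^esub> (gN \<star>\<^bsub>M\<^esub> v) \<noteq> \<zero>\<^bsub>M\<^esub>"
proof
  interpret M: alg_module M using assms(1) by (simp add: alg_module_def)
  assume zero: "eig y \<star>\<^bsub>M\<^esub> (gN \<star>\<^bsub>M\<^esub> v) = \<zero>\<^bsub>M\<^esub>"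
  have "eig (y ^ 4) = gN * (eig y * gN)"
    using eig_N(2)[OF assms(4), of gN] by (simp add: rels)
  then have "(eig (y ^ 4)) \<star>\<^bsub>M\<^esub> v = gN \<star>\<^bsub>M\<^esub> (eig y \<star>\<^bsub>M\<^esub> (gN \<star>\<^bsub>M\<^esub> v))"
    using assms(2) by (simp add: M.act_mult)
  then show False using assms(3) zero by simp
qed

section \<open>The trivial module\<close>

lemma rep_S1: "matrix_rep 1 (\<lambda>_. 1\<^sub>m 1 :: 'k mat)"
  by unfold_locales auto

lemma S1_act_eig1: "v \<in> carrier_vec 1 \<Longrightarrow> eig 1 \<star>\<^bsub>(S1 :: ('k, 'k vec) kA5_module)\<^esub> v = v"
proof -
  interpret matrix_rep 1 "\<lambda>_. 1\<^sub>m 1 :: 'k mat" by (rule rep_S1)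
  show "v \<in> carrier_vec 1 \<Longrightarrow> eig 1 \<star>\<^bsub>(S1 :: ('k, 'k vec) kA5_module)\<^esub> v = v"
    unfolding S1_def by (subst act_eig) (auto intro!: eq_vecI)
qed

lemma S1_simple: "simple_module kA5 (S1 :: ('k, 'k vec) kA5_module)"
proof -
  interpret matrix_rep 1 "\<lambda>_. 1\<^sub>m 1 :: 'k mat" by (rule rep_S1)
  have "N = {0\<^sub>v 1} \<or> N = carrier_vec 1" if N: "submodule N kA5 Md" for N
  proof (cases "N = {0\<^sub>v 1}")
    case False
    note ND = A.submoduleD[OF N, unfolded sel]
    obtain v where v: "v \<in> N" "v \<noteq> 0\<^sub>v 1" using False ND(2) by blast
    have vc: "v \<in> carrier_vec 1" using v ND(1) by blast
    have v0: "v $ 0 \<noteq> 0" using v(2) vc by (auto simp: vec_eq_iff)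
    have "u \<in> N" if u: "u \<in> carrier_vec 1" for u
    proof -
      have "((u $ 0 / v $ 0) \<cdot> 1) \<star>\<^bsub>Md\<^esub> v = (u $ 0 / v $ 0) \<cdot>\<^sub>v v"
        using vc by (rule act_const)
      also have "\<dots> = u" using u vc v0 by (auto simp: vec_eq_iff)
      finally show ?thesis using ND(4)[OF coeff_closed v(1)] by metis
    qed
    then show ?thesis using ND(1) by blast
  qed simp
  moreover have "carrier_vec 1 \<noteq> {0\<^sub>v 1 :: 'k vec}"
  proof -
    have "vec 1 (\<lambda>_. 1) \<noteq> (0\<^sub>v 1 :: 'k vec)" by (simp add: vec_eq_iff)
    then show ?thesis by (metis singletonD vec_carrier)
  qed
  ultimately show ?thesis
    using rep_left_module unfolding simple_module_def S1_def sel by blast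
qed

end

section \<open>The two-dimensional modules\<close>

locale rep_det = matrix_rep 2 \<psi> + char_two "TYPE('k::field)" for \<psi> :: "(nat \<Rightarrow> nat) \<Rightarrow> 'k::field mat" +
  assumes det: "\<psi> pc $$ (0, 0) * \<psi> pc $$ (1, 1) + \<psi> pc $$ (0, 1) * \<psi> pc $$ (1, 0) = 1"
begin

definition trc :: 'k where "trc = \<psi> pc $$ (0, 0) + \<psi> pc $$ (1, 1)"

text \<open>The theorem of Cayley and Hamilton for the matrix of \<open>pc\<close>.\<close>

lemma char_poly_kills:
  assumes v: "v \<in> carrier_vec 2"
  shows "(gC * gC + trc \<cdot> gC + 1) \<star>\<^bsub>Md\<^esub> v = 0\<^sub>v 2"
proof -
  define p q r s where "p = \<psi> pc $$ (0, 0)" "q = \<psi> pc $$ (0, 1)" "r = \<psi> pc $$ (1, 0)" "s = \<psi> pc $$ (1, 1)"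
  have D: "p * s + q * r = 1" using det by (simp add: p_q_r_s_def)
  have T: "trc = p + s" by (simp add: trc_def p_q_r_s_def)
  have m: "(\<psi> pc *\<^sub>v u) $ 0 = p * u $ 0 + q * u $ 1" "(\<psi> pc *\<^sub>v u) $ 1 = r * u $ 0 + s * u $ 1"
    "\<psi> pc *\<^sub>v u \<in> carrier_vec 2" if "u \<in> carrier_vec 2" for u
  proof -
    have "{0..<2::nat} = {0, 1}" by auto
    then show "(\<psi> pc *\<^sub>v u) $ 0 = p * u $ 0 + q * u $ 1" "(\<psi> pc *\<^sub>v u) $ 1 = r * u $ 0 + s * u $ 1"
      using dim[of pc] that by (simp_all add: scalar_prod_def p_q_r_s_def)
    show "\<psi> pc *\<^sub>v u \<in> carrier_vec 2" using dim[of pc] that by auto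
  qed
  have "(gC * gC + trc \<cdot> gC + 1) \<star>\<^bsub>Md\<^esub> v =
      \<psi> pc *\<^sub>v (\<psi> pc *\<^sub>v v) + (p + s) \<cdot>\<^sub>v (\<psi> pc *\<^sub>v v) + v"
    using v m(3)[OF v] A.act_one[unfolded sel, OF v]
    by (simp add: act_sum act_scalar act_assoc act_gens T)
  also have "\<dots> = 0\<^sub>v 2"
  proof (rule eq_vecI)
    fix i assume "i < dim_vec (0\<^sub>v 2 :: 'k vec)"
    then have "i = 0 \<or> i = 1" by auto
    moreover have "v $ 0 = p * s * v $ 0 + q * r * v $ 0" "v $ 1 = p * s * v $ 1 + q * r * v $ 1"
      using D by (simp_all flip: distrib_right)
    then have "p * (p * v $ 0 + q * v $ 1) + q * (r * v $ 0 + s * v $ 1) + (p + s) * (p * v $ 0 + q * v $ 1) + v $ 0 = 0"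
      "r * (p * v $ 0 + q * v $ 1) + s * (r * v $ 0 + s * v $ 1) + (p + s) * (r * v $ 0 + s * v $ 1) + v $ 1 = 0"
      by (simp_all add: distrib_left distrib_right mult_ac add_ac) (simp_all add: add_ac)?
    ultimately show "(\<psi> pc *\<^sub>v (\<psi> pc *\<^sub>v v) + (p + s) \<cdot>\<^sub>v (\<psi> pc *\<^sub>v v) + v) $ i = (0\<^sub>v 2 :: 'k vec) $ i"
      using v m[OF v] m(1,2)[OF m(3)[OF v]] carrier_vecD[OF v]
        carrier_vecD[OF m(3)[OF v]] carrier_vecD[OF m(3)[OF m(3)[OF v]]] by auto
  qed (use v in simp)
  finally show ?thesis .
qed

text \<open>Modulo the characteristic polynomial, \<open>gC ^ 5 + 1\<close> is \<open>(t\<^sup>4 + t\<^sup>2 + 1) \<cdot> gC + (t\<^sup>3 + 1)\<close>, where the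
  leading coefficient is \<open>(t\<^sup>2 + t + 1)\<^sup>2\<close> and \<open>t\<close> is the trace. If it were nonzero, the matrix of \<open>pc\<close> would be a scalar
  matrix of determinant one, hence the identity.\<close>

lemma trace_root:
  assumes "\<psi> pc \<noteq> 1\<^sub>m 2"
  shows "trc * trc + trc + 1 = 0"
proof (rule ccontr)
  let ?t = trc
  let ?u = "?t * ?t * ?t * ?t + ?t * ?t + 1" and ?w = "?t * ?t * ?t + 1"
  assume "?t * ?t + ?t + 1 \<noteq> 0"
  moreover have "?u = (?t * ?t + ?t + 1) * (?t * ?t + ?t + 1)"
    by (simp add: distrib_left distrib_right add_ac mult_ac)
  ultimately have u: "?u \<noteq> 0" by simp
  let ?Z = "gC * gC + ?t \<cdot> gC + (1 :: 'k alg)"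
  let ?W = "gC * (gC * gC) + ?t \<cdot> (gC * gC) + (?t * ?t + 1) \<cdot> gC + (?t * ?t * ?t) \<cdot> (1 :: 'k alg)"
  have WZ: "?W * ?Z = ?u \<cdot> gC + ?w \<cdot> 1"
    by (simp add: distrib_left distrib_right mult.assoc rels V.scale_left_distrib V.scale_right_distrib add_ac)
  have scalar: "?u * (\<psi> pc *\<^sub>v v) $ i = ?w * v $ i" if v: "v \<in> carrier_vec 2" and i: "i < 2" for v i
  proof -
    have "(?W * ?Z) \<star>\<^bsub>Md\<^esub> v = 0\<^sub>v 2"
      using char_poly_kills[OF v] A.act_null[of ?W] by (simp add: act_assoc[OF v] sel)
    then have "?u \<cdot>\<^sub>v (\<psi> pc *\<^sub>v v) + ?w \<cdot>\<^sub>v v = 0\<^sub>v 2"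
      unfolding WZ act_sum[OF v] act_scalar act_gens[OF v] using act_const[OF v, of 1] by simp
    then have "(?u \<cdot>\<^sub>v (\<psi> pc *\<^sub>v v) + ?w \<cdot>\<^sub>v v) $ i = 0" using i by simp
    then have "?u * (\<psi> pc *\<^sub>v v) $ i + ?w * v $ i = 0"
      using i v dim[of pc] by simp
    then show ?thesis using add_eq_0_iff[of "?u * (\<psi> pc *\<^sub>v v) $ i"] by simp
  qed
  have col: "(\<psi> pc *\<^sub>v unit_vec 2 j) $ i = \<psi> pc $$ (i, j)" if "i < 2" "j < 2" for i j
    using that dim[of pc] by (simp add: scalar_prod_right_unit)
  have entry: "?u * \<psi> pc $$ (i, j) = ?w * (if i = j then 1 else 0)" if "i < 2" "j < 2" for i j
    using scalar[of "unit_vec 2 j" i] that col[OF that] by simp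
  define c where "c = ?w / ?u"
  have c: "\<psi> pc $$ (i, j) = (if i = j then c else 0)" if "i < 2" "j < 2" for i j
  proof -
    have divide: "a = b / u" if "u * a = b" "u \<noteq> 0" for a b u :: 'k using that by auto
    show ?thesis unfolding divide[OF entry[OF that] u] c_def by (cases "i = j") simp_all
  qed
  have "c * c = 1" using det by (simp add: c)
  then have "(c + 1) * (c + 1) = 0" by (simp add: distrib_left distrib_right add_ac)
  then have "c = 1" using add_eq_0_iff[of c 1] by simp
  then have "\<psi> pc = 1\<^sub>m 2" using dim[of pc] by (intro eq_matI) (auto simp: c)
  then show False using assms by simp
qed

end

text \<open>The root \<open>x\<close> is an eigenvalue of \<open>gC\<close>; the other one is \<open>x\<^sup>4 = x\<^sup>-\<^sup>1\<close>.\<close>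

locale rep_two = rep_det \<psi> + prim_root x for \<psi> :: "(nat \<Rightarrow> nat) \<Rightarrow> 'k::field mat" and x :: 'k +
  assumes trace: "trc = x + x ^ 4"
begin

text \<open>On the range of \<open>eig y\<close> the element \<open>gC\<close> acts as \<open>y\<close>, so the characteristic polynomial acts as
  \<open>(y + x) * (y + x\<^sup>4)\<close>.\<close>

lemma kills_eig:
  assumes y: "y ^ 5 = 1" and neq: "y \<noteq> x" "y \<noteq> x ^ 4"
  shows "kills (eig y) Md"
  unfolding kills_def sel
proof
  fix v :: "'k vec" assume v: "v \<in> carrier_vec 2"
  let ?c = "y * y + (x + x ^ 4) * y + 1"
  have "eig y * (gC * gC + trc \<cdot> gC + 1) = ?c \<cdot> eig y"
    by (simp add: trace distrib_left distrib_right eig_C[OF y] V.scale_left_distrib mult.commute)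
  then have "(?c \<cdot> eig y) \<star>\<^bsub>Md\<^esub> v = 0\<^sub>v 2"
    using A.act_mult[of v "eig y" "gC * gC + trc \<cdot> gC + 1"] v char_poly_kills[OF v] A.act_null[of "eig y"]
    by (simp add: sel)
  then have "(?c \<cdot> 1) \<star>\<^bsub>Md\<^esub> (eig y \<star>\<^bsub>Md\<^esub> v) = 0\<^sub>v 2"
    using A.act_scal[of v ?c "eig y"] v by (simp add: sel)
  moreover have "?c = (y + x) * (y + x ^ 4)"
  proof -
    have "x * x ^ 4 = 1" using x5 by (simp add: eval_nat_numeral)
    then show ?thesis by (simp add: distrib_left distrib_right add_ac mult_ac)
  qed
  moreover have "y + x \<noteq> 0" "y + x ^ 4 \<noteq> 0"
    using neq by (simp_all add: add_eq_0_iff)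
  ultimately show "eig y \<star>\<^bsub>Md\<^esub> v = 0\<^sub>v 2"
    using A.act_scal_eq_zero[of "eig y \<star>\<^bsub>Md\<^esub> v" ?c] A.act_closed[of v "eig y"] v by (simp add: sel)
qed

lemma eig_nonzero:
  assumes v: "v \<in> carrier_vec 2" "v \<noteq> 0\<^sub>v 2"
  shows "eig x \<star>\<^bsub>Md\<^esub> v \<noteq> 0\<^sub>v 2 \<or> eig x \<star>\<^bsub>Md\<^esub> (gN \<star>\<^bsub>Md\<^esub> v) \<noteq> 0\<^sub>v 2"
proof -
  obtain y where y: "y \<in> {1, x, x ^ 2, x ^ 3, x ^ 4}" "eig y \<star>\<^bsub>Md\<^esub> v \<noteq> 0\<^sub>v 2"
    using component_nonzero[OF rep_left_module, unfolded sel, OF v] by blast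
  have "y ^ 5 = 1"
    using y(1) by (auto simp: x5 root_power[OF x5] simp flip: power_mult)
  then have "y = x \<or> y = x ^ 4" using y(2) kills_eig v by (auto simp: kills_def sel)
  then show ?thesis
    using y(2) component_flip[OF rep_left_module, unfolded sel, OF v(1) _ x5] by blast
qed

lemma eig_vector: "\<exists>v\<in>carrier_vec 2. eig x \<star>\<^bsub>Md\<^esub> v \<noteq> 0\<^sub>v 2"
proof -
  let ?v = "vec 2 (\<lambda>_. 1 :: 'k)"
  have "?v \<noteq> 0\<^sub>v 2" by (simp add: vec_eq_iff) (rule exI[of _ 0], simp)
  then show ?thesis using eig_nonzero[of ?v] act_closed'[of gN ?v] by auto
qed

text \<open>A nonzero submodule contains an eigenvector \<open>u\<close> of \<open>gC\<close> for \<open>x\<close>, by the flip, and the eigenvector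
  \<open>gN u\<close> for \<open>x\<^sup>4\<close>. Eigenvectors for different eigenvalues span the plane.\<close>

lemma simple: "simple_module kA5 Md"
proof -
  have "N = {0\<^sub>v 2} \<or> N = carrier_vec 2" if N: "submodule N kA5 Md" for N
  proof (cases "N = {0\<^sub>v 2}")
    case False
    note ND = A.submoduleD[OF N, unfolded sel]
    obtain v where v: "v \<in> N" "v \<noteq> 0\<^sub>v 2" using False ND(2) by blast
    have "gN \<star>\<^bsub>Md\<^esub> v \<in> N" using ND(4) v by simp
    then obtain v' where v': "v' \<in> N" "eig x \<star>\<^bsub>Md\<^esub> v' \<noteq> 0\<^sub>v 2" using eig_nonzero[of v] v ND(1) by blast
    define u where "u = eig x \<star>\<^bsub>Md\<^esub> v'"
    define w where "w = gN \<star>\<^bsub>Md\<^esub> u"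
    have uN: "u \<in> N" and wN: "w \<in> N" using ND(4) v' by (simp_all add: u_def w_def)
    have uc: "u \<in> carrier_vec 2" and wc: "w \<in> carrier_vec 2" and v'c: "v' \<in> carrier_vec 2" using uN wN v' ND(1) by auto
    have u0: "u \<noteq> 0\<^sub>v 2" using v' by (simp add: u_def)
    have w0: "w \<noteq> 0\<^sub>v 2"
    proof
      assume "w = 0\<^sub>v 2"
      then have "(gN * gN) \<star>\<^bsub>Md\<^esub> u = 0\<^sub>v 2" using uc A.act_null[of gN] by (simp add: act_assoc w_def sel)
      then show False using u0 uc A.act_one[of u] by (simp add: rels sel)
    qed
    have cu: "gC \<star>\<^bsub>Md\<^esub> u = x \<cdot>\<^sub>v u"
      using v'c by (simp add: u_def eig_C[OF x5] flip: act_assoc act_scalar)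
    have cw: "gC \<star>\<^bsub>Md\<^esub> w = x ^ 4 \<cdot>\<^sub>v w"
    proof -
      have "gC * (gN * eig x) = x ^ 4 \<cdot> (gN * eig x)"
        by (simp add: eig_N[OF x5] eig_C[OF pow4_root[OF x5]])
      then show ?thesis
        using v'c by (simp add: u_def w_def flip: act_assoc act_scalar)
    qed
    define d where "d = u $ 0 * w $ 1 + u $ 1 * w $ 0"
    have d: "d \<noteq> 0"
    proof
      assume "d = 0"
      then have eq: "u $ 0 * w $ 1 = u $ 1 * w $ 0" unfolding d_def using add_eq_0_iff[of "u $ 0 * w $ 1"] by simp
      have "\<exists>\<mu>. w = \<mu> \<cdot>\<^sub>v u"
      proof (cases "u $ 0 = 0")
        case True
        then have u1: "u $ 1 \<noteq> 0" using u0 uc by (auto simp: vec_eq_iff less_2_cases_iff)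
        then have "w $ 0 = 0" using eq True by simp
        then have "w = (w $ 1 / u $ 1) \<cdot>\<^sub>v u" using u1 uc wc True by (auto simp: vec_eq_iff less_2_cases_iff)
        then show ?thesis by blast
      next
        case False
        then have "w = (w $ 0 / u $ 0) \<cdot>\<^sub>v u" using uc wc eq by (auto simp: vec_eq_iff less_2_cases_iff field_simps)
        then show ?thesis by blast
      qed
      then obtain \<mu> where \<mu>: "w = \<mu> \<cdot>\<^sub>v u" by blast
      have "gC \<star>\<^bsub>Md\<^esub> w = (\<mu> \<cdot> gC) \<star>\<^bsub>Md\<^esub> u"
        using uc A.act_one[of u] by (simp add: \<mu> flip: act_scalar)
          (simp add: act_gens act_scalar mult_mat_vec[OF dim[OF generators_in_A5(1)]])
      also have "\<dots> = x \<cdot>\<^sub>v w" by (simp add: act_scalar cu \<mu> smult_smult_assoc mult.commute)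
      finally have "x ^ 4 \<cdot>\<^sub>v w = x \<cdot>\<^sub>v w" using cw by simp
      then have "(x ^ 4 - x) * w $ i = 0" if "i < 2" for i
        using wc that by (auto simp: vec_eq_iff algebra_simps)
      then have "w = 0\<^sub>v 2" using pow_neq(5) wc by (auto simp: vec_eq_iff)
      then show False using w0 by simp
    qed
    have "v \<in> N" if v: "v \<in> carrier_vec 2" for v
    proof -
      let ?a = "(v $ 0 * w $ 1 + v $ 1 * w $ 0) / d" and ?b = "(u $ 0 * v $ 1 + u $ 1 * v $ 0) / d"
      have "(?a \<cdot> 1) \<star>\<^bsub>Md\<^esub> u + (?b \<cdot> 1) \<star>\<^bsub>Md\<^esub> w \<in> N"
        using ND(3)[OF ND(4)[OF coeff_closed uN] ND(4)[OF coeff_closed wN]] .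
      moreover have "(?a \<cdot> 1) \<star>\<^bsub>Md\<^esub> u + (?b \<cdot> 1) \<star>\<^bsub>Md\<^esub> w = ?a \<cdot>\<^sub>v u + ?b \<cdot>\<^sub>v w"
        using uc wc A.act_one[of u] A.act_one[of w] by (simp add: act_scalar sel)
      moreover have "?a \<cdot>\<^sub>v u + ?b \<cdot>\<^sub>v w = v"
      proof (rule eq_vecI)
        fix i assume "i < dim_vec v"
        then have "i = 0 \<or> i = 1" using v by auto
        moreover have "(v $ 0 * w $ 1 + v $ 1 * w $ 0) * u $ 0 + (u $ 0 * v $ 1 + u $ 1 * v $ 0) * w $ 0 = v $ 0 * d"
          "(v $ 0 * w $ 1 + v $ 1 * w $ 0) * u $ 1 + (u $ 0 * v $ 1 + u $ 1 * v $ 0) * w $ 1 = v $ 1 * d"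
          by (simp_all add: d_def distrib_left distrib_right mult_ac add_ac)
        then have "?a * u $ 0 + ?b * w $ 0 = v $ 0" "?a * u $ 1 + ?b * w $ 1 = v $ 1"
          using d by (simp_all flip: add_divide_distrib)
        ultimately show "(?a \<cdot>\<^sub>v u + ?b \<cdot>\<^sub>v w) $ i = v $ i" using uc wc by auto
      qed (use v uc wc in auto)
      ultimately show ?thesis by simp
    qed
    then show ?thesis using ND(1) by blast
  qed simp
  moreover have "carrier_vec 2 \<noteq> {0\<^sub>v 2 :: 'k vec}"
  proof -
    have "vec 2 (\<lambda>_. 1) \<noteq> (0\<^sub>v 2 :: 'k vec)" by (simp add: vec_eq_iff) (rule exI[of _ 0], simp)
    then show ?thesis by (metis singletonD vec_carrier)
  qed
  ultimately show ?thesis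
    using rep_left_module by (simp add: simple_module_def sel)
qed

end

section \<open>The four-dimensional module\<close>

definition perm_mat :: "(nat \<Rightarrow> nat) \<Rightarrow> 'k::field mat" where
  "perm_mat p = mat 5 5 (\<lambda>(i, j). if p (Suc j) = Suc i then 1 else 0)"

lemma permutation_module_5: "permutation_module 5 = representation_module 5 perm_mat"
  by (simp add: permutation_module_def perm_mat_def[abs_def])

lemma A5_range:
  assumes "p \<in> carrier A5" "j < 5"
  shows "\<exists>k<5. p (Suc j) = Suc k"
proof -
  have "p (Suc j) \<in> {1..5}"
    using assms permutes_in_image[of p "{1..5}" "Suc j"] by (simp add: alt_group_carrier)
  then show ?thesis by (intro exI[of _ "p (Suc j) - 1"]) auto
qed

lemma rep_perm: "matrix_rep 5 (perm_mat :: _ \<Rightarrow> 'k::field mat)"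
proof
  show "(perm_mat g :: 'k mat) \<in> carrier_mat 5 5" for g by (simp add: perm_mat_def)
  show "perm_mat id = (1\<^sub>m 5 :: 'k mat)" by (rule eq_matI) (auto simp: perm_mat_def)
  fix g h assume g: "g \<in> carrier A5" and h: "h \<in> carrier A5"
  show "perm_mat (g \<circ> h) = (perm_mat g * perm_mat h :: 'k mat)"
  proof (rule eq_matI)
    fix i j assume "i < dim_row (perm_mat g * perm_mat h :: 'k mat)" "j < dim_col (perm_mat g * perm_mat h :: 'k mat)"
    then have i: "i < 5" and j: "j < 5" by (simp_all add: perm_mat_def)
    obtain k where k: "k < 5" "h (Suc j) = Suc k" using A5_range[OF h j] by blast
    have "(perm_mat g * perm_mat h :: 'k mat) $$ (i, j) =
        (\<Sum>l\<in>{0..<5}. (if g (Suc l) = Suc i then 1 else 0) * (if h (Suc j) = Suc l then 1 else 0))"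
      using i j by (simp add: perm_mat_def scalar_prod_def)
    also have "\<dots> = (\<Sum>l\<in>{0..<5}. if l = k then (if g (Suc k) = Suc i then 1 else 0) else 0)"
      by (intro sum.cong refl) (auto simp: k)
    also have "\<dots> = (perm_mat (g \<circ> h) :: 'k mat) $$ (i, j)"
      using i j k by (simp add: perm_mat_def)
    finally show "(perm_mat (g \<circ> h) :: 'k mat) $$ (i, j) = (perm_mat g * perm_mat h) $$ (i, j)" by simp
  qed (simp_all add: perm_mat_def)
qed

abbreviation PM :: "('k::field, 'k vec) kA5_module"
  where "PM \<equiv> representation_module 5 perm_mat"

interpretation perm: matrix_rep 5 perm_mat
  by (rule rep_perm)

lemma less_5: "i < (5::nat) \<longleftrightarrow> i = 0 \<or> i = 1 \<or> i = 2 \<or> i = 3 \<or> i = 4"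
  by auto

lemma vec5_eqI:
  "\<lbrakk>u \<in> carrier_vec 5; v \<in> carrier_vec 5; u $ 0 = v $ 0; u $ 1 = v $ 1; u $ 2 = v $ 2; u $ 3 = v $ 3; u $ 4 = v $ 4\<rbrakk> \<Longrightarrow> u = v"
  by (rule eq_vecI) (auto simp: less_5)

lemma set_5: "{0..<5::nat} = {0, 1, 2, 3, 4}" "{..<5::nat} = {0, 1, 2, 3, 4}"
  by auto

lemma perm_mat_dims: "dim_row (perm_mat p) = 5" "dim_col (perm_mat p) = 5"
  by (simp_all add: perm_mat_def)

lemma perm_vec_closed: "perm_mat p *\<^sub>v v \<in> carrier_vec 5"
  by (intro carrier_vecI) (simp add: perm_mat_dims)

lemma perm_vec:
  assumes "v \<in> carrier_vec 5" "i < 5"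
  shows "(perm_mat p *\<^sub>v v) $ i = (\<Sum>j<5. if p (Suc j) = Suc i then v $ j else 0)"
  using assms
  by (auto simp: perm_mat_def scalar_prod_def lessThan_atLeast0 intro!: sum.cong)

lemma perm_vec_sum:
  assumes p: "p \<in> carrier A5" and v: "v \<in> carrier_vec 5"
  shows "(\<Sum>i<5. (perm_mat p *\<^sub>v v) $ i) = (\<Sum>i<5. v $ i)"
proof -
  have "(\<Sum>i<5. (perm_mat p *\<^sub>v v) $ i) = (\<Sum>j<5. \<Sum>i<5. if p (Suc j) = Suc i then v $ j else 0)"
    using v by (subst sum.swap) (simp add: perm_vec)
  also have "\<dots> = (\<Sum>j<5. v $ j)"
  proof (rule sum.cong[OF refl])
    fix j :: nat assume "j \<in> {..<5}"
    then obtain k where k: "k < 5" "p (Suc j) = Suc k" using A5_range[OF p] by blast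
    have "(\<Sum>i<5. if p (Suc j) = Suc i then v $ j else 0) = (\<Sum>i<5. if i = k then v $ j else 0)"
      by (intro sum.cong refl) (auto simp: k)
    then show "(\<Sum>i<5. if p (Suc j) = Suc i then v $ j else 0) = v $ j" using k by simp
  qed
  finally show ?thesis .
qed

lemma perm_vec_gens:
  assumes v: "v \<in> carrier_vec 5"
  shows "(perm_mat pc *\<^sub>v v) $ 0 = v $ 4" "(perm_mat pc *\<^sub>v v) $ 1 = v $ 0" "(perm_mat pc *\<^sub>v v) $ 2 = v $ 1"
    "(perm_mat pc *\<^sub>v v) $ 3 = v $ 2" "(perm_mat pc *\<^sub>v v) $ 4 = v $ 3"
    "(perm_mat pn *\<^sub>v v) $ 0 = v $ 0" "(perm_mat pn *\<^sub>v v) $ 1 = v $ 4" "(perm_mat pn *\<^sub>v v) $ 2 = v $ 3"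
    "(perm_mat pn *\<^sub>v v) $ 3 = v $ 2" "(perm_mat pn *\<^sub>v v) $ 4 = v $ 1"
    "(perm_mat pg *\<^sub>v v) $ 0 = v $ 0" "(perm_mat pg *\<^sub>v v) $ 1 = v $ 2" "(perm_mat pg *\<^sub>v v) $ 2 = v $ 1"
    "(perm_mat pg *\<^sub>v v) $ 3 = v $ 4" "(perm_mat pg *\<^sub>v v) $ 4 = v $ 3"
  using v by (simp_all add: perm_vec set_5 del: One_nat_def)

definition S4_carrier :: "'k::field vec set" where
  "S4_carrier = {v \<in> carrier_vec 5. (\<Sum>i<5. v $ i) = 0}"

lemma S4_eq: "S4 = PM\<lparr>carrier := S4_carrier\<rparr>"
  by (simp add: S4_def permutation_module_5 S4_carrier_def)

lemma S4_submodule: "submodule S4_carrier kA5 (PM :: ('k::field, 'k vec) kA5_module)"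
proof (rule perm.A.submoduleI)
  show "S4_carrier \<subseteq> carrier (PM :: ('k, 'k vec) kA5_module)"
    by (auto simp: S4_carrier_def perm.sel)
  show "\<zero>\<^bsub>PM\<^esub> \<in> S4_carrier"
    by (auto simp: S4_carrier_def perm.sel)
  show "u \<oplus>\<^bsub>PM\<^esub> v \<in> S4_carrier" if "u \<in> S4_carrier" "v \<in> S4_carrier" for u v :: "'k vec"
    using that by (auto simp: S4_carrier_def perm.sel sum.distrib)
  show "a \<odot>\<^bsub>PM\<^esub> v \<in> S4_carrier"
    if a: "a \<in> carrier kA5" and v: "v \<in> S4_carrier" for a and v :: "'k vec"
  proof -
    obtain b where b: "a = coeff b" using a by (auto simp: carrier_kA5)
    have vc: "v \<in> carrier_vec 5" and v0: "(\<Sum>i<5. v $ i) = 0" using v by (auto simp: S4_carrier_def)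
    have "(\<Sum>i<5. (b \<star>\<^bsub>PM\<^esub> v) $ i) =
        (\<Sum>g\<in>carrier A5. coeff b g * (\<Sum>i<5. (perm_mat g *\<^sub>v v) $ i))"
      unfolding sum_distrib_left by (subst sum.swap) (simp add: perm.act_eq)
    also have "\<dots> = 0" using vc v0 by (intro sum.neutral) (simp add: perm_vec_sum)
    finally show ?thesis by (simp add: b S4_carrier_def perm.act_closed')
  qed
qed

lemma S4_left_module: "left_module kA5 (S4 :: ('k::field, 'k vec) kA5_module)"
  unfolding S4_eq by (rule perm.A.submodule_left_module[OF S4_submodule])

lemma S4_sel:
  "carrier S4 = S4_carrier" "\<zero>\<^bsub>S4\<^esub> = 0\<^sub>v 5" "u \<oplus>\<^bsub>S4\<^esub> v = u + v"
  "a \<odot>\<^bsub>S4\<^esub> v = a \<odot>\<^bsub>PM\<^esub> v"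
  by (simp_all add: S4_eq perm.sel)

text \<open>The eigenvector of the 5-cycle for the eigenvalue \<open>y\<close>, normalized in the first coordinate.\<close>

definition eigvec :: "'k::field \<Rightarrow> 'k vec" where "eigvec y = vec 5 (\<lambda>i. [1, y ^ 4, y ^ 3, y ^ 2, y] ! i)"

lemma eigvec_closed: "eigvec y \<in> carrier_vec 5"
  by (simp add: eigvec_def)

lemma eigvec_values: "eigvec y $ 0 = 1" "eigvec y $ 1 = y ^ 4" "eigvec y $ 2 = y ^ 3" "eigvec y $ 3 = y ^ 2" "eigvec y $ 4 = y"
  by (simp_all add: eigvec_def)

context char_two
begin

lemma quintic_shift:
  fixes a b c d e y :: 'k
  shows "(a + y * b + y ^ 2 * c + y ^ 3 * d + y ^ 4 * e) * y ^ 4 = a * y ^ 4 + b * y ^ 5 + c * y ^ 6 + d * y ^ 7 + e * y ^ 8"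
    "(a + y * b + y ^ 2 * c + y ^ 3 * d + y ^ 4 * e) * y ^ 3 = a * y ^ 3 + b * y ^ 4 + c * y ^ 5 + d * y ^ 6 + e * y ^ 7"
    "(a + y * b + y ^ 2 * c + y ^ 3 * d + y ^ 4 * e) * y ^ 2 = a * y ^ 2 + b * y ^ 3 + c * y ^ 4 + d * y ^ 5 + e * y ^ 6"
    "(a + y * b + y ^ 2 * c + y ^ 3 * d + y ^ 4 * e) * y = a * y + b * y ^ 2 + c * y ^ 3 + d * y ^ 4 + e * y ^ 5"
  by (simp_all add: distrib_right distrib_left eval_nat_numeral mult_ac)

lemma eig_perm:
  assumes y: "y ^ 5 = (1 :: 'k)" and v: "v \<in> carrier_vec 5"
  shows "eig y \<star>\<^bsub>PM\<^esub> v =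
    (v $ 0 + y * v $ 1 + y ^ 2 * v $ 2 + y ^ 3 * v $ 3 + y ^ 4 * v $ 4) \<cdot>\<^sub>v eigvec y"
proof -
  define t where "t = v $ 0 + y * v $ 1 + y ^ 2 * v $ 2 + y ^ 3 * v $ 3 + y ^ 4 * v $ 4"
  have "t * y ^ 4 = v $ 0 * y ^ 4 + v $ 1 * y ^ 5 + v $ 2 * y ^ 6 + v $ 3 * y ^ 7 + v $ 4 * y ^ 8"
    "t * y ^ 3 = v $ 0 * y ^ 3 + v $ 1 * y ^ 4 + v $ 2 * y ^ 5 + v $ 3 * y ^ 6 + v $ 4 * y ^ 7"
    "t * y ^ 2 = v $ 0 * y ^ 2 + v $ 1 * y ^ 3 + v $ 2 * y ^ 4 + v $ 3 * y ^ 5 + v $ 4 * y ^ 6"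
    "t * y = v $ 0 * y + v $ 1 * y ^ 2 + v $ 2 * y ^ 3 + v $ 3 * y ^ 4 + v $ 4 * y ^ 5"
    unfolding t_def by (rule quintic_shift)+
  note t = this[unfolded root_power[OF y] y]
  let ?c = "\<lambda>u. perm_mat pc *\<^sub>v u :: 'k vec"
  have comp: "(v + a \<cdot>\<^sub>v ?c v + b \<cdot>\<^sub>v ?c (?c v) + c \<cdot>\<^sub>v ?c (?c (?c v)) + d \<cdot>\<^sub>v ?c (?c (?c (?c v)))) $ i =
      v $ i + a * ?c v $ i + b * ?c (?c v) $ i + c * ?c (?c (?c v)) $ i + d * ?c (?c (?c (?c v))) $ i"
    if "i < 5" for a b c d i
    using that v by (simp add: carrier_vecD[OF perm_vec_closed] del: index_mult_mat_vec dim_mult_mat_vec)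
  have sc: "(t \<cdot>\<^sub>v eigvec y) $ i = t * eigvec y $ i" if "i < 5" for i
    using that by (simp add: carrier_vecD[OF eigvec_closed])
  show ?thesis
    unfolding perm.act_eig[OF v] t_def[symmetric]
  proof (rule vec5_eqI)
    show "v + y ^ 4 \<cdot>\<^sub>v ?c v + y ^ 3 \<cdot>\<^sub>v ?c (?c v) + y ^ 2 \<cdot>\<^sub>v ?c (?c (?c v)) + y \<cdot>\<^sub>v ?c (?c (?c (?c v))) \<in> carrier_vec 5"
      using v by (intro add_carrier_vec) (simp_all only: smult_carrier_vec perm_vec_closed)
    show "t \<cdot>\<^sub>v eigvec y \<in> carrier_vec 5" by (simp only: smult_carrier_vec eigvec_closed)
  qed (subst comp, simp, subst sc, simp,
       simp only: perm_vec_gens[OF v] perm_vec_gens[OF perm_vec_closed] eigvec_values t mult_1_right,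
       simp add: t_def add_ac mult_ac del: One_nat_def)+
qed

lemma eigvec_gens:
  assumes y: "y ^ 5 = (1 :: 'k)"
  shows "gN \<star>\<^bsub>PM\<^esub> eigvec y = eigvec (y ^ 4)"
proof -
  have "(y ^ 4) ^ 4 = y" "(y ^ 4) ^ 3 = y ^ 2" "(y ^ 4) ^ 2 = y ^ 3"
    by (simp_all add: root_power[OF y] flip: power_mult)
  then show ?thesis
    by (intro vec5_eqI) (simp_all add: perm.act_gens eigvec_closed perm_vec_closed perm_vec_gens eigvec_values del: One_nat_def)
qed

lemma eig_g_eigvec:
  assumes y: "y ^ 5 = (1 :: 'k)" and z: "z ^ 5 = 1"
  shows "(eig z * gG) \<star>\<^bsub>PM\<^esub> eigvec y =
    (1 + z * y ^ 3 + z ^ 2 * y ^ 4 + z ^ 3 * y + z ^ 4 * y ^ 2) \<cdot>\<^sub>v eigvec z"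
  by (simp add: perm.act_assoc eigvec_closed perm.act_gens eig_perm[OF z perm_vec_closed] perm_vec_gens eigvec_values del: One_nat_def)

end

context prim_root
begin

lemma eigvec_in_S4: "eigvec x \<in> S4_carrier"
  using phi' by (simp add: S4_carrier_def eigvec_closed set_5 eigvec_values add_ac del: One_nat_def)

lemma eig_eigvec: "eig x \<star>\<^bsub>PM\<^esub> eigvec x = eigvec x"
proof -
  have "1 + x * x ^ 4 + x ^ 2 * x ^ 3 + x ^ 3 * x ^ 2 + x ^ 4 * x = 1"
    by (simp add: x5 two flip: power_add power_Suc power_Suc2)
  then show ?thesis unfolding eig_perm[OF x5 eigvec_closed] eigvec_values by (simp only: one_smult_vec)
qed

lemma eigvec_nonzero: "eigvec y \<noteq> (0\<^sub>v 5 :: 'k vec)"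
proof
  assume "eigvec y = (0\<^sub>v 5 :: 'k vec)"
  then have "eigvec y $ 0 = (0\<^sub>v 5 :: 'k vec) $ 0" by simp
  then show False by (simp add: eigvec_values)
qed

text \<open>The factors in \<open>eig_g_eigvec\<close> for the eigenvectors of \<open>x\<close> and its powers.\<close>

lemma overlaps:
  "1 + x * x ^ 3 + x ^ 2 * x ^ 4 + x ^ 3 * x + x ^ 4 * x ^ 2 = 1"
  "1 + x * (x ^ 4) ^ 3 + x ^ 2 * (x ^ 4) ^ 4 + x ^ 3 * x ^ 4 + x ^ 4 * (x ^ 4) ^ 2 = 1"
  "1 + x ^ 4 * x ^ 3 + (x ^ 4) ^ 2 * x ^ 4 + (x ^ 4) ^ 3 * x + (x ^ 4) ^ 4 * x ^ 2 = 1"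
  "1 + x ^ 2 * x ^ 3 + (x ^ 2) ^ 2 * x ^ 4 + (x ^ 2) ^ 3 * x + (x ^ 2) ^ 4 * x ^ 2 = 1 + x ^ 2 + x ^ 3"
  "1 + x ^ 3 * x ^ 3 + (x ^ 3) ^ 2 * x ^ 4 + (x ^ 3) ^ 3 * x + (x ^ 3) ^ 4 * x ^ 2 = 1 + x + x ^ 4"
  by (simp_all add: x5 root_power[OF x5] add_ac flip: power_mult power_add power_Suc power_Suc2)
     (simp_all add: power2_eq_square)

lemma overlaps_nonzero: "1 + x ^ 2 + x ^ 3 \<noteq> 0" "1 + x + x ^ 4 \<noteq> 0"
proof -
  have "(1 + x ^ 2 + x ^ 3) * (1 + x + x ^ 4) = 1"
    using phi' by (simp add: distrib_left distrib_right x5 root_power[OF x5] add_ac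
      flip: power_mult power_add power_Suc power_Suc2)
  then show "1 + x ^ 2 + x ^ 3 \<noteq> 0" "1 + x + x ^ 4 \<noteq> 0" by auto
qed

text \<open>Both \<open>X x x\<close> and \<open>Y x x\<close> fix the eigenvector, so \<open>E x\<close> kills it.\<close>

lemma F_eigvec: "F x \<star>\<^bsub>PM\<^esub> eigvec x = eigvec x"
proof -
  let ?M = "PM :: ('k, 'k vec) kA5_module"
  have X: "X x x \<star>\<^bsub>?M\<^esub> eigvec x = eigvec x"
  proof -
    have "X x x \<star>\<^bsub>?M\<^esub> eigvec x = (eig x * gG) \<star>\<^bsub>?M\<^esub> (eig x \<star>\<^bsub>?M\<^esub> eigvec x)"
      by (simp add: X_def eigvec_closed mult.assoc flip: perm.act_assoc)
    then show ?thesis by (simp only: eig_eigvec eig_g_eigvec[OF x5 x5] overlaps) simp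
  qed
  have Y: "Y x x \<star>\<^bsub>?M\<^esub> eigvec x = eigvec x"
  proof -
    have "Y x x \<star>\<^bsub>?M\<^esub> eigvec x = (eig x * gG) \<star>\<^bsub>?M\<^esub> (gN \<star>\<^bsub>?M\<^esub> (eig x \<star>\<^bsub>?M\<^esub> eigvec x))"
      by (simp add: Y_def eigvec_closed mult.assoc perm.act_closed' flip: perm.act_assoc)
    then show ?thesis by (simp only: eig_eigvec eigvec_gens[OF x5] eig_g_eigvec[OF pow4_root[OF x5] x5] overlaps) simp
  qed
  have "F x \<star>\<^bsub>?M\<^esub> eigvec x = eigvec x + (eigvec x + eigvec x)"
    unfolding F_def E_def by (simp only: perm.act_sum[OF eigvec_closed] X Y eig_eigvec)
  also have "\<dots> = eigvec x" by (intro eq_vecI) (simp_all add: carrier_vecD[OF eigvec_closed])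
  finally show ?thesis .
qed

text \<open>The group element \<open>gG\<close> has nonzero components from the eigenvector of \<open>x\<close> to those of all nontrivial
  powers of \<open>x\<close>, and these span the vectors with coordinate sum zero.\<close>

lemma all_eigvec:
  assumes N: "submodule N kA5 S4" and w: "eigvec x \<in> N"
  shows "N = S4_carrier"
proof -
  interpret S: alg_module S4 using S4_left_module by (simp add: alg_module_def)
  note ND = S.submoduleD[OF N, unfolded S4_sel]
  have act: "a \<star>\<^bsub>PM\<^esub> v \<in> N" if "v \<in> N" for a v
    using ND(4)[OF coeff_closed that] .
  have scale: "c \<cdot>\<^sub>v v \<in> N" if "v \<in> N" for c v
    using act[OF that, of "c \<cdot> 1"] perm.act_const[of v c] ND(1) that by (auto simp: S4_carrier_def)
  have unscale: "v \<in> N" if "c \<cdot>\<^sub>v v \<in> N" "c \<noteq> 0" for c v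
    using scale[OF that(1), of "1 / c"] that(2) by (simp add: smult_smult_assoc)
  have gen: "eigvec z \<in> N" if "z ^ 5 = 1" "1 + z * x ^ 3 + z ^ 2 * x ^ 4 + z ^ 3 * x + z ^ 4 * x ^ 2 \<noteq> 0" for z
    using act[OF w, of "eig z * gG"] unscale[OF _ that(2)] unfolding eig_g_eigvec[OF x5 that(1)] by blast
  have r: "(x ^ 2) ^ 5 = 1" "(x ^ 3) ^ 5 = 1" "(x ^ 4) ^ 5 = 1"
    by (simp_all add: root_power[OF x5] flip: power_mult)
  have ws: "eigvec (x ^ 2) \<in> N" "eigvec (x ^ 3) \<in> N" "eigvec (x ^ 4) \<in> N"
    by (rule gen; simp only: r overlaps; simp add: overlaps_nonzero)+
  have "v \<in> N" if v: "v \<in> S4_carrier" for v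
  proof -
    have vc: "v \<in> carrier_vec 5" and v0: "v $ 0 + v $ 1 + v $ 2 + v $ 3 + v $ 4 = 0"
      using v by (auto simp: S4_carrier_def set_5 add_ac simp del: One_nat_def)
    have comp: "eig y \<star>\<^bsub>PM\<^esub> v \<in> N" if "y ^ 5 = 1" "eigvec y \<in> N" for y
      unfolding eig_perm[OF that(1) vc] by (rule scale[OF that(2)])
    have "eig 1 \<star>\<^bsub>PM\<^esub> v = 0 \<cdot>\<^sub>v eigvec 1"
      unfolding eig_perm[OF power_one vc] using v0 by (simp add: add_ac del: One_nat_def)
    also have "\<dots> = 0\<^sub>v 5" by (intro eq_vecI) (simp_all add: carrier_vecD[OF eigvec_closed])
    finally have c1: "eig 1 \<star>\<^bsub>PM\<^esub> v \<in> N" using ND(2) by simp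
    have "(eig 1 + eig x + eig (x ^ 2) + eig (x ^ 3) + eig (x ^ 4)) \<star>\<^bsub>PM\<^esub> v \<in> N"
      unfolding perm.act_sum[OF vc]
      by (intro ND(3) c1 comp x5 w r ws)
    then show "v \<in> N" unfolding eig_sum using perm.A.act_one[of v] vc by (simp add: perm.sel)
  qed
  then show ?thesis using ND(1) by blast
qed

lemma prim_root_powers: "prim_root (x ^ 2)" "prim_root (x ^ 3)" "prim_root (x ^ 4)"
proof -
  show 2: "prim_root (x ^ 2)" by (rule prim_root_square)
  have "prim_root ((x ^ 2) ^ 2)" using 2 by (rule prim_root.prim_root_square)
  then show 4: "prim_root (x ^ 4)" by (simp flip: power_mult)
  have "prim_root ((x ^ 4) ^ 2)" using 4 by (rule prim_root.prim_root_square)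
  then show "prim_root (x ^ 3)" by (simp add: root_power[OF x5] flip: power_mult)
qed

lemma S4_f1: "kills (eig 1) (S4 :: ('k, 'k vec) kA5_module)"
  unfolding kills_def S4_sel
proof
  fix v :: "'k vec" assume v: "v \<in> S4_carrier"
  have vc: "v \<in> carrier_vec 5" and v0: "v $ 0 + v $ 1 + v $ 2 + v $ 3 + v $ 4 = 0"
    using v by (auto simp: S4_carrier_def set_5 add_ac simp del: One_nat_def)
  have "eig 1 \<star>\<^bsub>PM\<^esub> v = 0 \<cdot>\<^sub>v eigvec 1"
    unfolding eig_perm[OF power_one vc] using v0 by (simp add: add_ac del: One_nat_def)
  also have "\<dots> = 0\<^sub>v 5" by (intro eq_vecI) (simp_all add: carrier_vecD[OF eigvec_closed])
  finally show "eig 1 \<star>\<^bsub>PM\<^esub> v = 0\<^sub>v 5" .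
qed

lemma S4_simple: "simple_module kA5 (S4 :: ('k, 'k vec) kA5_module)"
proof -
  interpret S: alg_module "S4 :: ('k, 'k vec) kA5_module" using S4_left_module by (simp add: alg_module_def)
  have "N = {0\<^sub>v 5} \<or> N = S4_carrier" if N: "submodule N kA5 (S4 :: ('k, 'k vec) kA5_module)" for N
  proof (cases "N = {0\<^sub>v 5}")
    case False
    note ND = S.submoduleD[OF N, unfolded S4_sel]
    obtain v where v: "v \<in> N" "v \<noteq> 0\<^sub>v 5" using False ND(2) by blast
    have vS: "v \<in> S4_carrier" and vc: "v \<in> carrier_vec 5" using v ND(1) by (auto simp: S4_carrier_def)
    obtain y where y: "y \<in> {1, x, x ^ 2, x ^ 3, x ^ 4}"
      and ne: "eig y \<star>\<^bsub>PM\<^esub> v \<noteq> 0\<^sub>v 5"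
      using component_nonzero[OF S4_left_module, unfolded S4_sel, OF vS v(2)] by blast
    have "y \<noteq> 1" using ne S4_f1 vS by (auto simp: kills_def S4_sel)
    then have "prim_root y" using y prim_root_powers prim_root_axioms by blast
    then interpret Y: prim_root y .
    define t where "t = v $ 0 + y * v $ 1 + y ^ 2 * v $ 2 + y ^ 3 * v $ 3 + y ^ 4 * v $ 4"
    have t: "eig y \<star>\<^bsub>PM\<^esub> v = t \<cdot>\<^sub>v eigvec y"
      unfolding t_def by (rule eig_perm[OF Y.x5 vc])
    have "t \<noteq> 0"
    proof
      assume "t = 0"
      then have "t \<cdot>\<^sub>v eigvec y = 0\<^sub>v 5" by (intro eq_vecI) (simp_all add: carrier_vecD[OF eigvec_closed])
      then show False using ne t by simp
    qed
    have "t \<cdot>\<^sub>v eigvec y \<in> N" using ND(4)[OF coeff_closed v(1), of "eig y"] t by simp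
    then have "((1 / t) \<cdot> 1) \<star>\<^bsub>PM\<^esub> (t \<cdot>\<^sub>v eigvec y) \<in> N"
      by (rule ND(4)[OF coeff_closed])
    then have "eigvec y \<in> N"
      using \<open>t \<noteq> 0\<close> eigvec_closed[of y] by (simp add: perm.act_const smult_smult_assoc)
    then show ?thesis using Y.all_eigvec[OF N] by blast
  qed simp
  moreover have "S4_carrier \<noteq> {0\<^sub>v 5 :: 'k vec}" using eigvec_in_S4 eigvec_nonzero by blast
  ultimately show ?thesis
    using S4_left_module by (simp add: simple_module_def S4_sel)
qed

end

section \<open>The Cartan matrix\<close>

lemma det_two:
  assumes A: "A \<in> carrier_mat 2 2"
  shows "det A = A $$ (0, 0) * A $$ (1, 1) - A $$ (0, 1) * (A $$ (1, 0) :: 'k::comm_ring_1)"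
proof -
  have "det A = (\<Sum>j<2. A $$ (0, j) * cofactor A 0 j)" using A by (rule laplace_expansion_row) simp
  also have "\<dots> = A $$ (0, 0) * cofactor A 0 0 + A $$ (0, 1) * cofactor A 0 1"
    by (simp add: numeral_2_eq_2)
  also have "cofactor A 0 0 = A $$ (1, 1)"
    using A by (simp add: cofactor_def det_single mat_delete_def)
  also have "cofactor A 0 1 = - A $$ (1, 0)"
    using A by (simp add: cofactor_def det_single mat_delete_def)
  finally show ?thesis by simp
qed

lemma SL_iso:
  fixes \<phi> :: "(nat \<Rightarrow> nat) \<Rightarrow> 'k::field mat"
  assumes \<phi>: "\<phi> \<in> iso A5 (SL 2 (F4 :: 'k set))"
  shows "matrix_rep 2 \<phi>" "g \<in> carrier A5 \<Longrightarrow> det (\<phi> g) = 1" "\<phi> pc \<noteq> 1\<^sub>m 2"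
proof -
  have cl: "\<phi> g \<in> carrier (SL 2 (F4 :: 'k set))" if "g \<in> carrier A5" for g
    using \<phi> that by (auto simp: iso_def hom_def)
  have mult: "\<phi> (g \<circ> h) = \<phi> g * \<phi> h" if "g \<in> carrier A5" "h \<in> carrier A5" for g h
    using \<phi> that by (auto simp: iso_def hom_def SL_def alt_group_mult)
  have bij: "bij_betw \<phi> (carrier A5) (carrier (SL 2 (F4 :: 'k set)))" using \<phi> by (simp add: iso_def)
  have d: "\<phi> g \<in> carrier_mat 2 2" "det (\<phi> g) = 1" if "g \<in> carrier A5" for g
    using cl[OF that] by (auto simp: SL_def)
  have "1\<^sub>m 2 \<in> carrier (SL 2 (F4 :: 'k set))"
    by (auto simp: SL_def F4_def elements_mat_def)
  then obtain h where h: "h \<in> carrier A5" "\<phi> h = 1\<^sub>m 2"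
    using bij_betw_imp_surj_on[OF bij] by (metis (no_types, lifting) imageE)
  have one: "\<phi> id = 1\<^sub>m 2"
    using mult[of id h] h d(1)[OF id_in_A5] by simp
  show "matrix_rep 2 \<phi>" using d(1) mult one by unfold_locales
  show "g \<in> carrier A5 \<Longrightarrow> det (\<phi> g) = 1" by (rule d(2))
  show "\<phi> pc \<noteq> 1\<^sub>m 2"
  proof
    assume "\<phi> pc = 1\<^sub>m 2"
    then have "\<phi> pc = \<phi> id" using one by simp
    then have "pc = id" using inj_onD[OF bij_betw_imp_inj_on[OF bij], of pc id] by simp
    then have "pc 1 = 1" by simp
    then show False by (simp del: One_nat_def)
  qed
qed

text \<open>The primitive root is an eigenvalue of \<open>\<phi> pc\<close>: a root of \<open>X\<^sup>2 + t X + 1\<close> with \<open>t\<^sup>2 + t + 1 = 0\<close>.\<close>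

lemma rep_two_exists:
  fixes \<phi> :: "(nat \<Rightarrow> nat) \<Rightarrow> 'k::alg_closed_field mat"
  assumes char2: "CHAR('k) = 2" and \<phi>: "\<phi> \<in> iso A5 (SL 2 (F4 :: 'k set))"
  shows "\<exists>x. rep_two \<phi> x"
proof -
  have "of_nat CHAR('k) = (0 :: 'k)" by (rule of_nat_CHAR)
  then have two: "(2 :: 'k) = 0" by (simp add: char2)
  interpret char_two "TYPE('k)" by unfold_locales (rule two)
  interpret matrix_rep 2 \<phi> by (rule SL_iso(1)[OF \<phi>])
  have "det (\<phi> pc) = 1" using SL_iso(2)[OF \<phi>] by simp
  then have "\<phi> pc $$ (0, 0) * \<phi> pc $$ (1, 1) + \<phi> pc $$ (0, 1) * \<phi> pc $$ (1, 0) = 1"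
    using det_two[OF dim[OF generators_in_A5(1)]] uminus_self[of "\<phi> pc $$ (0, 1) * \<phi> pc $$ (1, 0)"]
    by (simp only: diff_conv_add_uminus)
  then interpret rep_det \<phi> by unfold_locales
  let ?t = trc
  have t: "?t * ?t + ?t + 1 = 0" by (rule trace_root[OF SL_iso(3)[OF \<phi>]])
  obtain x where "poly [:1, ?t, 1:] x = 0" using alg_closed_imp_poly_has_root[of "[:1, ?t, 1:]"] by auto
  then have "x * x + ?t * x + 1 = 0" by (simp add: algebra_simps)
  then have xx: "x * x = ?t * x + 1"
    by (metis add.assoc add_eq_0_iff uminus_self)
  have tt: "?t * ?t = ?t + 1" using t by (metis add.assoc add_eq_0_iff uminus_self)
  have x2: "x ^ 2 = ?t * x + 1" by (simp add: power2_eq_square xx)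
  have x3: "x ^ 3 = ?t * x + ?t"
  proof -
    have "x ^ 3 = x * (?t * x + 1)" by (simp add: power3_eq_cube xx mult.assoc)
    also have "\<dots> = ?t * (x * x) + x" by (simp add: distrib_left mult_ac)
    also have "\<dots> = (?t * ?t) * x + ?t + x" by (simp add: xx distrib_left mult_ac)
    also have "\<dots> = ?t * x + ?t" by (simp add: tt distrib_right add_ac)
    finally show ?thesis .
  qed
  have x4: "x ^ 4 = x + ?t"
  proof -
    have "x ^ 4 = x * x ^ 3" by (simp add: eval_nat_numeral)
    also have "\<dots> = ?t * (x * x) + ?t * x" by (simp add: x3 distrib_left mult_ac)
    also have "\<dots> = (?t * ?t) * x + ?t + ?t * x" by (simp add: xx distrib_left mult_ac)
    also have "\<dots> = x + ?t" by (simp add: tt distrib_right add_ac)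
    finally show ?thesis .
  qed
  have "prim_root x" by unfold_locales (simp add: x2 x3 x4 add_ac)
  then interpret prim_root x .
  have "rep_two \<phi> x" by unfold_locales (simp add: x4)
  then show ?thesis ..
qed

context rep_two
begin

text \<open>Squaring is a field endomorphism in characteristic two; it sends the eigenvalue \<open>x\<close> to \<open>x\<^sup>2\<close>.\<close>

lemma frobenius_rep: "rep_two (\<lambda>g. map_mat (\<lambda>a. a ^ 2) (\<psi> g)) (x ^ 2)"
proof -
  let ?\<chi> = "\<lambda>g. map_mat (\<lambda>a. a ^ 2) (\<psi> g)"
  interpret Y: prim_root "x ^ 2" by (rule prim_root_square)
  have sq: "(a + b) ^ 2 = a ^ 2 + b ^ 2" for a b :: 'k
    by (simp add: power2_eq_square distrib_left distrib_right add_ac mult_ac)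
  have two_set: "{0..<2::nat} = {0, 1}" by auto
  interpret R: matrix_rep 2 ?\<chi>
  proof
    show "?\<chi> g \<in> carrier_mat 2 2" if "g \<in> carrier A5" for g using dim[OF that] by simp
    show "?\<chi> id = 1\<^sub>m 2" by (rule eq_matI) (auto simp: one)
    fix g h assume g: "g \<in> carrier A5" and h: "h \<in> carrier A5"
    show "?\<chi> (g \<circ> h) = ?\<chi> g * ?\<chi> h"
      unfolding hom[OF g h] using dim[OF g] dim[OF h]
      by (intro eq_matI) (auto simp: scalar_prod_def two_set sq power_mult_distrib)
  qed
  have entry: "?\<chi> pc $$ (i, j) = (\<psi> pc $$ (i, j)) ^ 2" if "i < 2" "j < 2" for i j
    using that dim[of pc] by simp
  have "(\<psi> pc $$ (0, 0) * \<psi> pc $$ (1, 1) + \<psi> pc $$ (0, 1) * \<psi> pc $$ (1, 0)) ^ 2 = 1" by (simp only: det power_one)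
  then have "?\<chi> pc $$ (0, 0) * ?\<chi> pc $$ (1, 1) + ?\<chi> pc $$ (0, 1) * ?\<chi> pc $$ (1, 0) = 1"
    by (simp add: entry sq power_mult_distrib)
  then interpret R: rep_det ?\<chi> by unfold_locales
  have "R.trc = trc ^ 2" by (simp add: R.trc_def trc_def entry sq)
  also have "\<dots> = x ^ 2 + (x ^ 2) ^ 4" by (simp add: trace sq mult.commute flip: power_mult)
  finally show ?thesis by unfold_locales
qed

lemma S4_not_killed: "\<not> kills (eig x) (S4 :: ('k, 'k vec) kA5_module)"
  using eig_eigvec eigvec_in_S4 eigvec_nonzero[of x] by (auto simp: kills_def S4_sel)

text \<open>Otherwise \<open>F x\<close>, which is local and nonzero on \<open>S4\<close>, would be nonzero on the module, and the two
  would be isomorphic. But \<open>eig (x\<^sup>2)\<close> kills only one of them.\<close>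

lemma E_not_killed: "\<not> kills (E x) Md"
proof
  assume E: "kills (E x) Md"
  obtain v where v: "v \<in> carrier_vec 2" "eig x \<star>\<^bsub>Md\<^esub> v \<noteq> 0\<^sub>v 2" using eig_vector by blast
  have "eig x = E x + F x" by (simp add: F_def add_ac)
  then have F: "F x \<star>\<^bsub>Md\<^esub> v \<noteq> 0\<^sub>v 2"
    using v E act_sum[OF v(1), of "E x" "F x"] by (auto simp: kills_def sel)
  have "left_module_isomorphic kA5 (S4 :: ('k, 'k vec) kA5_module) Md"
  proof (rule local_idem_isomorphic[OF local_F S4_simple simple])
    show "eigvec x \<in> carrier S4" by (simp add: S4_sel eigvec_in_S4)
    show "F x \<star>\<^bsub>S4\<^esub> eigvec x \<noteq> \<zero>\<^bsub>S4\<^esub>" by (simp add: S4_sel F_eigvec eigvec_nonzero)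
  qed (use v F in \<open>auto simp: sel\<close>)
  then have "kills (eig (x ^ 2)) (S4 :: ('k, 'k vec) kA5_module) = kills (eig (x ^ 2)) Md"
    by (rule kills_isomorphic[OF S4_left_module rep_left_module])
  moreover have "kills (eig (x ^ 2)) Md"
    using prim_root.x5[OF prim_root_powers(1)] pow_neq by (intro kills_eig) auto
  moreover have "eigvec (x ^ 2) \<noteq> 0\<^sub>v 5" by (rule eigvec_nonzero)
  then have "\<not> kills (eig (x ^ 2)) (S4 :: ('k, 'k vec) kA5_module)"
    using prim_root.eig_eigvec[OF prim_root_powers(1)] prim_root.eigvec_in_S4[OF prim_root_powers(1)]
    by (auto simp: kills_def S4_sel)
  ultimately show False by simp
qed

end

lemma classification_step:
  fixes T :: "((nat \<Rightarrow> nat) \<Rightarrow> 'k::field, 't) module" and S :: "('k::field, 'c, 'n) kA5_scheme"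
  assumes "simple_module kA5 T" "simple_module kA5 S" "local_idem e" "\<not> kills e T" "\<not> kills e S"
  shows "left_module_isomorphic kA5 T S"
  using assms local_idem_isomorphic[OF assms(3,1,2)] unfolding kills_def by blast

lemma cartan_invariant_of_idems:
  assumes "simple_module kA5 S" "local_idem e" "\<not> kills e S" "simple_module kA5 T" "local_idem e'" "\<not> kills e' T"
  shows "cartan_invariant kA5 S T = V.dim (range (\<lambda>a. e * a * e'))"
  using assms cartan_invariant_eq_dim[OF assms(1,2) _ _ assms(4,5)] unfolding kills_def by blast

theorem mainTheorem8:
  fixes \<phi> :: "(nat \<Rightarrow> nat) \<Rightarrow> 'k::alg_closed_field mat"
  assumes char2: "CHAR('k) = 2"
    and \<phi>: "\<phi> \<in> iso A5 (SL 2 (F4 :: 'k set))"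
  shows "let kA5 = group_algebra A5 :: ((nat \<Rightarrow> nat) \<Rightarrow> 'k) ring;
             Ss = [S1, S2 \<phi>, S3 \<phi>, S4]
         in (\<forall>S\<in>set Ss. simple_module kA5 S) \<and>
            (\<forall>i<4. \<forall>j<4. left_module_isomorphic kA5 (Ss ! i) (Ss ! j) \<longrightarrow> i = j) \<and>
            (\<forall>T :: ((nat \<Rightarrow> nat) \<Rightarrow> 'k, 't) module.
               simple_module kA5 T \<longrightarrow> (\<exists>S\<in>set Ss. left_module_isomorphic kA5 T S)) \<and>
            cartan_matrix kA5 Ss = mat_of_rows_list 4
              [[4, 2, 2, 0],
               [2, 2, 1, 0],
               [2, 1, 2, 0],
               [0, 0, 0, 1]]"
proof -
  obtain x where x: "rep_two \<phi> x" using rep_two_exists[OF char2 \<phi>] by blast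
  interpret A: rep_two \<phi> x by (rule x)
  interpret B: rep_two "\<lambda>g. map_mat (\<lambda>a. a ^ 2) (\<phi> g)" "x ^ 2" by (rule A.frobenius_rep)
  let ?S1 = "S1 :: ('k, 'k vec) kA5_module" and ?S4 = "S4 :: ('k, 'k vec) kA5_module"
  let ?S2 = "S2 \<phi>" and ?S3 = "S3 \<phi>"
  note x5 = A.x5
  have pw: "(x ^ 2) ^ 4 = x ^ 3" "(x ^ 2) ^ 3 = x" by (simp_all add: A.root_power[OF x5] flip: power_mult)
  have simple: "simple_module kA5 ?S1" "simple_module kA5 ?S2" "simple_module kA5 ?S3" "simple_module kA5 ?S4"
    using A.S1_simple A.simple B.simple A.S4_simple by (simp_all add: S2_def S3_def)
  have lm: "left_module kA5 ?S1" "left_module kA5 ?S2" "left_module kA5 ?S3" "left_module kA5 ?S4"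
    using simple by (simp_all add: simple_module_def)
  have S1_sel: "carrier ?S1 = carrier_vec 1" "\<zero>\<^bsub>?S1\<^esub> = 0\<^sub>v 1"
    by (simp_all add: S1_def representation_module_def)
  have S1_f: "kills (eig y) ?S1" if "y ^ 5 = 1" "y \<noteq> 1" for y
  proof -
    interpret S: alg_module ?S1 using lm by (simp add: alg_module_def)
    have "eig y \<star>\<^bsub>?S1\<^esub> v = \<zero>\<^bsub>?S1\<^esub>" if v: "v \<in> carrier ?S1" for v
    proof -
      have "eig y \<star>\<^bsub>?S1\<^esub> v = eig y \<star>\<^bsub>?S1\<^esub> (eig 1 \<star>\<^bsub>?S1\<^esub> v)"
        using A.S1_act_eig1[of v] v by (simp add: S1_sel)
      also have "\<dots> = (eig y * eig 1) \<star>\<^bsub>?S1\<^esub> v" using v by (simp add: S.act_mult)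
      also have "eig y * eig 1 = 0" by (rule A.eig_orth(1)[OF \<open>y ^ 5 = 1\<close> power_one \<open>y \<noteq> 1\<close>])
      finally show ?thesis using v by simp
    qed
    then show ?thesis by (simp add: kills_def)
  qed
  have S1_f1: "\<not> kills (eig 1) ?S1"
  proof -
    have "vec 1 (\<lambda>_. 1) \<noteq> (0\<^sub>v 1 :: 'k vec)" by (simp add: vec_eq_iff)
    then show ?thesis using A.S1_act_eig1[of "vec 1 (\<lambda>_. 1)"] by (auto simp: kills_def S1_sel)
  qed
  have x_not_4: "1 \<noteq> x" "1 \<noteq> x ^ 4" "1 \<noteq> x ^ 2" "1 \<noteq> x ^ 3" "x \<noteq> x ^ 2" "x \<noteq> x ^ 3" "x ^ 2 \<noteq> x" "x ^ 2 \<noteq> x ^ 4"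
    using A.pow_neq A.x_neq_1 by metis+
  have S1_k: "kills (eig x) ?S1" "kills (eig (x ^ 2)) ?S1"
    using S1_f[OF x5] S1_f[OF B.x5] A.x_neq_1 B.x_neq_1 by blast+
  have S2_k: "kills (eig 1) ?S2" "\<not> kills (eig x) ?S2" "kills (eig (x ^ 2)) ?S2"
    unfolding S2_def
    using A.kills_eig[OF power_one x_not_4(1,2)] A.kills_eig[OF B.x5 x_not_4(7,8)] A.eig_vector
    by (auto simp: kills_def A.sel)
  have S3_k: "kills (eig 1) ?S3" "kills (eig x) ?S3" "\<not> kills (eig (x ^ 2)) ?S3"
    unfolding S3_def
    using B.kills_eig[OF power_one x_not_4(3), unfolded pw, OF x_not_4(4)]
      B.kills_eig[OF x5 x_not_4(5), unfolded pw, OF x_not_4(6)] B.eig_vector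
    by (auto simp: kills_def B.sel)
  have S4_k: "kills (eig 1) ?S4" "\<not> kills (eig x) ?S4" "\<not> kills (eig (x ^ 2)) ?S4"
    by (rule A.S4_f1 A.S4_not_killed B.S4_not_killed)+
  let ?e1 = "eig 1 :: 'k alg" and ?e2 = "A.E x" and ?e3 = "A.E (x ^ 2)" and ?e4 = "A.F x" and ?e4' = "A.F (x ^ 2)"
  have local: "local_idem ?e1" "local_idem ?e2" "local_idem ?e3" "local_idem ?e4" "local_idem ?e4'"
    by (rule A.local_trivial A.local_E B.local_E A.local_F B.local_F)+
  have alive: "\<not> kills ?e1 ?S1" "\<not> kills ?e2 ?S2" "\<not> kills ?e3 ?S3" "\<not> kills ?e4 ?S4" "\<not> kills ?e4' ?S4"
  proof -
    show "\<not> kills ?e1 ?S1" by (rule S1_f1)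
    show "\<not> kills ?e2 ?S2" unfolding S2_def by (rule A.E_not_killed)
    show "\<not> kills ?e3 ?S3" unfolding S3_def by (rule B.E_not_killed)
    show "\<not> kills ?e4 ?S4"
      using A.F_eigvec A.eigvec_in_S4 A.eigvec_nonzero[of x] by (auto simp: kills_def S4_sel)
    show "\<not> kills ?e4' ?S4"
      using B.F_eigvec B.eigvec_in_S4 B.eigvec_nonzero[of "x ^ 2"] by (auto simp: kills_def S4_sel)
  qed
  let ?Ss = "[?S1, ?S2, ?S3, ?S4]" and ?es = "[?e1, ?e2, ?e3, ?e4]"
  have cases4: "i = 0 \<or> i = 1 \<or> i = 2 \<or> i = 3" if "i < 4" for i :: nat using that by auto
  have part1: "\<forall>S\<in>set ?Ss. simple_module kA5 S" using simple by simp
  have part2: "\<forall>i<4. \<forall>j<4. left_module_isomorphic kA5 (?Ss ! i) (?Ss ! j) \<longrightarrow> i = j"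
  proof (intro allI impI)
    fix i j :: nat
    assume i: "i < 4" and j: "j < 4" and iso: "left_module_isomorphic kA5 (?Ss ! i) (?Ss ! j)"
    have lm': "left_module kA5 (?Ss ! i)" if "i < 4" for i using cases4[OF that] lm by auto
    \<comment> \<open>The set of those idempotents among these three that kill a module determines its position.\<close>
    have sig: "kills (eig 1) (?Ss ! i) \<longleftrightarrow> i \<noteq> 0" "kills (eig x) (?Ss ! i) \<longleftrightarrow> i \<noteq> 1 \<and> i \<noteq> 3"
      "kills (eig (x ^ 2)) (?Ss ! i) \<longleftrightarrow> i \<noteq> 2 \<and> i \<noteq> 3" if "i < 4" for i
      using cases4[OF that] S1_f1 S1_k S2_k S3_k S4_k by auto
    have "kills a (?Ss ! i) \<longleftrightarrow> kills a (?Ss ! j)" for a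
      by (rule kills_isomorphic[OF lm'[OF i] lm'[OF j] iso])
    from this[of "eig 1"] this[of "eig x"] this[of "eig (x ^ 2)"]
    show "i = j" unfolding sig[OF i] sig[OF j] using cases4[OF i] cases4[OF j] by auto
  qed
  have part3: "\<exists>S\<in>set ?Ss. left_module_isomorphic kA5 T S"
    if T: "simple_module kA5 T" for T :: "((nat \<Rightarrow> nat) \<Rightarrow> 'k, 't) module"
  proof -
    interpret T: alg_module T using T by (simp add: simple_module_def alg_module_def)
    have lmT: "left_module kA5 T" by (rule T.left_module_axioms)
    have "carrier T \<noteq> {\<zero>\<^bsub>T\<^esub>}" using T by (simp add: simple_module_def)
    then obtain t where t: "t \<in> carrier T" "t \<noteq> \<zero>\<^bsub>T\<^esub>" using T.M.zero_closed by blast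
    obtain y where y: "y \<in> {1, x, x ^ 2, x ^ 3, x ^ 4}" "eig y \<star>\<^bsub>T\<^esub> t \<noteq> \<zero>\<^bsub>T\<^esub>"
      using A.component_nonzero[OF lmT t] by blast
    have alive_T: "\<not> kills (eig y) T" using y(2) t(1) by (auto simp: kills_def)
    have "\<not> kills (eig z) T" if "y = z ^ 4" "z ^ 5 = 1" for z
      using A.component_flip[OF lmT t(1) _ that(2)] y(2) that(1) T.act_closed[OF t(1), of gN]
      by (auto simp: kills_def)
    \<comment> \<open>The flip replaces the eigenvalues \<open>x\<^sup>3\<close> and \<open>x\<^sup>4\<close> by their inverses \<open>x\<^sup>2\<close> and \<open>x\<close>.\<close>
    from this[of x] this[of "x ^ 2"] have "\<not> kills (eig 1) T \<or> \<not> kills (eig x) T \<or> \<not> kills (eig (x ^ 2)) T"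
      using y(1) alive_T x5 B.x5 pw by auto
    moreover have split: "\<not> kills (A.E z) T \<or> \<not> kills (A.F z) T" if "\<not> kills (eig z) T" for z
    proof (rule ccontr)
      assume k: "\<not> (\<not> kills (A.E z) T \<or> \<not> kills (A.F z) T)"
      have "eig z = A.E z + A.F z" by (simp add: A.F_def add_ac)
      then have "kills (eig z) T" using k by (auto simp: kills_def T.act_add)
      then show False using that by simp
    qed
    ultimately consider "\<not> kills ?e1 T" | "\<not> kills ?e2 T" | "\<not> kills ?e3 T" | "\<not> kills ?e4 T" | "\<not> kills ?e4' T"
      by blast
    then show ?thesis
    proof cases
      case 1
      then show ?thesis using classification_step[OF T simple(1) local(1) _ alive(1)] by simp
    next
      case 2
      then show ?thesis using classification_step[OF T simple(2) local(2) _ alive(2)] by simp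
    next
      case 3
      then show ?thesis using classification_step[OF T simple(3) local(3) _ alive(3)] by simp
    next
      case 4
      then show ?thesis using classification_step[OF T simple(4) local(4) _ alive(4)] by simp
    next
      case 5
      then show ?thesis using classification_step[OF T simple(4) local(5) _ alive(5)] by simp
    qed
  qed
  define dm where "dm e e' = V.dim (range (\<lambda>a. e * a * e'))" for e e' :: "'k alg"
  have dims: "dm ?e1 ?e1 = 4" "dm ?e1 ?e2 = 2" "dm ?e1 ?e3 = 2" "dm ?e1 ?e4 = 0"
    "dm ?e2 ?e1 = 2" "dm ?e2 ?e2 = 2" "dm ?e2 ?e3 = 1" "dm ?e2 ?e4 = 0"
    "dm ?e3 ?e1 = 2" "dm ?e3 ?e2 = 1" "dm ?e3 ?e3 = 2" "dm ?e3 ?e4 = 0"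
    "dm ?e4 ?e1 = 0" "dm ?e4 ?e2 = 0" "dm ?e4 ?e3 = 0" "dm ?e4 ?e4 = 1"
  proof -
    show "dm ?e1 ?e1 = 4" unfolding dm_def by (rule A.dim_trivial)
    show "dm ?e1 ?e2 = 2" unfolding dm_def by (rule A.dim_trivial_E)
    show "dm ?e1 ?e3 = 2" unfolding dm_def by (rule B.dim_trivial_E)
    show "dm ?e2 ?e1 = 2" unfolding dm_def by (rule A.dim_E_trivial)
    show "dm ?e3 ?e1 = 2" unfolding dm_def by (rule B.dim_E_trivial)
    show "dm ?e2 ?e2 = 2" unfolding dm_def by (rule A.dim_EE)
    show "dm ?e3 ?e3 = 2" unfolding dm_def by (rule B.dim_EE)
    show "dm ?e4 ?e4 = 1" unfolding dm_def by (rule A.dim_FF)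
    show "dm ?e2 ?e3 = 1" unfolding dm_def by (rule A.dim_cross[OF _ B.prim_root_axioms]) blast
    have "x = (x ^ 2) ^ 3" using pw by simp
    then show "dm ?e3 ?e2 = 1" unfolding dm_def by (intro B.dim_cross[OF _ A.prim_root_axioms]) blast
    note orth = A.block_orthogonal[OF A.tau_trivial_square] A.block_orthogonal[OF A.tau_EE] A.block_orthogonal[OF B.tau_EE]
    show "dm ?e1 ?e4 = 0" "dm ?e2 ?e4 = 0" "dm ?e3 ?e4 = 0" "dm ?e4 ?e1 = 0" "dm ?e4 ?e2 = 0" "dm ?e4 ?e3 = 0"
      unfolding dm_def orth by simp_all
  qed
  have entry: "cartan_invariant kA5 (?Ss ! i) (?Ss ! j) = dm (?es ! i) (?es ! j)" if "i < 4" "j < 4" for i j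
  proof -
    have "simple_module kA5 (?Ss ! i) \<and> local_idem (?es ! i) \<and> \<not> kills (?es ! i) (?Ss ! i)" if "i < 4" for i
      using cases4[OF that] simple local alive by auto
    then show ?thesis unfolding dm_def using that by (intro cartan_invariant_of_idems) blast+
  qed
  have part4: "cartan_matrix kA5 ?Ss = mat_of_rows_list 4 [[4, 2, 2, 0], [2, 2, 1, 0], [2, 1, 2, 0], [0, 0, 0, 1]]"
    (is "_ = ?C")
  proof (rule eq_matI)
    fix i j assume "i < dim_row ?C" "j < dim_col ?C"
    then have i: "i < 4" and j: "j < 4" by (simp_all add: mat_of_rows_list_def)
    have "cartan_matrix kA5 ?Ss $$ (i, j) = dm (?es ! i) (?es ! j)"
      using i j by (simp add: cartan_matrix_def entry del: One_nat_def)
    also have "\<dots> = ?C $$ (i, j)"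
      using cases4[OF i] cases4[OF j] by (elim disjE) (simp_all add: mat_of_rows_list_def dims)
    finally show "cartan_matrix kA5 ?Ss $$ (i, j) = ?C $$ (i, j)" .
  qed (simp_all add: cartan_matrix_def mat_of_rows_list_def)
  show ?thesis unfolding Let_def using part1 part2 part3 part4 by blast
qed

end
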